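(* Let $p$ be an odd prime, and let $G$ be a finite $p$-soluble group containing a $p$-central Sylow $p$-subgroup $P$ of height $p-2$. Then $G$ is a $p'pp'$-sandwich group. In particular, $N_G(P)$ controls $p$-fusion in $G$.
   Context: For a finite $p$-group $P$, $\Omega_1(P)=\langle x\in P\mid x^{p}=1\rangle$, and $\zeta_k(P)$ denotes the $k$-th term of the ascending (upper) central series of $P$, with $\zeta_1(P)=\mathrm{Z}(P)$. $P$ is called $p$-central of height $k$ if $\Omega_1(P)\leq\zeta_k(P)$. For a finite group $G$, $O_p(G)$ and $O_{p'}(G)$ denote the largest normal $p$-subgroup and the largest normal subgroup of order prime to $p$, respectively. A $p$-soluble finite group $G$ is called a $p'pp'$-sandwich group if $O_p(G/O_{p'}(G))$ is a Sylow $p$-subgroup of $G/O_{p'}(G)$. A subgroup $H\leq G$ containing a Sylow $p$-subgroup of $G$ controls $p$-fusion in $G$ if for every $p$-subgroup $Q\leq H$ and every $g\in G$ with $gQg^{-1}\leq H$ there is $h\in H$ with $gxg^{-1}=hxh^{-1}$ for all $x\in Q$. *)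

theory Defs
  imports "HOL-Algebra.Algebra" "HOL-Computational_Algebra.Primes"
begin

definition p_group :: "nat \<Rightarrow> ('a, 'b) monoid_scheme \<Rightarrow> bool" where
  "p_group p G \<longleftrightarrow> group G \<and> finite (carrier G) \<and> (\<exists>n. order G = p ^ n)"

definition p'_group :: "nat \<Rightarrow> ('a, 'b) monoid_scheme \<Rightarrow> bool" where
  "p'_group p G \<longleftrightarrow> group G \<and> finite (carrier G) \<and> coprime (order G) p"

definition sylow_subgroup :: "nat \<Rightarrow> 'a set \<Rightarrow> ('a, 'b) monoid_scheme \<Rightarrow> bool" where
  "sylow_subgroup p P G \<longleftrightarrow> subgroup P G \<and> card P = p ^ multiplicity p (order G)"

definition center :: "('a, 'b) monoid_scheme \<Rightarrow> 'a set" where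
  "center G = {z \<in> carrier G. \<forall>g \<in> carrier G. z \<otimes>\<^bsub>G\<^esub> g = g \<otimes>\<^bsub>G\<^esub> z}"

text \<open>The term of index \<open>Suc k\<close> is the full preimage in \<open>G\<close> of the centre of the quotient
  of \<open>G\<close> by the term of index \<open>k\<close>.\<close>

primrec upper_central :: "('a, 'b) monoid_scheme \<Rightarrow> nat \<Rightarrow> 'a set" where
  "upper_central G 0 = {\<one>\<^bsub>G\<^esub>}"
| "upper_central G (Suc k) =
     {x \<in> carrier G. upper_central G k #>\<^bsub>G\<^esub> x \<in> center (G Mod upper_central G k)}"

definition Omega1 :: "nat \<Rightarrow> ('a, 'b) monoid_scheme \<Rightarrow> 'a set" where
  "Omega1 p P = generate P {x \<in> carrier P. x [^]\<^bsub>P\<^esub> p = \<one>\<^bsub>P\<^esub>}"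

definition p_central :: "nat \<Rightarrow> nat \<Rightarrow> ('a, 'b) monoid_scheme \<Rightarrow> bool" where
  "p_central p k P \<longleftrightarrow> p_group p P \<and> Omega1 p P \<subseteq> upper_central P k"

text \<open>A finite group is \<open>p\<close>-soluble if it has a subnormal series each of whose factors is a
  \<open>p\<close>-group or a \<open>p'\<close>-group.\<close>

definition p_soluble :: "nat \<Rightarrow> ('a, 'b) monoid_scheme \<Rightarrow> bool" where
  "p_soluble p G \<longleftrightarrow> group G \<and> finite (carrier G) \<and>
     (\<exists>(n::nat) H. H 0 = {\<one>\<^bsub>G\<^esub>} \<and> H n = carrier G \<and> (\<forall>i \<le> n. subgroup (H i) G) \<and>
        (\<forall>i < n. H i \<lhd> G\<lparr>carrier := H (Suc i)\<rparr> \<and>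
           (p_group p (G\<lparr>carrier := H (Suc i)\<rparr> Mod H i) \<or>
            p'_group p (G\<lparr>carrier := H (Suc i)\<rparr> Mod H i))))"

text \<open>\<open>GREATEST\<close> refers to inclusion. For a finite group and a prime \<open>p\<close> the greatest elements
  exist, see \<open>p_core_greatest\<close> and \<open>p'_core_greatest\<close> below.\<close>

definition p_core :: "nat \<Rightarrow> ('a, 'b) monoid_scheme \<Rightarrow> 'a set" where
  "p_core p G = (GREATEST N. N \<lhd> G \<and> p_group p (G\<lparr>carrier := N\<rparr>))"

definition p'_core :: "nat \<Rightarrow> ('a, 'b) monoid_scheme \<Rightarrow> 'a set" where
  "p'_core p G = (GREATEST N. N \<lhd> G \<and> p'_group p (G\<lparr>carrier := N\<rparr>))"

definition sandwich_group :: "nat \<Rightarrow> ('a, 'b) monoid_scheme \<Rightarrow> bool" where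
  "sandwich_group p G \<longleftrightarrow> p_soluble p G \<and>
     sylow_subgroup p (p_core p (G Mod p'_core p G)) (G Mod p'_core p G)"

definition controls_p_fusion :: "nat \<Rightarrow> 'a set \<Rightarrow> ('a, 'b) monoid_scheme \<Rightarrow> bool" where
  "controls_p_fusion p H G \<longleftrightarrow> subgroup H G \<and> (\<exists>S \<subseteq> H. sylow_subgroup p S G) \<and>
     (\<forall>Q g. subgroup Q G \<and> Q \<subseteq> H \<and> p_group p (G\<lparr>carrier := Q\<rparr>) \<and> g \<in> carrier G \<and>
            g <#\<^bsub>G\<^esub> Q #>\<^bsub>G\<^esub> inv\<^bsub>G\<^esub> g \<subseteq> H \<longrightarrow>
        (\<exists>h \<in> H. \<forall>x \<in> Q. g \<otimes>\<^bsub>G\<^esub> x \<otimes>\<^bsub>G\<^esub> inv\<^bsub>G\<^esub> g = h \<otimes>\<^bsub>G\<^esub> x \<otimes>\<^bsub>G\<^esub> inv\<^bsub>G\<^esub> h))"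

lemma (in group) card_set_mult_dvd:
  assumes fin: "finite (carrier G)" and N: "N \<lhd> G" and M: "subgroup M G"
  shows "card (N <#> M) dvd card N * card M"
proof -
  interpret second_isomorphism_grp N G M
    using N M by (simp add: second_isomorphism_grp_def second_isomorphism_grp_axioms_def)
  have NM: "subgroup (N <#> M) G" by (rule normal_set_mult_subgroup)
  have finNM: "finite (N <#> M)" "finite M"
    using fin NM M by (meson finite_subset subgroup.subset)+
  interpret NM: group "G\<lparr>carrier := N <#> M\<rparr>" by (rule subgroup_imp_group[OF NM])
  interpret M: group "G\<lparr>carrier := M\<rparr>" by (rule subgroup_imp_group[OF M])
  have sN: "subgroup N (G\<lparr>carrier := N <#> M\<rparr>)"
    using H_contained_in_set_mult NM is_subgroup subgroup_incl by blast
  have sI: "subgroup (N \<inter> M) (G\<lparr>carrier := M\<rparr>)"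
    by (metis inf_commute normal_imp_subgroup normal_subgrp_intersection_normal)
  have "card (rcosets\<^bsub>G\<lparr>carrier := N <#> M\<rparr>\<^esub> N) = card (rcosets\<^bsub>G\<lparr>carrier := M\<rparr>\<^esub> (N \<inter> M))"
    using iso_same_card[OF is_isoI[OF normal_intersection_quotient_isom]]
    by (simp add: FactGroup_def)
  moreover have "card (rcosets\<^bsub>G\<lparr>carrier := N <#> M\<rparr>\<^esub> N) * card N = card (N <#> M)"
    using NM.lagrange[OF sN] by (simp add: order_def)
  moreover have "card (rcosets\<^bsub>G\<lparr>carrier := M\<rparr>\<^esub> (N \<inter> M)) dvd card M"
    using M.lagrange[OF sI] dvd_triv_left[of "card (rcosets\<^bsub>G\<lparr>carrier := M\<rparr>\<^esub> (N \<inter> M))"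
        "card (N \<inter> M)"] by (simp add: order_def)
  ultimately show ?thesis by (metis dvd_refl mult.commute mult_dvd_mono)
qed

lemma (in group) normal_Greatest:
  assumes fin: "finite (carrier G)" and one: "Q {\<one>}"
    and cl: "\<And>M N. M \<lhd> G \<Longrightarrow> N \<lhd> G \<Longrightarrow> Q M \<Longrightarrow> Q N \<Longrightarrow> Q (M <#> N)"
  defines "K \<equiv> GREATEST N. N \<lhd> G \<and> Q N"
  shows "K \<lhd> G \<and> Q K \<and> (\<forall>N. N \<lhd> G \<and> Q N \<longrightarrow> N \<subseteq> K)"
proof -
  let ?S = "{N. N \<lhd> G \<and> Q N}"
  have "?S \<subseteq> Pow (carrier G)" using normal_imp_subgroup subgroup.subset by blast
  then have finS: "finite ?S" using fin by (simp add: finite_subset)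
  have "{\<one>} \<in> ?S" using one one_is_normal by simp
  then obtain M where M: "M \<in> ?S" and max: "\<And>N. N \<in> ?S \<Longrightarrow> M \<subseteq> N \<Longrightarrow> N = M"
    using finite_has_maximal[OF finS] by blast
  have le: "N \<subseteq> M" if "N \<lhd> G \<and> Q N" for N
  proof -
    have MN: "M <#> N \<in> ?S" using M that cl normal_subgroup_set_mult_closed by blast
    interpret second_isomorphism_grp M G N
      using M that by (simp add: second_isomorphism_grp_def second_isomorphism_grp_axioms_def
          normal_imp_subgroup)
    show ?thesis using max[OF MN H_contained_in_set_mult] S_contained_in_set_mult by simp
  qed
  have "K = M" unfolding K_def by (rule Greatest_equality) (use M le in auto)
  then show ?thesis using M le by auto
qed

lemma (in group) normal_subgroup_carrier:
  assumes "finite (carrier G)" "N \<lhd> G"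
  shows "group (G\<lparr>carrier := N\<rparr>)" "finite N"
proof -
  have N: "subgroup N G" using assms(2) by (rule normal_imp_subgroup)
  show "group (G\<lparr>carrier := N\<rparr>)" by (rule subgroup_imp_group[OF N])
  show "finite N" by (rule finite_subset[OF subgroup.subset[OF N] assms(1)])
qed

lemma (in group) p_core_greatest:
  assumes fin: "finite (carrier G)" and p: "Factorial_Ring.prime p"
  shows "p_core p G \<lhd> G" "p_group p (G\<lparr>carrier := p_core p G\<rparr>)"
    and "N \<lhd> G \<Longrightarrow> p_group p (G\<lparr>carrier := N\<rparr>) \<Longrightarrow> N \<subseteq> p_core p G"
proof -
  have "p_core p G \<lhd> G \<and> p_group p (G\<lparr>carrier := p_core p G\<rparr>) \<and>
      (\<forall>N. N \<lhd> G \<and> p_group p (G\<lparr>carrier := N\<rparr>) \<longrightarrow> N \<subseteq> p_core p G)"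
    unfolding p_core_def
  proof (rule normal_Greatest[OF fin])
    show "p_group p (G\<lparr>carrier := {\<one>}\<rparr>)"
      unfolding p_group_def using normal_subgroup_carrier[OF fin one_is_normal]
      by (auto simp: order_def intro: exI[of _ 0])
  next
    fix M N
    assume M: "M \<lhd> G" and N: "N \<lhd> G" and "p_group p (G\<lparr>carrier := M\<rparr>)" "p_group p (G\<lparr>carrier := N\<rparr>)"
    then obtain a b where "card M = p ^ a" "card N = p ^ b"
      by (auto simp: p_group_def order_def)
    then have "card (M <#> N) dvd p ^ (a + b)"
      using card_set_mult_dvd[OF fin M normal_imp_subgroup[OF N]] by (simp add: power_add)
    then obtain n where "card (M <#> N) = p ^ n" using p by (auto simp: divides_primepow_nat)
    then show "p_group p (G\<lparr>carrier := M <#> N\<rparr>)"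
      unfolding p_group_def
      using normal_subgroup_carrier[OF fin normal_subgroup_set_mult_closed[OF M N]]
      by (auto simp: order_def)
  qed
  then show "p_core p G \<lhd> G" "p_group p (G\<lparr>carrier := p_core p G\<rparr>)"
    "N \<lhd> G \<Longrightarrow> p_group p (G\<lparr>carrier := N\<rparr>) \<Longrightarrow> N \<subseteq> p_core p G" by auto
qed

lemma (in group) p'_core_greatest:
  assumes fin: "finite (carrier G)"
  shows "p'_core p G \<lhd> G" "p'_group p (G\<lparr>carrier := p'_core p G\<rparr>)"
    and "N \<lhd> G \<Longrightarrow> p'_group p (G\<lparr>carrier := N\<rparr>) \<Longrightarrow> N \<subseteq> p'_core p G"
proof -
  have "p'_core p G \<lhd> G \<and> p'_group p (G\<lparr>carrier := p'_core p G\<rparr>) \<and>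
      (\<forall>N. N \<lhd> G \<and> p'_group p (G\<lparr>carrier := N\<rparr>) \<longrightarrow> N \<subseteq> p'_core p G)"
    unfolding p'_core_def
  proof (rule normal_Greatest[OF fin])
    show "p'_group p (G\<lparr>carrier := {\<one>}\<rparr>)"
      unfolding p'_group_def using normal_subgroup_carrier[OF fin one_is_normal]
      by (auto simp: order_def)
  next
    fix M N
    assume M: "M \<lhd> G" and N: "N \<lhd> G" and "p'_group p (G\<lparr>carrier := M\<rparr>)" "p'_group p (G\<lparr>carrier := N\<rparr>)"
    then have "coprime (card M * card N) p"
      by (auto simp: p'_group_def order_def)
    then have "coprime (card (M <#> N)) p"
      using card_set_mult_dvd[OF fin M normal_imp_subgroup[OF N]]
      by (metis coprime_divisors dvd_refl)
    then show "p'_group p (G\<lparr>carrier := M <#> N\<rparr>)"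
      unfolding p'_group_def
      using normal_subgroup_carrier[OF fin normal_subgroup_set_mult_closed[OF M N]]
      by (auto simp: order_def)
  qed
  then show "p'_core p G \<lhd> G" "p'_group p (G\<lparr>carrier := p'_core p G\<rparr>)"
    "N \<lhd> G \<Longrightarrow> p'_group p (G\<lparr>carrier := N\<rparr>) \<Longrightarrow> N \<subseteq> p'_core p G" by auto
qed

end

theory Submission
  imports Defs "HOL-Library.Function_Algebras"
begin

text \<open>After dividing by \<open>O\<^sub>p\<^sub>'(G)\<close>, let \<open>T = O\<^sub>p(G)\<close> and let \<open>R/T\<close> be the largest normal \<open>p'\<close>-subgroup of \<open>G/T\<close>.
  By the arguments of Hall and Higman, \<open>p\<close>-solubility gives \<open>C\<^sub>G(T) \<le> T\<close>, and \<open>P = T\<close> follows once \<open>[P, R] \<le> T\<close>.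
  Let \<open>x \<in> P\<close> and \<open>r \<in> R\<close>. As \<open>p\<close> is odd, a \<open>p'\<close>-element which centralises \<open>\<Omega>\<^sub>1(T)\<close> centralises \<open>T\<close> and lies in \<open>T\<close>,
  so it suffices that \<open>[x, r]\<close> acts trivially on the factors of a series of \<open>\<Omega>\<^sub>1(T)\<close>.

  Inside the character group of an invariant subgroup choose an irreducible module \<open>U\<close> for \<open>R\<close> and \<open>x\<close>. Here \<open>R\<close>
  acts as a \<open>p'\<close>-group \<open>Q\<close> normalised by \<open>x\<close>, and \<open>N = x - 1\<close> satisfies \<open>N^(p-2) = 0\<close> since \<open>\<Omega>\<^sub>1(T) \<le> \<zeta>\<^sub>p\<^sub>-\<^sub>2(P)\<close>.
  The claim is \<open>x = 1\<close> on \<open>U\<close>. Schur's lemma and a Weyl relation show that \<open>x\<close> commutes with all \<open>Q\<close>-endomorphisms,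
  so \<open>N\<close> lies in the image of the group ring of \<open>Q\<close>, with coefficients constant on the orbits of conjugation by
  \<open>x\<close>. On the kernel of \<open>N\<^sup>2\<close> the orbits of length \<open>p\<close> cancel, which leaves an element of the group ring of
  \<open>C\<^sub>Q(x)\<close>; an equivariant complement of the kernel of \<open>N\<close> then gives \<open>N = 0\<close>.\<close>

section \<open>Equivariant projections\<close>

text \<open>The exponent \<open>p - 2\<close> comes from a single sum. On the kernel of
  \<open>N^2\<close>, the conjugate of \<open>q\<close> by \<open>x^i\<close> sends \<open>u\<close>
  to \<open>x^i q (u - i N u)\<close>. With \<open>N^(p-2) = 0\<close> the iterates of
  \<open>x\<close> are polynomial in \<open>i\<close> of degree at most \<open>p - 3\<close>, and
  the factor \<open>i\<close> raises this to at most \<open>p - 2\<close>. Polynomials of degree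
  below \<open>p - 1\<close> sum to zero over Z/p; degree \<open>p - 1\<close> is the first that
  does not.

  The obstacle is the field. \<open>U\<close> is irreducible only for \<open>R\<close> and
  \<open>x\<close> together, and F_p need not split it. Instead of extending scalars, the proof
  shows that \<open>x\<close> centralises all \<open>Q\<close>-endomorphisms; the double centraliser
  theorem over F_p then expresses \<open>N\<close> by \<open>Q\<close>, and a central idempotent
  makes the coefficients invariant under \<open>x\<close>.

  Characters are used because subspaces of Hom(B, Q/Z) are dual to elementary abelian quotients of
  \<open>B\<close>. A minimal subspace with common kernel \<open>B0\<close> stands for the section
  B/B0, which is never formed, and \<open>B\<close> may be non-abelian.\<close>

definition nscale :: "nat \<Rightarrow> 'v::ab_group_add \<Rightarrow> 'v" where
  "nscale n v = (\<Sum>i<n. v)"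

text \<open>With \<open>p\<close> a variable, vector spaces over F_p are handled as Z-modules
  annihilated by \<open>zscale p\<close>; their subspaces are then just subgroups.\<close>

definition zscale :: "int \<Rightarrow> 'v::ab_group_add \<Rightarrow> 'v" where
  "zscale k v = nscale (nat k) v - nscale (nat (- k)) v"

lemma nscale_simps [simp]: "nscale 0 v = 0" "nscale (Suc n) v = v + nscale n v" "nscale n 0 = 0"
  by (simp_all add: nscale_def add.commute)

lemma nscale_add: "nscale (m + n) v = nscale m v + nscale n v"
  by (induction m) (simp_all add: add.assoc)

lemma nscale_add_right: "nscale n (u + v) = nscale n u + nscale n v"
  by (simp add: nscale_def sum.distrib)

lemma nscale_mult: "nscale (m * n) v = nscale m (nscale n v)"
  by (induction m) (simp_all add: nscale_add)

lemma nscale_diff_right: "nscale n (u - v) = nscale n u - nscale n v"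
  by (simp add: nscale_def sum_subtractf)

text \<open>Independence of the chosen difference allows the module axioms to be checked on pairs of
  natural numbers, with no case distinction on signs.\<close>

lemma zscale_diff: "zscale (int m - int n) v = nscale m v - nscale n v"
proof (cases "n \<le> m")
  case True
  then obtain d where "m = n + d" using le_Suc_ex by blast
  then show ?thesis by (simp add: zscale_def nscale_add)
next
  case False
  then obtain d where "n = m + d" using le_Suc_ex nat_le_linear by blast
  then show ?thesis by (simp add: zscale_def nscale_add)
qed

interpretation zm: Modules.module "zscale :: int \<Rightarrow> 'v::ab_group_add \<Rightarrow> 'v"
proof
  fix a b :: int and x y :: 'v
  obtain m n where a: "a = int m - int n" by (metis diff_0 int_diff_cases)
  obtain k l where b: "b = int k - int l" by (metis diff_0 int_diff_cases)
  show "zscale a (x + y) = zscale a x + zscale a y"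
    unfolding a zscale_diff by (simp add: nscale_add_right)
  have "a + b = int (m + k) - int (n + l)" using a b by simp
  then have "zscale (a + b) x = nscale (m + k) x - nscale (n + l) x" by (simp only: zscale_diff)
  then show "zscale (a + b) x = zscale a x + zscale b x"
    unfolding a b zscale_diff by (simp add: nscale_add)
  have "a * b = int (m * k + n * l) - int (m * l + n * k)" unfolding a b by (simp add: algebra_simps)
  then have "zscale (a * b) x = nscale (m * k + n * l) x - nscale (m * l + n * k) x"
    by (simp only: zscale_diff)
  then show "zscale a (zscale b x) = zscale (a * b) x"
    unfolding a b zscale_diff
    by (simp only: nscale_add nscale_mult nscale_diff_right) (simp add: algebra_simps)
  show "zscale 1 x = x" by (simp add: zscale_def)
qed

lemma zscale_dvd:
  assumes "zscale p v = 0" "p dvd k" shows "zscale k v = 0"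
proof -
  obtain j where "k = j * p" using assms(2) by (metis dvdE mult.commute)
  then have "zscale k v = zscale j (zscale p v)" by simp
  then show ?thesis using assms(1) by simp
qed

lemma zscale_cong:
  assumes "zscale p v = 0" "p dvd k - l" shows "zscale k v = zscale l v"
  using zscale_dvd[OF assms] by (simp add: zm.scale_left_diff_distrib)

lemma inverse_mod_prime:
  assumes "Factorial_Ring.prime (p::nat)" "\<not> int p dvd k"
  obtains c where "int p dvd c * k - 1"
proof -
  have "coprime (int p) k" using assms by (simp add: prime_imp_coprime)
  then obtain c d where "c * k + d * int p = 1" by (metis bezout_int coprime_imp_gcd_eq_1 gcd.commute)
  then have "c * k - 1 = int p * (- d)" by (simp add: algebra_simps)
  then show ?thesis using that by (metis dvd_triv_left)
qed

section \<open>Additive maps between subgroups, projections and averaging\<close>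

definition ahom :: "'v::ab_group_add set \<Rightarrow> 'w::ab_group_add set \<Rightarrow> ('v \<Rightarrow> 'w) \<Rightarrow> bool" where
  "ahom U W f \<longleftrightarrow> (\<forall>u \<in> U. f u \<in> W) \<and> (\<forall>u \<in> U. \<forall>v \<in> U. f (u + v) = f u + f v)"

lemma ahom_closed: "ahom U W f \<Longrightarrow> u \<in> U \<Longrightarrow> f u \<in> W"
  by (auto simp: ahom_def)

lemma ahom_add: "ahom U W f \<Longrightarrow> u \<in> U \<Longrightarrow> v \<in> U \<Longrightarrow> f (u + v) = f u + f v"
  by (auto simp: ahom_def)

lemma ahomI: "(\<And>u. u \<in> U \<Longrightarrow> f u \<in> W) \<Longrightarrow> (\<And>u v. u \<in> U \<Longrightarrow> v \<in> U \<Longrightarrow> f (u + v) = f u + f v) \<Longrightarrow> ahom U W f"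
  by (auto simp: ahom_def)

context
  fixes U :: "'v::ab_group_add set" and W :: "'w::ab_group_add set" and f
  assumes U: "zm.subspace U" and f: "ahom U W f"
begin

lemma ahom_zero: "f 0 = 0"
proof -
  have "f (0 + 0) = f 0 + f 0" by (rule ahom_add[OF f zm.subspace_0[OF U] zm.subspace_0[OF U]])
  then show ?thesis by simp
qed

lemma ahom_minus: assumes u: "u \<in> U" shows "f (- u) = - f u"
proof -
  have "f (u + - u) = f u + f (- u)" by (rule ahom_add[OF f u zm.subspace_neg[OF U u]])
  then have "f u + f (- u) = 0" using ahom_zero by simp
  then show ?thesis by (metis minus_unique)
qed

lemma ahom_diff: assumes "u \<in> U" "v \<in> U" shows "f (u - v) = f u - f v"
proof -
  have "f (u + - v) = f u + f (- v)" by (rule ahom_add[OF f assms(1) zm.subspace_neg[OF U assms(2)]])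
  then show ?thesis using ahom_minus assms by simp
qed

lemma ahom_sum: assumes "\<And>i. i \<in> I \<Longrightarrow> g i \<in> U" shows "f (\<Sum>i\<in>I. g i) = (\<Sum>i\<in>I. f (g i))"
  using assms
proof (induction I rule: infinite_finite_induct)
  case (insert i I)
  have "sum g I \<in> U" by (rule zm.subspace_sum[OF U]) (use insert in auto)
  then show ?case using insert ahom_add[OF f, of "g i" "sum g I"] by simp
qed (simp_all add: ahom_zero)

lemma ahom_scale: assumes u: "u \<in> U" shows "f (zscale k u) = zscale k (f u)"
proof -
  have n: "nscale n u \<in> U" "f (nscale n u) = nscale n (f u)" for n
    unfolding nscale_def using ahom_sum[of "{..<n}" "\<lambda>_. u"] u zm.subspace_sum[OF U, of "{..<n}" "\<lambda>_. u"] by simp_all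
  show ?thesis unfolding zscale_def using n by (simp add: ahom_diff)
qed

end

lemma ahom_comp: "ahom U V f \<Longrightarrow> ahom V W g \<Longrightarrow> ahom U W (\<lambda>u. g (f u))"
  by (auto simp: ahom_def)

lemma ahom_minus_fun: "zm.subspace W \<Longrightarrow> ahom U W f \<Longrightarrow> ahom U W g \<Longrightarrow> ahom U W (\<lambda>u. f u - g u)"
  unfolding ahom_def by (auto simp: image_subset_iff zm.subspace_diff algebra_simps)

lemma ahom_scale_fun: "zm.subspace W \<Longrightarrow> ahom U W f \<Longrightarrow> ahom U W (\<lambda>u. zscale k (f u))"
  unfolding ahom_def by (auto simp: image_subset_iff zm.subspace_scale zm.scale_right_distrib)

lemma ahom_sum_fun: "zm.subspace W \<Longrightarrow> (\<And>i. i \<in> I \<Longrightarrow> ahom U W (f i)) \<Longrightarrow> ahom U W (\<lambda>u. \<Sum>i\<in>I. f i u)"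
  unfolding ahom_def by (auto intro!: zm.subspace_sum sum.cong simp: sum.distrib[symmetric])

lemma ahom_id: "ahom U U (\<lambda>u. u)"
  by (auto simp: ahom_def)

text \<open>A subspace \<open>K\<close> maximal among those meeting \<open>M\<close> trivially is a
  complement. If \<open>w\<close> were outside \<open>K + M\<close>, then \<open>K\<close> enlarged
  by \<open>w\<close> would still meet \<open>M\<close> trivially: in an element of the intersection
  the coefficient of \<open>w\<close> is zero modulo \<open>p\<close>, since otherwise it is
  invertible and \<open>w\<close> lies in \<open>K + M\<close>.\<close>

lemma exists_projection:
  fixes V M :: "'v::ab_group_add set"
  assumes p: "Factorial_Ring.prime (p::nat)" and V: "zm.subspace V" "finite V" "\<And>u. u \<in> V \<Longrightarrow> zscale (int p) u = 0"
    and M: "zm.subspace M" "M \<subseteq> V"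
  shows "\<exists>l. ahom V M l \<and> (\<forall>m \<in> M. l m = m)"
proof -
  define S where "S = {K. zm.subspace K \<and> K \<subseteq> V \<and> K \<inter> M \<subseteq> {0}}"
  have fin: "finite S" by (rule finite_subset[of _ "Pow V"]) (use V S_def in auto)
  have "zm.subspace {0::'v}" by (rule zm.subspaceI) auto
  then have "{0} \<in> S" unfolding S_def using zm.subspace_0[OF V(1)] by simp
  then obtain K where K: "K \<in> S" and max: "\<And>L. L \<in> S \<Longrightarrow> K \<subseteq> L \<Longrightarrow> L = K"
    using finite_has_maximal[OF fin] by blast
  have sK: "zm.subspace K" and KX: "K \<subseteq> V" and KM: "K \<inter> M \<subseteq> {0}" using K by (auto simp: S_def)
  have dec: "\<exists>k \<in> K. \<exists>m \<in> M. w = k + m" if w: "w \<in> V" for w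
  proof (rule ccontr)
    assume n: "\<not> ?thesis"
    let ?L = "{k + zscale i w | k i. k \<in> K}"
    have sL: "zm.subspace ?L"
    proof (rule zm.subspaceI)
      show "0 \<in> ?L" using zm.subspace_0[OF sK] by (auto intro!: exI[of _ 0])
    next
      fix x y assume "x \<in> ?L" "y \<in> ?L"
      then obtain k i l j where "k \<in> K" "l \<in> K" "x = k + zscale i w" "y = l + zscale j w" by auto
      then have "x + y = (k + l) + zscale (i + j) w" "k + l \<in> K"
        by (auto simp: zm.scale_left_distrib algebra_simps zm.subspace_add[OF sK])
      then show "x + y \<in> ?L" by auto
    next
      fix c x assume "x \<in> ?L"
      then obtain k i where "k \<in> K" "x = k + zscale i w" by auto
      then have "zscale c x = zscale c k + zscale (c * i) w" "zscale c k \<in> K"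
        by (auto simp: zm.scale_right_distrib zm.subspace_scale[OF sK])
      then show "zscale c x \<in> ?L" by auto
    qed
    have LV: "?L \<subseteq> V" using KX w V(1) by (auto intro!: zm.subspace_add zm.subspace_scale)
    have LM: "?L \<inter> M \<subseteq> {0}"
    proof
      fix m assume "m \<in> ?L \<inter> M"
      then obtain k i where k: "k \<in> K" and m: "m = k + zscale i w" "m \<in> M" by auto
      show "m \<in> {0}"
      proof (cases "int p dvd i")
        case True
        then have "m = k" using m zscale_dvd[OF V(3)[OF w]] by simp
        then show ?thesis using k m KM by auto
      next
        case False
        then obtain c where "int p dvd c * i - 1" using inverse_mod_prime p by blast
        then have "zscale (c * i) w = zscale 1 w" by (rule zscale_cong[OF V(3)[OF w]])
        then have "w = zscale c (zscale i w)" by simp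
        also have "\<dots> = zscale (- c) k + zscale c m"
          using m(1) by (simp add: zm.scale_right_distrib)
        finally have "w = zscale (- c) k + zscale c m" .
        moreover have "zscale (- c) k \<in> K" "zscale c m \<in> M"
          using zm.subspace_scale[OF sK k] zm.subspace_scale[OF M(1) m(2)] by blast+
        ultimately show ?thesis using n by metis
      qed
    qed
    have KL: "K \<subseteq> ?L"
    proof
      fix k assume "k \<in> K"
      moreover have "k = k + zscale 0 w" by simp
      ultimately show "k \<in> ?L" by blast
    qed
    have "?L \<in> S" unfolding S_def by (rule CollectI) (intro conjI sL LV LM)
    then have LK: "?L = K" using KL by (rule max)
    have "0 + zscale 1 w \<in> ?L" using zm.subspace_0[OF sK] by blast
    then have "w \<in> K" unfolding LK by simp
    then show False using n zm.subspace_0[OF M(1)] by (metis add.right_neutral)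
  qed
  have uniq: "m = m'" if "k \<in> K" "k' \<in> K" "m \<in> M" "m' \<in> M" "k + m = k' + m'" for k k' m m'
  proof -
    have "k - k' = m' - m" using that(5) by (simp add: algebra_simps)
    moreover have "k - k' \<in> K" "m' - m \<in> M" using that sK M(1) by (auto intro: zm.subspace_diff)
    ultimately have "m' - m = 0" using KM by auto
    then show ?thesis by simp
  qed
  define l where "l w = (THE m. m \<in> M \<and> (\<exists>k \<in> K. w = k + m))" for w
  have l: "l (k + m) = m" if "k \<in> K" "m \<in> M" for k m
    unfolding l_def using that uniq by (intro the_equality) auto
  have "ahom V M l"
  proof (rule ahomI)
    fix u assume "u \<in> V" then show "l u \<in> M" using dec[OF \<open>u \<in> V\<close>] l by auto
  next
    fix u v assume "u \<in> V" "v \<in> V"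
    then obtain k m k' m' where *: "k \<in> K" "m \<in> M" "u = k + m" "k' \<in> K" "m' \<in> M" "v = k' + m'"
      using dec by metis
    then have "u + v = (k + k') + (m + m')" by (simp add: algebra_simps)
    then have "l (u + v) = m + m'" using l zm.subspace_add[OF sK *(1,4)] zm.subspace_add[OF M(1) *(2,5)] by simp
    then show "l (u + v) = l u + l v" using l * by simp
  qed
  moreover have "l m = m" if "m \<in> M" for m using l[of 0 m] zm.subspace_0[OF sK] that by simp
  ultimately show ?thesis by blast
qed

text \<open>Permutations of the whole type, so that composition and \<open>inv_into UNIV\<close>
  serve as the group operations. An action on a subset enters by extending each map by the
  identity.\<close>

definition perm_group :: "('v \<Rightarrow> 'v) set \<Rightarrow> bool" where
  "perm_group Q \<longleftrightarrow> finite Q \<and> id \<in> Q \<and> (\<forall>q \<in> Q. \<forall>r \<in> Q. q \<circ> r \<in> Q) \<and> (\<forall>q \<in> Q. bij q \<and> inv_into UNIV q \<in> Q)"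

lemma perm_groupD:
  assumes "perm_group Q"
  shows "finite Q" "id \<in> Q" "q \<in> Q \<Longrightarrow> r \<in> Q \<Longrightarrow> q \<circ> r \<in> Q" "q \<in> Q \<Longrightarrow> bij q" "q \<in> Q \<Longrightarrow> inv_into UNIV q \<in> Q"
  using assms by (auto simp: perm_group_def)

lemma perm_group_bij:
  assumes Q: "perm_group Q" and q: "q \<in> Q"
  shows "bij_betw (\<lambda>r. q \<circ> r) Q Q"
proof (rule bij_betw_byWitness[where f' = "\<lambda>r. inv_into UNIV q \<circ> r"])
  have b: "bij q" using perm_groupD[OF Q] q by auto
  show "\<forall>a\<in>Q. inv_into UNIV q \<circ> (q \<circ> a) = a" using b by (auto simp: fun_eq_iff bij_is_inj)
  show "\<forall>a\<in>Q. q \<circ> (inv_into UNIV q \<circ> a) = a" using b by (auto simp: fun_eq_iff bij_is_surj surj_f_inv_f)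
  show "(\<circ>) q ` Q \<subseteq> Q" "(\<circ>) (inv_into UNIV q) ` Q \<subseteq> Q" using perm_groupD[OF Q] q by auto
qed

text \<open>Maschke's theorem: average \<open>q l q^-1\<close> over \<open>Q\<close> and divide by
  \<open>card Q\<close>, which is invertible modulo \<open>p\<close>. The action \<open>a\<close> is
  kept abstract because the lemma is used for evaluation on \<open>U\<close> and also for
  post-composition on a space of functions.\<close>

lemma equivariant_projection:
  fixes V M :: "'x::ab_group_add set" and Q :: "('v \<Rightarrow> 'v) set"
  assumes p: "Factorial_Ring.prime (p::nat)" and V: "zm.subspace V" "finite V" "\<And>u. u \<in> V \<Longrightarrow> zscale (int p) u = 0"
    and M: "zm.subspace M" "M \<subseteq> V"
    and Q: "perm_group Q" "coprime (card Q) p"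
    and a: "\<And>q. q \<in> Q \<Longrightarrow> ahom V V (a q)" "\<And>q r u. q \<in> Q \<Longrightarrow> r \<in> Q \<Longrightarrow> u \<in> V \<Longrightarrow> a (q \<circ> r) u = a q (a r u)"
      "\<And>u. u \<in> V \<Longrightarrow> a id u = u" "\<And>q m. q \<in> Q \<Longrightarrow> m \<in> M \<Longrightarrow> a q m \<in> M"
  obtains \<pi> where "ahom V M \<pi>" "\<And>m. m \<in> M \<Longrightarrow> \<pi> m = m" "\<And>q u. q \<in> Q \<Longrightarrow> u \<in> V \<Longrightarrow> \<pi> (a q u) = a q (\<pi> u)"
proof -
  obtain l where l: "ahom V M l" "\<And>m. m \<in> M \<Longrightarrow> l m = m" using exists_projection[OF p V M] by blast
  note QD = perm_groupD[OF Q(1)]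
  have "\<not> int p dvd int (card Q)" using Q(2) p
    by (auto dest: coprime_common_divisor[of _ _ p])
  then obtain c where c: "int p dvd c * int (card Q) - 1" using inverse_mod_prime p by blast
  define s where "s u = (\<Sum>q\<in>Q. a q (l (a (inv_into UNIV q) u)))" for u
  define \<pi> where "\<pi> u = zscale c (s u)" for u
  have aM: "ahom M M (a q)" if "q \<in> Q" for q
    using a(1)[OF that] a(4)[OF that] M(2) unfolding ahom_def by blast
  have hs: "ahom V M s"
    unfolding s_def
    by (intro ahom_sum_fun[OF M(1)] ahom_comp[OF ahom_comp[OF a(1) l(1)] aM]) (use QD in auto)
  then have h: "ahom V M \<pi>" unfolding \<pi>_def by (intro ahom_scale_fun[OF M(1)])
  have fix_s: "\<pi> m = m" if m: "m \<in> M" for m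
  proof -
    have "a q (l (a (inv_into UNIV q) m)) = m" if q: "q \<in> Q" for q
    proof -
      have "l (a (inv_into UNIV q) m) = a (inv_into UNIV q) m" using l(2) a(4) QD q m by auto
      then have "a q (l (a (inv_into UNIV q) m)) = a (q \<circ> inv_into UNIV q) m" using a(2) QD q m M(2) by auto
      also have "q \<circ> inv_into UNIV q = id" using QD(4)[OF q] bij_is_surj surj_iff by blast
      finally show ?thesis using a(3)[OF subsetD[OF M(2) m]] by (simp only:)
    qed
    then have "s m = (\<Sum>q\<in>Q. m)" unfolding s_def by (intro sum.cong) auto
    then have "s m = zscale (int (card Q)) m" by (simp only: zm.sum_constant_scale)
    then have "\<pi> m = zscale (c * int (card Q)) m" unfolding \<pi>_def by simp
    also have "\<dots> = zscale 1 m" by (rule zscale_cong[OF V(3) c]) (use m M in auto)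
    finally show ?thesis by simp
  qed
  have eq: "\<pi> (a r u) = a r (\<pi> u)" if r: "r \<in> Q" and u: "u \<in> V" for r u
  proof -
    have lV: "l (a (inv_into UNIV q) u) \<in> V" if q: "q \<in> Q" for q
      using ahom_closed[OF l(1) ahom_closed[OF a(1)[OF QD(5)[OF q]] u]] M(2) by auto
    then have mem: "a q (l (a (inv_into UNIV q) u)) \<in> V" if "q \<in> Q" for q
      using ahom_closed[OF a(1)[OF that]] that by auto
    have "s (a r u) = (\<Sum>q\<in>Q. a (r \<circ> q) (l (a (inv_into UNIV (r \<circ> q)) (a r u))))"
      unfolding s_def by (rule sum.reindex_bij_betw[OF perm_group_bij[OF Q(1) r], symmetric])
    also have "\<dots> = (\<Sum>q\<in>Q. a r (a q (l (a (inv_into UNIV q) u))))"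
    proof (rule sum.cong[OF refl])
      fix q assume q: "q \<in> Q"
      have e: "inv_into UNIV (r \<circ> q) \<circ> r = inv_into UNIV q"
        using o_inv_distrib[OF QD(4)[OF r] QD(4)[OF q]] inv_o_cancel[OF bij_is_inj[OF QD(4)[OF r]]]
        by (metis comp_assoc comp_id)
      have "a (inv_into UNIV (r \<circ> q)) (a r u) = a (inv_into UNIV (r \<circ> q) \<circ> r) u"
        using a(2)[OF QD(5)[OF QD(3)[OF r q]] r u] by simp
      then have "a (inv_into UNIV (r \<circ> q)) (a r u) = a (inv_into UNIV q) u" using e by simp
      then show "a (r \<circ> q) (l (a (inv_into UNIV (r \<circ> q)) (a r u))) = a r (a q (l (a (inv_into UNIV q) u)))"
        using a(2)[OF r q lV[OF q]] by simp
    qed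
    also have "\<dots> = a r (s u)" unfolding s_def using ahom_sum[OF V(1) a(1)[OF r], of Q] mem by simp
    finally have "s (a r u) = a r (s u)" .
    moreover have "s u \<in> V" using ahom_closed[OF hs u] M(2) by auto
    ultimately show ?thesis unfolding \<pi>_def using ahom_scale[OF V(1) a(1)[OF r]] by simp
  qed
  show ?thesis using that h fix_s eq by blast
qed

text \<open>Orbits of a fixed-point-free permutation with \<open>s ^^ p = id\<close> have exactly
  \<open>p\<close> elements because \<open>p\<close> is prime; the induction splits off one orbit at
  a time. The set \<open>W\<close> is a parameter so that the same lemma counts points modulo
  \<open>p\<close> and annihilates vector sums.\<close>

lemma sum_over_free_orbits:
  fixes F :: "'q \<Rightarrow> 'w::comm_monoid_add"
  assumes p: "Factorial_Ring.prime (p::nat)"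
    and W: "0 \<in> W" "\<And>a b. a \<in> W \<Longrightarrow> b \<in> W \<Longrightarrow> a + b \<in> W"
  shows "finite S \<Longrightarrow> bij_betw s S S \<Longrightarrow> (\<And>q. q \<in> S \<Longrightarrow> (s ^^ p) q = q) \<Longrightarrow> (\<And>q. q \<in> S \<Longrightarrow> s q \<noteq> q) \<Longrightarrow>
    (\<And>q. q \<in> S \<Longrightarrow> (\<Sum>i<p. F ((s ^^ i) q)) \<in> W) \<Longrightarrow> sum F S \<in> W"
proof (induction "card S" arbitrary: S rule: less_induct)
  case less
  show ?case
  proof (cases "S = {}")
    case True then show ?thesis using W by simp
  next
    case False
    then obtain q where q: "q \<in> S" by blast
    have sS: "s ` S = S" and inj: "inj_on s S" using less.prems(2) by (auto simp: bij_betw_def)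
    have clo: "(s ^^ i) r \<in> S" if "r \<in> S" for i r using that sS by (induction i) auto
    have mult: "(s ^^ (k * n)) r = r" if "(s ^^ n) r = r" for k n r
      using that by (induction k) (auto simp: funpow_add)
    have cancel: "r = t" if "(s ^^ i) r = (s ^^ i) t" "r \<in> S" "t \<in> S" for i r t
      using that
    proof (induction i)
      case (Suc i)
      then show ?case using inj_onD[OF inj, of "(s ^^ i) r" "(s ^^ i) t"] clo by auto
    qed simp
    have free: "(s ^^ a) r \<noteq> r" if "r \<in> S" "0 < a" "a < p" for a r
    proof
      assume eq: "(s ^^ a) r = r"
      note h = that
      \<comment> \<open>Bezout: \<open>s ^^ a\<close> and \<open>s ^^ p\<close> both fix
        \<open>r\<close>, hence so does \<open>s\<close> itself, which is excluded.\<close>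
      have "coprime a p" using h p by (metis coprime_commute nat_dvd_not_less prime_imp_coprime)
      then obtain k l where kl: "a * k = p * l + 1"
        using h(2) bezout_nat[of a p] by (metis coprime_imp_gcd_eq_1 less_numeral_extra(3))
      have "(s ^^ (k * a)) r = r" by (rule mult[OF eq])
      moreover have "(s ^^ (k * a)) r = s ((s ^^ (l * p)) r)" using kl by (simp add: mult.commute)
      moreover have "(s ^^ (l * p)) r = r" by (rule mult[OF less.prems(3)[OF h(1)]])
      ultimately show False using less.prems(4)[OF h(1)] by simp
    qed
    have inji: "inj_on (\<lambda>i. (s ^^ i) q) {..<p}"
    proof (rule linorder_inj_onI)
      fix i j :: nat assume ij: "i < j" "i \<in> {..<p}" "j \<in> {..<p}"
      have "(s ^^ j) q = (s ^^ i) ((s ^^ (j - i)) q)" using ij(1) by (metis funpow_add comp_apply le_add_diff_inverse less_imp_le)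
      then show "(s ^^ i) q \<noteq> (s ^^ j) q"
        using cancel[of i q "(s ^^ (j - i)) q"] clo[OF q] free[OF q, of "j - i"] ij q
          less_imp_diff_less[of j p i] by auto
    qed auto
    define orb where "orb = (\<lambda>i. (s ^^ i) q) ` {..<p}"
    have OS: "orb \<subseteq> S" using clo[OF q] by (auto simp: orb_def)
    have fO: "finite orb" by (simp add: orb_def)
    have p0: "0 < p" using p prime_gt_0_nat by auto
    have qO: "q \<in> orb" unfolding orb_def by (rule image_eqI[of _ _ 0]) (use p0 in auto)
    have "s ((s ^^ i) q) \<in> orb" if "i < p" for i
    proof (cases "Suc i < p")
      case True then show ?thesis unfolding orb_def by (intro image_eqI[of _ _ "Suc i"]) auto
    next
      case False
      then have "Suc i = p" using that by simp
      then have "s ((s ^^ i) q) = q" using less.prems(3)[OF q] by auto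
      then show ?thesis using qO by simp
    qed
    then have "s ` orb \<subseteq> orb" by (auto simp: orb_def)
    then have sO': "s ` orb = orb"
      using endo_inj_surj[OF fO _ inj_on_subset[OF inj OS]] by blast
    have "bij_betw s (S - orb) (S - orb)"
      unfolding bij_betw_def using inj_on_subset[OF inj, of "S - orb"] inj_on_image_set_diff[OF inj, of S orb] sO' sS OS by auto
    moreover have "card (S - orb) < card S"
      using q qO by (intro psubset_card_mono[OF less.prems(1)]) blast
    ultimately have "sum F (S - orb) \<in> W" using less.prems(1,3,4,5) by (intro less.hyps) simp_all
    moreover have "sum F orb \<in> W"
      using less.prems(5)[OF q] by (simp add: orb_def sum.reindex[OF inji])
    moreover have "sum F S = sum F (S - orb) + sum F orb" by (rule sum.subset_diff[OF OS less.prems(1)])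
    ultimately show ?thesis using W(2) by simp
  qed
qed

text \<open>By the hockey-stick identity the first sum is \<open>p choose (j + 1)\<close>. For the
  second, \<open>(i + 1) (i choose j) = (j + 1) (i + 1 choose j + 1)\<close> leads to the lower
  indices \<open>j + 1\<close> and \<open>j + 2\<close>; the bound on \<open>j\<close> keeps both
  strictly between 0 and \<open>p\<close>.\<close>

lemma dvd_sum_choose:
  assumes p: "Factorial_Ring.prime (p::nat)" and j: "j + 2 < p"
  shows "p dvd (\<Sum>i<p. i choose j)" "p dvd (\<Sum>i<p. i * (i choose j))"
proof -
  obtain n where n: "p = Suc n" using j by (metis less_nat_zero_code not0_implies_Suc)
  have ch: "p dvd p choose k" if "0 < k" "k < p" for k
    using that p by (intro dvd_choose_prime) auto
  have "(\<Sum>i<p. i choose j) = p choose Suc j"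
    unfolding n using sum_choose_upper[of j n] by (simp add: lessThan_Suc_atMost atLeast0AtMost)
  then show 1: "p dvd (\<Sum>i<p. i choose j)" using ch[of "Suc j"] j by simp
  have "(\<Sum>i<p. Suc i choose Suc j) = (\<Sum>i\<le>p. i choose Suc j)"
    by (simp add: sum.atMost_shift)
  also have "\<dots> = Suc p choose Suc (Suc j)"
    using sum_choose_upper[of "Suc j" p] by (simp add: atLeast0AtMost)
  also have "\<dots> = (p choose Suc j) + (p choose Suc (Suc j))" by simp
  finally have 2: "p dvd (\<Sum>i<p. Suc i choose Suc j)" using ch[of "Suc j"] ch[of "Suc (Suc j)"] j by simp
  have "(\<Sum>i<p. i * (i choose j)) + (\<Sum>i<p. i choose j) = (\<Sum>i<p. Suc i * (i choose j))"
    by (simp add: sum.distrib[symmetric] add.commute)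
  also have "\<dots> = Suc j * (\<Sum>i<p. Suc i choose Suc j)"
    by (simp only: Suc_times_binomial_eq sum_distrib_left mult.commute)
  finally show "p dvd (\<Sum>i<p. i * (i choose j))"
    using 1 2 by (metis dvd_add_left_iff dvd_mult)
qed

text \<open>Coefficient vectors of a projection modulo \<open>p\<close> onto \<open>I\<close>, given by the images of the unit vectors.\<close>

lemma exists_projection_coeffs:
  fixes I :: "('q \<Rightarrow> int) set"
  assumes p: "Factorial_Ring.prime (p::nat)" and fin: "finite S"
    and I: "\<And>i j k. i \<in> I \<Longrightarrow> j \<in> I \<Longrightarrow> (\<lambda>s. i s + k * j s) \<in> I" "(\<lambda>_. 0) \<in> I"
  shows "\<exists>l. (\<forall>s \<in> S. l s \<in> I) \<and>
    (\<forall>i \<in> I. (\<forall>s. s \<notin> S \<longrightarrow> int p dvd i s) \<longrightarrow> (\<forall>t. int p dvd (\<Sum>s\<in>S. i s * l s t) - i t))"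
  using fin I
proof (induction S arbitrary: I rule: finite_induct)
  case empty
  then show ?case by auto
next
  case (insert r S)
  obtain l where l: "\<And>s. s \<in> S \<Longrightarrow> l s \<in> I"
    "\<And>i t. i \<in> I \<Longrightarrow> (\<And>s. s \<notin> S \<Longrightarrow> int p dvd i s) \<Longrightarrow> int p dvd (\<Sum>s\<in>S. i s * l s t) - i t"
    using insert.IH[of I] insert.prems by blast
  have lin: "(\<lambda>t. b t + (\<Sum>s\<in>T. c s * l s t)) \<in> I" if "T \<subseteq> S" "b \<in> I" for b c T
  proof -
    have "finite T" using that(1) insert.hyps(1) finite_subset by blast
    then show ?thesis using that
    proof (induction T rule: finite_induct)
      case (insert s T)
      then have "(\<lambda>t. (b t + (\<Sum>s\<in>T. c s * l s t)) + c s * l s t) \<in> I"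
        using l(1)[of s] by (intro \<open>\<And>i j k. i \<in> I \<Longrightarrow> j \<in> I \<Longrightarrow> (\<lambda>s. i s + k * j s) \<in> I\<close>) auto
      moreover have "(\<lambda>t. b t + (\<Sum>s\<in>insert s T. c s * l s t)) = (\<lambda>t. (b t + (\<Sum>s\<in>T. c s * l s t)) + c s * l s t)"
        using insert.hyps by (simp add: fun_eq_iff add.assoc add.left_commute add.commute)
      ultimately show ?case by simp
    qed simp
  qed
  show ?case
  \<comment> \<open>Gaussian elimination in the coordinate \<open>r\<close>: either a pivot exists,
    or admitting \<open>r\<close> to the support adds nothing modulo \<open>p\<close> and
    \<open>r\<close> may be sent to zero.\<close>
  proof (cases "\<exists>b \<in> I. (\<forall>s. s \<notin> insert r S \<longrightarrow> int p dvd b s) \<and> \<not> int p dvd b r")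
    case False
    have "\<exists>l'. l' r \<in> I \<and> (\<forall>s \<in> S. l' s = l s) \<and> l' r = (\<lambda>_. 0)"
      using insert.prems(2) insert.hyps(2) by (intro exI[of _ "l(r := (\<lambda>_. 0))"]) auto
    then obtain l' where l': "l' r = (\<lambda>_. 0)" "\<And>s. s \<in> S \<Longrightarrow> l' s = l s" by blast
    show ?thesis
    proof (intro exI[of _ l'] conjI ballI impI allI)
      fix s assume "s \<in> insert r S" then show "l' s \<in> I" using l' l(1) insert.prems(2) by (metis insert_iff)
    next
      fix i t assume i: "i \<in> I" "\<forall>s. s \<notin> insert r S \<longrightarrow> int p dvd i s"
      then have "int p dvd i s" if "s \<notin> S" for s using False that by (metis insert_iff)
      then have "int p dvd (\<Sum>s\<in>S. i s * l s t) - i t" by (intro l(2) i)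
      moreover have "(\<Sum>s\<in>S. i s * l' s t) = (\<Sum>s\<in>S. i s * l s t)" by (intro sum.cong) (auto simp: l')
      ultimately show "int p dvd (\<Sum>s\<in>insert r S. i s * l' s t) - i t" using insert.hyps l'(1) by simp
    qed
  next
    case True
    then obtain b0 where b0: "b0 \<in> I" "\<And>s. s \<notin> insert r S \<Longrightarrow> int p dvd b0 s" "\<not> int p dvd b0 r" by blast
    obtain c where c: "int p dvd c * b0 r - 1" using inverse_mod_prime[OF p b0(3)] by blast
    define b where "b = (\<lambda>s. 0 + c * b0 s)"
    have b: "b \<in> I" unfolding b_def by (rule insert.prems(1)[OF insert.prems(2) b0(1)])
    have br: "int p dvd b r - 1" using c by (simp add: b_def)
    have bs: "int p dvd b s" if "s \<notin> insert r S" for s using b0(2)[OF that] by (simp add: b_def)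
    \<comment> \<open>With \<open>b r\<close> equal to 1 modulo \<open>p\<close>, subtracting
      \<open>i r\<close> times \<open>b\<close> from \<open>i\<close> leaves a vector supported on
      \<open>S\<close>, where \<open>l\<close> already works. The choice of \<open>e\<close> makes
      the two contributions add up to \<open>i\<close> again.\<close>
    define e where "e t = b t + (\<Sum>s\<in>S. (- b s) * l s t)" for t
    have e: "e \<in> I" using lin[of S b "\<lambda>s. - b s"] b unfolding e_def by simp
    define l' where "l' = l(r := e)"
    have l': "l' r = e" "\<And>s. s \<in> S \<Longrightarrow> l' s = l s" using insert.hyps(2) by (auto simp: l'_def)
    show ?thesis
    proof (intro exI[of _ l'] conjI ballI impI allI)
      fix s assume "s \<in> insert r S" then show "l' s \<in> I" using l' l(1) e by (metis insert_iff)
    next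
      fix i t assume i: "i \<in> I" "\<forall>s. s \<notin> insert r S \<longrightarrow> int p dvd i s"
      define j where "j = (\<lambda>s. i s + (- i r) * b s)"
      have j: "j \<in> I" unfolding j_def by (rule insert.prems(1)[OF i(1) b])
      have "int p dvd j s" if "s \<notin> S" for s
      proof (cases "s = r")
        case True
        have "j r = (- i r) * (b r - 1)" by (simp add: j_def algebra_simps)
        then show ?thesis using br True by simp
      next
        case False then show ?thesis using bs[of s] i(2) that by (simp add: j_def)
      qed
      then have 1: "int p dvd (\<Sum>s\<in>S. j s * l s t) - j t" by (intro l(2) j)
      have "(\<Sum>s\<in>insert r S. i s * l' s t) = i r * e t + (\<Sum>s\<in>S. i s * l s t)"
        using insert.hyps by (simp add: l' cong: sum.cong)
      also have "\<dots> = i r * b t + (\<Sum>s\<in>S. j s * l s t)"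
        unfolding e_def j_def by (simp add: algebra_simps sum.distrib sum_distrib_left sum_negf sum_subtractf)
      finally have "(\<Sum>s\<in>insert r S. i s * l' s t) - i t = (\<Sum>s\<in>S. j s * l s t) - j t"
        by (simp add: j_def)
      then show "int p dvd (\<Sum>s\<in>insert r S. i s * l' s t) - i t" using 1 by simp
    qed
  qed
qed

lemma zscale_fun_apply: "zscale k f u = zscale k (f u)"
proof -
  have n: "nscale n f u = nscale n (f u)" for n by (induction n) auto
  show ?thesis by (simp add: zscale_def n)
qed

lemma sum_fun_apply: "(\<Sum>i\<in>I. f i) u = (\<Sum>i\<in>I. f i u)" for f :: "'i \<Rightarrow> 'v \<Rightarrow> 'w::ab_group_add"
  by (induction I rule: infinite_finite_induct) auto

section \<open>Unipotent elements normalising a group of coprime order\<close>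

text \<open>Irreducibility is required under \<open>Q\<close> and \<open>x\<close> jointly; under
  \<open>Q\<close> alone \<open>U\<close> may decompose. Fixing all points outside \<open>U\<close>
  makes \<open>x ^^ p = id\<close> an equation between functions on the type.\<close>

locale normalised_module =
  fixes p :: nat and U :: "'v::ab_group_add set" and Q :: "('v \<Rightarrow> 'v) set" and x :: "'v \<Rightarrow> 'v"
  assumes p: "Factorial_Ring.prime p"
    and U: "zm.subspace U" "finite U" "\<And>u. u \<in> U \<Longrightarrow> zscale (int p) u = 0"
    and Q: "perm_group Q" "coprime (card Q) p" "\<And>q. q \<in> Q \<Longrightarrow> ahom U U q"
    and x: "bij x" "ahom U U x" "\<And>u. u \<notin> U \<Longrightarrow> x u = u"
    and xQ: "\<And>q. q \<in> Q \<Longrightarrow> x \<circ> q \<circ> inv_into UNIV x \<in> Q"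
    and nil: "\<And>u. u \<in> U \<Longrightarrow> ((\<lambda>v. x v - v) ^^ (p - 2)) u = 0"
    and irr: "\<And>W. zm.subspace W \<Longrightarrow> W \<subseteq> U \<Longrightarrow> (\<And>q w. q \<in> Q \<Longrightarrow> w \<in> W \<Longrightarrow> q w \<in> W) \<Longrightarrow>
      (\<And>w. w \<in> W \<Longrightarrow> x w \<in> W) \<Longrightarrow> W = {0} \<or> W = U"
begin

abbreviation "y \<equiv> inv_into UNIV x"
definition "N u = x u - u"

lemmas QD = perm_groupD[OF Q(1)]

lemma U_mem [simp]: "u \<in> U \<Longrightarrow> x u \<in> U" "q \<in> Q \<Longrightarrow> u \<in> U \<Longrightarrow> q u \<in> U" "0 \<in> U"
  "u \<in> U \<Longrightarrow> v \<in> U \<Longrightarrow> u + v \<in> U" "u \<in> U \<Longrightarrow> v \<in> U \<Longrightarrow> u - v \<in> U" "u \<in> U \<Longrightarrow> zscale k u \<in> U"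
  using ahom_closed[OF x(2)] ahom_closed[OF Q(3)] zm.subspace_0[OF U(1)] zm.subspace_add[OF U(1)]
    zm.subspace_diff[OF U(1)] zm.subspace_scale[OF U(1)] by auto

lemma xy [simp]: "x (y u) = u" "y (x u) = u"
  using x(1) by (simp_all add: bij_is_inj bij_is_surj surj_f_inv_f)

lemma xU: "x ` U = U"
  using inj_on_subset[OF bij_is_inj[OF x(1)]] by (intro endo_inj_surj[OF U(2)]) auto

lemma y_mem [simp]: "u \<in> U \<Longrightarrow> y u \<in> U"
  using xU by (metis imageE xy(2))

lemma y: "ahom U U y"
proof (rule ahomI)
  fix u v assume "u \<in> U" "v \<in> U"
  then have "x (y u + y v) = u + v" using ahom_add[OF x(2)] by simp
  then show "y (u + v) = y u + y v" by (metis xy(2))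
qed simp

lemma N: "ahom U U N"
  unfolding N_def by (intro ahom_minus_fun[OF U(1) x(2)] ahom_id)

lemma N_mem [simp]: "u \<in> U \<Longrightarrow> N u \<in> U"
  using ahom_closed[OF N] .

lemma Nk: "ahom U U (N ^^ k)"
proof (induction k)
  case 0 show ?case by (simp add: ahom_id[unfolded id_def] id_def)
next
  case (Suc k) show ?case using ahom_comp[OF Suc N] by (simp add: comp_def)
qed

lemma Nk_mem [simp]: "u \<in> U \<Longrightarrow> (N ^^ k) u \<in> U"
  using ahom_closed[OF Nk] .

lemma Nk_zero: "u \<in> U \<Longrightarrow> k \<ge> p - 2 \<Longrightarrow> (N ^^ k) u = 0"
proof -
  assume u: "u \<in> U" and k: "k \<ge> p - 2"
  have "(N ^^ (p - 2 + (k - (p - 2)))) u = (N ^^ (p - 2)) ((N ^^ (k - (p - 2))) u)"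
    by (simp only: funpow_add comp_def)
  also have "\<dots> = 0" using nil[OF Nk_mem[OF u]] unfolding N_def[abs_def] .
  finally show ?thesis using k by simp
qed

lemma xN: "x u = u + N u"
  by (simp add: N_def)

text \<open>Binomial expansion of \<open>(1 + N)^i\<close>. The cut at \<open>p - 2\<close> does not
  depend on \<open>i\<close>, so the iterates of \<open>x\<close> are polynomial functions of
  \<open>i\<close>.\<close>

lemma x_pow: "u \<in> U \<Longrightarrow> (x ^^ i) u = (\<Sum>j<p - 2. zscale (int (i choose j)) ((N ^^ j) u))"
proof (induction i arbitrary: u)
  case 0
  show ?case
  \<comment> \<open>An exponent 0, as for \<open>p = 2\<close>, makes \<open>N ^^ 0\<close> vanish
    on \<open>U\<close>, so \<open>U\<close> is zero and the empty sum is correct.\<close>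
  proof (cases "p - 2")
    case 0
    then show ?thesis using Nk_zero[of u 0] \<open>u \<in> U\<close> by simp
  next
    case (Suc d)
    then show ?thesis by (simp add: sum.lessThan_Suc_shift del: sum.lessThan_Suc)
  qed
next
  case (Suc i)
  define f where "f j = zscale (int (i choose j)) ((N ^^ j) u)" for j
  define g where "g j = zscale (int (i choose j)) ((N ^^ Suc j) u)" for j
  have xi: "(x ^^ i) u \<in> U" using Suc(2) by (induction i) auto
  have "N ((x ^^ i) u) = (\<Sum>j<p - 2. N (f j))"
    using Suc.IH[OF Suc.prems] Suc.prems ahom_sum[OF U(1) N, of "{..<p-2}" f] by (simp add: f_def)
  also have "\<dots> = (\<Sum>j<p - 2. g j)"
    unfolding f_def g_def using ahom_scale[OF U(1) N] Suc(2) by simp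
  finally have "(x ^^ Suc i) u = (\<Sum>j<p - 2. f j) + (\<Sum>j<p - 2. g j)"
    using Suc.IH[OF Suc.prems] xN[of "(x ^^ i) u"] by (simp add: f_def)
  also have "\<dots> = (\<Sum>j<p - 2. zscale (int (Suc i choose j)) ((N ^^ j) u))"
  proof (cases "p - 2")
    case (Suc d)
    have "g d = 0" using Nk_zero[of u "Suc d"] Suc.prems Suc by (simp add: g_def)
    moreover have "f (Suc j) + g j = zscale (int (Suc i choose Suc j)) ((N ^^ Suc j) u)" for j
      unfolding f_def g_def zm.scale_left_distrib[symmetric] by (simp add: add.commute)
    then have "(\<Sum>j<d. f (Suc j)) + (\<Sum>j<d. g j) = (\<Sum>j<d. zscale (int (Suc i choose Suc j)) ((N ^^ Suc j) u))"
      by (simp add: sum.distrib[symmetric])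
    moreover have "(\<Sum>j<Suc d. f j) = f 0 + (\<Sum>j<d. f (Suc j))" by (rule sum.lessThan_Suc_shift)
    moreover have "(\<Sum>j<Suc d. g j) = (\<Sum>j<d. g j) + g d" by simp
    moreover have "(\<Sum>j<Suc d. zscale (int (Suc i choose j)) ((N ^^ j) u)) =
        zscale (int (Suc i choose 0)) ((N ^^ 0) u) + (\<Sum>j<d. zscale (int (Suc i choose Suc j)) ((N ^^ Suc j) u))"
      by (rule sum.lessThan_Suc_shift)
    ultimately show ?thesis unfolding Suc by (simp add: f_def add.assoc)
  qed simp
  finally show ?case .
qed

lemma x_pow_mem [simp]: "u \<in> U \<Longrightarrow> (x ^^ i) u \<in> U"
  by (induction i) auto

text \<open>The polynomial function \<open>i \<mapsto> x ^^ i\<close> has degree below \<open>p - 2\<close>, so it and its product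
  with \<open>i\<close> sum to \<open>0\<close> over \<open>\<int>/p\<close>.\<close>

lemma sum_x_pow:
  assumes u: "u \<in> U"
  shows "(\<Sum>i<p. (x ^^ i) u) = 0" "(\<Sum>i<p. zscale (int i) ((x ^^ i) u)) = 0"
proof -
  have t: "zscale (int (\<Sum>i<p. c i * (i choose j))) ((N ^^ j) u) = 0"
    if "p dvd (\<Sum>i<p. c i * (i choose j))" for c j
    using zscale_dvd[OF U(3)[OF Nk_mem[OF u]]] that int_dvd_int_iff by blast
  have g: "(\<Sum>i<p. zscale (int (c i)) ((x ^^ i) u)) = 0"
    if "\<And>j. j + 2 < p \<Longrightarrow> p dvd (\<Sum>i<p. c i * (i choose j))" for c
  proof -
    have "(\<Sum>i<p. zscale (int (c i)) ((x ^^ i) u)) = (\<Sum>i<p. \<Sum>j<p-2. zscale (int (c i * (i choose j))) ((N ^^ j) u))"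
      by (simp add: x_pow[OF u] zm.scale_sum_right)
    also have "\<dots> = (\<Sum>j<p-2. \<Sum>i<p. zscale (int (c i * (i choose j))) ((N ^^ j) u))"
      by (rule sum.swap)
    also have "\<dots> = (\<Sum>j<p-2. zscale (int (\<Sum>i<p. c i * (i choose j))) ((N ^^ j) u))"
      by (simp only: zm.scale_sum_left[symmetric] of_nat_sum)
    also have "\<dots> = 0" using t that by (intro sum.neutral ballI) auto
    finally show ?thesis .
  qed
  show "(\<Sum>i<p. (x ^^ i) u) = 0" using g[of "\<lambda>_. 1"] dvd_sum_choose[OF p] by simp
  show "(\<Sum>i<p. zscale (int i) ((x ^^ i) u)) = 0" using g[of "\<lambda>i. i"] dvd_sum_choose[OF p] by simp
qed

text \<open>The inner binomial coefficients of \<open>p\<close> are divisible by \<open>p\<close>,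
  and the term with index \<open>p\<close> is already beyond the nilpotency bound. Hence conjugation
  orbits of \<open>x\<close> on \<open>Q\<close> have length 1 or \<open>p\<close>.\<close>

lemma x_pow_p: "x ^^ p = id"
proof
  fix u
  show "(x ^^ p) u = id u"
  proof (cases "u \<in> U")
    case True
    have z: "zscale (int (p choose Suc j)) ((N ^^ Suc j) u) = 0" if "Suc j < p" for j
      using zscale_dvd[OF U(3)[OF Nk_mem[OF True]]] dvd_choose_prime[of "Suc j" p] that p int_dvd_int_iff
      by (metis less_zeroE neq0_conv nat.distinct(1))
    show ?thesis
    proof (cases "p - 2")
      case 0 then show ?thesis using Nk_zero[OF True, of 0] x_pow[OF True, of p] by simp
    next
      case (Suc d)
      have "(\<Sum>j<Suc d. zscale (int (p choose j)) ((N ^^ j) u)) = u + (\<Sum>j<d. zscale (int (p choose Suc j)) ((N ^^ Suc j) u))"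
        unfolding sum.lessThan_Suc_shift by simp
      also have "(\<Sum>j<d. zscale (int (p choose Suc j)) ((N ^^ Suc j) u)) = 0"
        using Suc by (intro sum.neutral ballI z) auto
      finally show ?thesis using x_pow[OF True, of p] Suc by simp
    qed
  next
    case False
    have "(x ^^ i) u = u" for i using x(3)[OF False] by (induction i) auto
    then show ?thesis by simp
  qed
qed

section \<open>Endomorphisms commuting with \<open>Q\<close>\<close>

definition "equivariant e \<longleftrightarrow> ahom U U e \<and> (\<forall>q \<in> Q. \<forall>u \<in> U. e (q u) = q (e u))"

text \<open>Normalisation is assumed in one direction; on the finite set \<open>Q\<close> an
  injective conjugation is onto, which supplies the other direction.\<close>

lemma conj_mem': assumes q: "q \<in> Q" shows "y \<circ> q \<circ> x \<in> Q"
proof -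
  let ?c = "\<lambda>q. x \<circ> q \<circ> y"
  have "inj_on ?c Q"
  proof (rule inj_onI)
    fix q r assume "?c q = ?c r"
    then have "y ((?c q) (x u)) = y ((?c r) (x u))" for u by simp
    then show "q = r" by (simp add: fun_eq_iff)
  qed
  then have "?c ` Q = Q" using xQ by (intro endo_inj_surj[OF QD(1)]) auto
  then obtain r where r: "r \<in> Q" "q = x \<circ> r \<circ> y" using q by blast
  then have "y \<circ> q \<circ> x = r" by (simp add: fun_eq_iff)
  then show ?thesis using r by simp
qed

text \<open>Conjugation by \<open>x\<close> minus the identity on the endomorphism ring of
  \<open>U\<close>; an endomorphism commutes with \<open>x\<close> on \<open>U\<close> exactly when
  \<open>D\<close> annihilates it there.\<close>

definition "D e u = x (e (y u)) - e u"

lemma equivariant_D: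
  assumes e: "equivariant e"
  shows "equivariant (D e)"
proof -
  have h: "ahom U U e" using e by (simp add: equivariant_def)
  have "ahom U U (D e)"
    unfolding D_def[abs_def] by (intro ahom_minus_fun[OF U(1) ahom_comp[OF ahom_comp[OF y h] x(2)] h])
  moreover have "D e (q u) = q (D e u)" if q: "q \<in> Q" and u: "u \<in> U" for q u
  proof -
    have r: "y \<circ> q \<circ> x \<in> Q" by (rule conj_mem'[OF q])
    have "y (q u) = (y \<circ> q \<circ> x) (y u)" by simp
    then have "e (y (q u)) = (y \<circ> q \<circ> x) (e (y u))" using e r u by (simp add: equivariant_def del: comp_apply)
    then have "x (e (y (q u))) = q (x (e (y u)))" by simp
    moreover have "e (q u) = q (e u)" using e q u by (simp add: equivariant_def)
    moreover have "q (x (e (y u)) - e u) = q (x (e (y u))) - q (e u)"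
      by (rule ahom_diff[OF U(1) Q(3)[OF q]]) (use ahom_closed[OF h] u in auto)
    ultimately show ?thesis by (simp add: D_def)
  qed
  ultimately show ?thesis by (simp add: equivariant_def)
qed

lemma equivariant_Dk: "equivariant e \<Longrightarrow> equivariant ((D ^^ k) e)"
  by (induction k) (auto intro: equivariant_D)

lemma yN1: "u \<in> U \<Longrightarrow> y (N u) = N (y u)"
  unfolding N_def using ahom_diff[OF U(1) y] by simp

lemma yN: "u \<in> U \<Longrightarrow> y ((N ^^ k) u) = (N ^^ k) (y u)"
proof (induction k)
  case (Suc k)
  then show ?case using yN1[of "(N ^^ k) u"] by simp
qed simp

text \<open>With \<open>D e = (N e - e N) x\<^sup>-\<^sup>1\<close>, the operator \<open>D\<close> inherits nilpotency from \<open>N\<close>.\<close>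

lemma D_nilpotent:
  assumes e: "equivariant e"
  shows "u \<in> U \<Longrightarrow> a + b + m \<ge> 2 * (p - 2) \<Longrightarrow> (N ^^ a) (((D ^^ m) e) ((N ^^ b) u)) = 0"
proof (induction m arbitrary: a b u)
  case 0
  have h: "ahom U U e" using e by (simp add: equivariant_def)
  show ?case
  proof (cases "a \<ge> p - 2")
    case True then show ?thesis using Nk_zero ahom_closed[OF h] 0 by simp
  next
    case False
    then show ?thesis using Nk_zero[of u b] 0 ahom_zero[OF U(1) h] ahom_zero[OF U(1) Nk] by simp
  qed
next
  case (Suc m)
  let ?f = "(D ^^ m) e"
  have h: "ahom U U ?f" using equivariant_Dk[OF e] by (simp add: equivariant_def)
  note m = ahom_closed[OF h]
  let ?w = "(N ^^ b) (y u)"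
  have w: "?w \<in> U" using Suc by simp
  have "D ?f ((N ^^ b) u) = x (?f ?w) - ?f (x ?w)"
    unfolding D_def using yN[OF Suc(2)] xy(1)[of "(N ^^ b) u"] by simp
  also have "\<dots> = N (?f ?w) - ?f (N ?w)"
    using xN[of "?f ?w"] xN[of ?w] ahom_add[OF h w N_mem[OF w]] by (simp add: algebra_simps)
  finally have "(N ^^ a) (D ?f ((N ^^ b) u)) = (N ^^ a) (N (?f ?w)) - (N ^^ a) (?f (N ?w))"
    using ahom_diff[OF U(1) Nk] m w by simp
  moreover have "(N ^^ a) (N (?f ?w)) = 0"
    using Suc.IH[of "y u" "Suc a" b] Suc.prems by (simp add: funpow_swap1)
  moreover have "(N ^^ a) (?f (N ?w)) = 0"
    using Suc.IH[of "y u" a "Suc b"] Suc.prems by simp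
  ultimately show ?case by simp
qed

text \<open>By Schur's lemma, a non-zero obstruction \<open>b = D e\<close> with \<open>D b = 0\<close> would be invertible, and then
  \<open>s = e b\<^sup>-\<^sup>1 x\<^sup>-\<^sup>1\<close> would satisfy the Weyl relation \<open>N s - s N = 1\<close>, which is incompatible with
  \<open>N ^^ (p - 2) = 0\<close> in characteristic \<open>p\<close>.\<close>

lemma x_commutes_equivariant:
  assumes e: "equivariant e" and u: "u \<in> U"
  shows "e (x u) = x (e u)"
proof (rule ccontr)
  assume neq: "\<not> ?thesis"
  define m where "m = (LEAST m. \<forall>u \<in> U. ((D ^^ m) e) u = 0)"
  have "\<forall>u \<in> U. ((D ^^ (2 * (p - 2))) e) u = 0" using D_nilpotent[OF e, of _ 0 0] by simp
  then have m: "\<forall>u \<in> U. ((D ^^ m) e) u = 0" unfolding m_def by (rule LeastI)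
  have m_min: "\<exists>u \<in> U. ((D ^^ k) e) u \<noteq> 0" if "k < m" for k
    using not_less_Least[of k] that unfolding m_def by blast
  have "m \<noteq> 0"
    using m u neq ahom_zero[OF U(1) x(2)] by (intro notI) simp
  moreover have "m \<noteq> 1"
  proof
    assume "m = 1"
    then have "D e (x u) = 0" using m u by simp
    then show False using neq by (simp add: D_def)
  qed
  \<comment> \<open>Exponent 0 would make \<open>e\<close> zero and exponent 1 would make it commute
    with \<open>x\<close>, so the least exponent leaves room for two steps: \<open>b = D f\<close>
    is non-zero while \<open>D b = 0\<close>.\<close>
  ultimately obtain k where k: "m = Suc (Suc k)" by (metis One_nat_def not0_implies_Suc)
  define f where "f = (D ^^ k) e"
  define b where "b = D f"
  have eqb: "equivariant b" and eqf: "equivariant f" using equivariant_Dk[OF e] equivariant_D by (auto simp: f_def b_def)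
  then have hb: "ahom U U b" and hf: "ahom U U f" by (auto simp: equivariant_def)
  have bx: "b (x v) = x (b v)" if "v \<in> U" for v
  proof -
    have "D b (x v) = 0" using m that by (simp add: k f_def b_def)
    then show ?thesis by (simp add: D_def)
  qed
  obtain w where w: "w \<in> U" "b w \<noteq> 0" using m_min[of "Suc k"] by (auto simp: k b_def f_def)
  define K where "K = {v \<in> U. b v = 0}"
  have sK: "zm.subspace K"
    by (rule zm.subspaceI) (auto simp: K_def ahom_zero[OF U(1) hb] ahom_add[OF hb] ahom_scale[OF U(1) hb])
  \<comment> \<open>Because \<open>D b = 0\<close>, the kernel of \<open>b\<close> is stable under
    \<open>x\<close> as well as under \<open>Q\<close>; this is the form of Schur's lemma available
    when \<open>Q\<close> alone is not irreducible.\<close>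
  have "K = {0} \<or> K = U"
  proof (rule irr[OF sK])
    show "q v \<in> K" if "q \<in> Q" "v \<in> K" for q v
      using that eqb ahom_zero[OF U(1) Q(3)] by (auto simp: K_def equivariant_def)
    show "x v \<in> K" if "v \<in> K" for v
      using that bx ahom_zero[OF U(1) x(2)] by (auto simp: K_def)
  qed (auto simp: K_def)
  moreover have "w \<notin> K" using w by (simp add: K_def)
  ultimately have K: "K = {0}" using w(1) by blast
  have injb: "inj_on b U"
  proof (rule inj_onI)
    fix v v' assume v: "v \<in> U" "v' \<in> U" "b v = b v'"
    then have "v - v' \<in> K" using ahom_diff[OF U(1) hb] by (simp add: K_def)
    then show "v = v'" using K by simp
  qed
  then have bU: "b ` U = U" using ahom_closed[OF hb] by (intro endo_inj_surj[OF U(2)]) auto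
  define c where "c = inv_into U b"
  have bc: "b (c v) = v" and cU: "c v \<in> U" if "v \<in> U" for v
    using that bU unfolding c_def by (auto intro: f_inv_into_f inv_into_into)
  have c_uniq: "c v = v'" if "v' \<in> U" "b v' = v" for v v'
    using that injb unfolding c_def by auto
  have hc: "ahom U U c"
    by (rule ahomI) (auto simp: cU ahom_add[OF hb] bc intro!: c_uniq)
  have cx: "c (x v) = x (c v)" if "v \<in> U" for v
    by (rule c_uniq) (use that bx cU bc in auto)
  define s where "s v = f (c (y v))" for v
  have hs: "ahom U U s" unfolding s_def by (intro ahom_comp[OF ahom_comp[OF y hc] hf])
  have weyl: "N (s v) = s (N v) + v" if v: "v \<in> U" for v
  proof -
    have "s (N v) = s (x v) - s v" unfolding N_def using v by (intro ahom_diff[OF U(1) hs]) auto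
    also have "s (x v) = f (c v)" by (simp add: s_def)
    finally have "N (s v) - s (N v) = x (s v) - f (c v)" by (simp add: N_def)
    also have "x (s v) = x (f (y (c v)))"
    proof -
      have "c (y v) = y (c v)" using cx[OF y_mem[OF v]] by (metis xy)
      then show ?thesis by (simp add: s_def)
    qed
    also have "x (f (y (c v))) - f (c v) = b (c v)" by (simp add: b_def D_def)
    finally show ?thesis using bc[OF v] by (simp add: algebra_simps)
  qed
  have weylk: "(N ^^ Suc j) (s v) = s ((N ^^ Suc j) v) + zscale (int (Suc j)) ((N ^^ j) v)" if v: "v \<in> U" for j v
  proof (induction j)
    case 0 show ?case using weyl[OF v] by simp
  next
    case (Suc j)
    have 1: "s ((N ^^ Suc j) v) \<in> U" using ahom_closed[OF hs] v by simp
    have "(N ^^ Suc (Suc j)) (s v) = N (s ((N ^^ Suc j) v) + zscale (int (Suc j)) ((N ^^ j) v))"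
      using Suc by simp
    also have "\<dots> = N (s ((N ^^ Suc j) v)) + zscale (int (Suc j)) (N ((N ^^ j) v))"
      using ahom_add[OF N 1, of "zscale (int (Suc j)) ((N ^^ j) v)"] ahom_scale[OF U(1) N] v by simp
    also have "N (s ((N ^^ Suc j) v)) = s ((N ^^ Suc (Suc j)) v) + (N ^^ Suc j) v"
      using weyl[of "(N ^^ Suc j) v"] v by simp
    moreover have "zscale (int (Suc (Suc j))) ((N ^^ Suc j) v) = (N ^^ Suc j) v + zscale (int (Suc j)) ((N ^^ Suc j) v)"
      by (simp only: of_nat_Suc[of "Suc j"] zm.scale_left_distrib zm.scale_one)
    ultimately show ?case by (simp only: add.assoc funpow.simps comp_def)
  qed
  \<comment> \<open>Descent: if \<open>N^(k+1)\<close> vanishes on \<open>U\<close>, the Weyl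
    relation leaves \<open>(k + 1) N^k = 0\<close>, and \<open>k + 1\<close> is at most
    \<open>p - 2\<close>, hence invertible. At the bottom \<open>N ^^ 0\<close> vanishes, so
    \<open>U\<close> would be zero.\<close>
  have "\<forall>v \<in> U. (N ^^ (p - 2 - j)) v = 0" if "j \<le> p - 2" for j
    using that
  proof (induction j)
    case 0 then show ?case using Nk_zero by simp
  next
    case (Suc j)
    let ?k = "p - 2 - Suc j"
    have k: "p - 2 - j = Suc ?k" using Suc.prems by simp
    show ?case
    proof
      fix v assume v: "v \<in> U"
      have z: "(N ^^ Suc ?k) v' = 0" if "v' \<in> U" for v' using Suc.IH Suc.prems that unfolding k by simp
      have "zscale (int (Suc ?k)) ((N ^^ ?k) v) = 0"
        using weylk[OF v, of ?k] z[OF v] z[OF ahom_closed[OF hs v]] ahom_zero[OF U(1) hs] by simp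
      moreover have "\<not> p dvd Suc ?k" using Suc.prems by (intro notI) (auto dest!: dvd_imp_le)
      then have "\<not> int p dvd int (Suc ?k)" by (simp only: int_dvd_int_iff not_False_eq_True)
      then obtain d where "int p dvd d * int (Suc ?k) - 1" using inverse_mod_prime[OF p] by blast
      then have "zscale (d * int (Suc ?k)) ((N ^^ ?k) v) = zscale 1 ((N ^^ ?k) v)"
        by (intro zscale_cong[OF U(3)]) (use v in auto)
      ultimately show "(N ^^ ?k) v = 0" by (metis zm.scale_scale zm.scale_zero_right zm.scale_one)
    qed
  qed
  from this[of "p - 2"] have "w = 0" using w(1) by simp
  then show False using w(2) ahom_zero[OF U(1) hb] by simp
qed

text \<open>Double centraliser theorem. The classical proof applies a \<open>Q\<close>-projection on
  a power of \<open>U\<close> to a tuple of generators; here the tuple lists all elements of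
  \<open>U\<close>, so no basis is chosen. The matrix entries of the projection are
  \<open>Q\<close>-endomorphisms, hence commute with \<open>f\<close>, and \<open>f\<close> maps the
  cyclic submodule generated by the tuple into itself.\<close>

lemma bicommutant:
  assumes f: "ahom U U f" and comm: "\<And>e u. equivariant e \<Longrightarrow> u \<in> U \<Longrightarrow> f (e u) = e (f u)"
  obtains \<alpha> :: "('v \<Rightarrow> 'v) \<Rightarrow> int" where "\<And>u. u \<in> U \<Longrightarrow> f u = (\<Sum>q\<in>Q. zscale (\<alpha> q) (q u))"
proof -
  \<comment> \<open>All functions, additive or not: \<open>F\<close> is the direct power of
    \<open>U\<close> indexed by \<open>U\<close>, with \<open>Q\<close> acting by post-composition.
    The submodule \<open>M\<close> is generated by the tuple of all elements of
    \<open>U\<close>.\<close>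
  define F where "F = {\<phi>. \<forall>u. (u \<in> U \<longrightarrow> \<phi> u \<in> U) \<and> (u \<notin> U \<longrightarrow> \<phi> u = (0::'v))}"
  define M where "M = {\<phi> \<in> F. \<exists>\<alpha>::('v \<Rightarrow> 'v) \<Rightarrow> int. \<forall>u \<in> U. \<phi> u = (\<Sum>q\<in>Q. zscale (\<alpha> q) (q u))}"
  have MI: "\<phi> \<in> M" if "\<phi> \<in> F" "\<And>u. u \<in> U \<Longrightarrow> \<phi> u = (\<Sum>q\<in>Q. zscale (\<alpha> q) (q u))"
    for \<phi> and \<alpha> :: "('v \<Rightarrow> 'v) \<Rightarrow> int"
    unfolding M_def using that by (intro CollectI conjI exI[of _ \<alpha>] ballI) auto
  have finF: "finite F" unfolding F_def by (rule finite_set_of_finite_funs[OF U(2) U(2)])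
  have sF: "zm.subspace F"
    by (rule zm.subspaceI) (auto simp: F_def zscale_fun_apply)
  have F1: "\<phi> u \<in> U" if "\<phi> \<in> F" "u \<in> U" for \<phi> u using that by (auto simp: F_def)
  have F0: "\<phi> u = 0" if "\<phi> \<in> F" "u \<notin> U" for \<phi> u using that by (auto simp: F_def)
  have tF: "zscale (int p) \<phi> = 0" if "\<phi> \<in> F" for \<phi>
  proof
    fix u show "zscale (int p) \<phi> u = 0 u"
      using F1[OF that, of u] F0[OF that, of u] U(3) by (cases "u \<in> U") (auto simp: zscale_fun_apply)
  qed
  have sM: "zm.subspace M"
  proof (rule zm.subspaceI)
    show "0 \<in> M" using zm.subspace_0[OF sF] by (intro MI[of _ "\<lambda>_. 0"]) simp_all
  next
    fix \<phi> \<psi> assume "\<phi> \<in> M" "\<psi> \<in> M"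
    then obtain \<alpha> \<beta> :: "('v \<Rightarrow> 'v) \<Rightarrow> int" where "\<phi> \<in> F" "\<psi> \<in> F"
      "\<And>u. u \<in> U \<Longrightarrow> \<phi> u = (\<Sum>q\<in>Q. zscale (\<alpha> q) (q u))" "\<And>u. u \<in> U \<Longrightarrow> \<psi> u = (\<Sum>q\<in>Q. zscale (\<beta> q) (q u))"
      unfolding M_def by blast
    then show "\<phi> + \<psi> \<in> M" using zm.subspace_add[OF sF]
      by (intro MI[of _ "\<lambda>q. \<alpha> q + \<beta> q"]) (simp_all add: zm.scale_left_distrib sum.distrib)
  next
    fix c \<phi> assume "\<phi> \<in> M"
    then obtain \<alpha> :: "('v \<Rightarrow> 'v) \<Rightarrow> int" where "\<phi> \<in> F"
      "\<And>u. u \<in> U \<Longrightarrow> \<phi> u = (\<Sum>q\<in>Q. zscale (\<alpha> q) (q u))"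
      unfolding M_def by blast
    then show "zscale c \<phi> \<in> M" using zm.subspace_scale[OF sF]
      by (intro MI[of _ "\<lambda>q. c * \<alpha> q"]) (simp_all add: zscale_fun_apply zm.scale_sum_right)
  qed
  have aF: "ahom F F (\<lambda>\<phi>. q \<circ> \<phi>)" if q: "q \<in> Q" for q
  proof (rule ahomI)
    show "q \<circ> \<phi> \<in> F" if "\<phi> \<in> F" for \<phi>
      using that q ahom_zero[OF U(1) Q(3)[OF q]] by (auto simp: F_def)
    fix \<phi> \<psi> assume m: "\<phi> \<in> F" "\<psi> \<in> F"
    show "q \<circ> (\<phi> + \<psi>) = (q \<circ> \<phi>) + (q \<circ> \<psi>)"
    proof
      fix u show "(q \<circ> (\<phi> + \<psi>)) u = ((q \<circ> \<phi>) + (q \<circ> \<psi>)) u"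
        using F1[OF m(1), of u] F1[OF m(2), of u] F0[OF m(1), of u] F0[OF m(2), of u]
          ahom_add[OF Q(3)[OF q], of "\<phi> u" "\<psi> u"] ahom_zero[OF U(1) Q(3)[OF q]]
        by (cases "u \<in> U") auto
    qed
  qed
  have aM: "r \<circ> \<phi> \<in> M" if r: "r \<in> Q" and \<phi>: "\<phi> \<in> M" for r \<phi>
  proof -
    obtain \<alpha> :: "('v \<Rightarrow> 'v) \<Rightarrow> int" where a: "\<phi> \<in> F"
      "\<And>u. u \<in> U \<Longrightarrow> \<phi> u = (\<Sum>q\<in>Q. zscale (\<alpha> q) (q u))"
      using \<phi> unfolding M_def by blast
    have "(r \<circ> \<phi>) u = (\<Sum>q\<in>Q. zscale (\<alpha> (inv_into UNIV r \<circ> q)) (q u))" if u: "u \<in> U" for u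
    proof -
      have "(r \<circ> \<phi>) u = (\<Sum>q\<in>Q. zscale (\<alpha> q) ((r \<circ> q) u))"
        using ahom_sum[OF U(1) Q(3)[OF r], of Q "\<lambda>q. zscale (\<alpha> q) (q u)"] ahom_scale[OF U(1) Q(3)[OF r]] u
        by (simp add: a(2))
      also have "\<dots> = (\<Sum>q\<in>Q. zscale (\<alpha> (inv_into UNIV r \<circ> (r \<circ> q))) ((r \<circ> q) u))"
        using bij_is_inj[OF QD(4)[OF r]] by (simp add: comp_assoc[symmetric])
      also have "\<dots> = (\<Sum>q\<in>Q. zscale (\<alpha> (inv_into UNIV r \<circ> q)) (q u))"
        by (rule sum.reindex_bij_betw[OF perm_group_bij[OF Q(1) r]])
      finally show ?thesis .
    qed
    then show ?thesis using ahom_closed[OF aF[OF r] a(1)]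
      by (intro MI[of _ "\<lambda>q. \<alpha> (inv_into UNIV r \<circ> q)"])
  qed
  obtain \<pi> where \<pi>: "ahom F M \<pi>" "\<And>m. m \<in> M \<Longrightarrow> \<pi> m = m"
    "\<And>q \<phi>. q \<in> Q \<Longrightarrow> \<phi> \<in> F \<Longrightarrow> \<pi> (q \<circ> \<phi>) = q \<circ> \<pi> \<phi>"
    by (rule equivariant_projection[OF p sF finF tF sM _ Q(1,2), where a = "\<lambda>q \<phi>. q \<circ> \<phi>"])
      (use aF aM in \<open>auto simp: M_def comp_assoc\<close>)
  have MF: "\<phi> \<in> F" if "\<phi> \<in> M" for \<phi> using that by (simp add: M_def)
  \<comment> \<open>The injection of the coordinate \<open>w\<close> into the power.\<close>
  define single where "single w v = (\<lambda>u. if u = w then v else (0::'v))" for w v :: 'v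
  have sg: "single w v \<in> F" if "w \<in> U" "v \<in> U" for w v using that by (auto simp: single_def F_def)
  have decomp: "\<phi> = (\<Sum>w\<in>U. single w (\<phi> w))" if "\<phi> \<in> F" for \<phi>
  proof
    fix u show "\<phi> u = (\<Sum>w\<in>U. single w (\<phi> w)) u"
      using F0[OF that, of u] U(2) by (simp add: sum_fun_apply single_def)
  qed
  \<comment> \<open>The entry of the projection from coordinate \<open>w\<close> to coordinate
    \<open>u\<close>, as a map on \<open>U\<close>.\<close>
  have entry: "equivariant (\<lambda>v. \<pi> (single w v) u)" if w: "w \<in> U" and u: "u \<in> U" for w u
    unfolding equivariant_def
  proof (intro conjI ballI ahomI)
    show "\<pi> (single w v) u \<in> U" if "v \<in> U" for v
      using F1[OF MF[OF ahom_closed[OF \<pi>(1) sg[OF w that]]] u] .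
    show "\<pi> (single w (v + v')) u = \<pi> (single w v) u + \<pi> (single w v') u" if "v \<in> U" "v' \<in> U" for v v'
    proof -
      have "single w (v + v') = single w v + single w v'" by (auto simp: single_def)
      then show ?thesis using ahom_add[OF \<pi>(1) sg[OF w that(1)] sg[OF w that(2)]] by simp
    qed
    show "\<pi> (single w (q v)) u = q (\<pi> (single w v) u)" if "q \<in> Q" "v \<in> U" for q v
    proof -
      have "single w (q v) = q \<circ> single w v"
        using ahom_zero[OF U(1) Q(3)[OF that(1)]] by (auto simp: single_def)
      then show ?thesis using \<pi>(3)[OF that(1) sg[OF w that(2)]] by simp
    qed
  qed
  have \<pi>_entries: "\<pi> \<phi> u = (\<Sum>w\<in>U. \<pi> (single w (\<phi> w)) u)" if \<phi>: "\<phi> \<in> F" and u: "u \<in> U" for \<phi> u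
  proof -
    have "\<pi> \<phi> = (\<Sum>w\<in>U. \<pi> (single w (\<phi> w)))"
      using ahom_sum[OF sF \<pi>(1), of U "\<lambda>w. single w (\<phi> w)"] sg F1[OF \<phi>] decomp[OF \<phi>] by simp
    then show ?thesis by (simp add: sum_fun_apply)
  qed
  \<comment> \<open>The generating tuple of \<open>M\<close>; \<open>g\<close> is its image under
    \<open>f\<close> in every coordinate. Once \<open>g\<close> is shown to be fixed by
    \<open>\<pi>\<close>, it lies in \<open>M\<close>, and membership is the required formula for
    \<open>f\<close>.\<close>
  define one where "one = (\<lambda>u. if u \<in> U then u else (0::'v))"
  define g where "g = (\<lambda>u. if u \<in> U then f u else (0::'v))"
  have gF: "g \<in> F" and oF: "one \<in> F" using ahom_closed[OF f] by (auto simp: g_def one_def F_def)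
  have oM: "one \<in> M"
  proof -
    have "one u = (\<Sum>q\<in>Q. zscale (if q = id then 1 else 0) (q u))" if "u \<in> U" for u
    proof -
      have "(\<Sum>q\<in>Q. zscale (if q = id then 1 else 0) (q u)) = (\<Sum>q\<in>Q. if q = id then u else 0)"
        by (intro sum.cong) auto
      then show ?thesis using QD(1,2) that by (simp add: one_def)
    qed
    then show ?thesis using oF by (intro MI[of _ "\<lambda>q. if q = id then 1 else 0"])
  qed
  have "f u = \<pi> g u" if u: "u \<in> U" for u
  proof -
    have m: "\<pi> (single w w) u \<in> U" if "w \<in> U" for w
      using F1[OF MF[OF ahom_closed[OF \<pi>(1) sg[OF that that]]] u] .
    have "f u = f (\<pi> one u)" using \<pi>(2)[OF oM] u by (simp add: one_def)
    also have "\<pi> one u = (\<Sum>w\<in>U. \<pi> (single w w) u)"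
      using \<pi>_entries[OF oF u] by (simp add: one_def)
    also have "f \<dots> = (\<Sum>w\<in>U. f (\<pi> (single w w) u))"
      using ahom_sum[OF U(1) f, of U "\<lambda>w. \<pi> (single w w) u"] m by simp
    also have "\<dots> = (\<Sum>w\<in>U. \<pi> (single w (g w)) u)"
    proof (rule sum.cong[OF refl])
      fix w assume w: "w \<in> U"
      show "f (\<pi> (single w w) u) = \<pi> (single w (g w)) u"
        using comm[OF entry[OF w u] w] w by (simp add: g_def)
    qed
    also have "\<dots> = \<pi> g u" using \<pi>_entries[OF gF u] by simp
    finally show ?thesis .
  qed
  moreover obtain \<alpha> :: "('v \<Rightarrow> 'v) \<Rightarrow> int" where "\<And>u. u \<in> U \<Longrightarrow> \<pi> g u = (\<Sum>q\<in>Q. zscale (\<alpha> q) (q u))"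
    using ahom_closed[OF \<pi>(1) gF] unfolding M_def by blast
  ultimately show ?thesis using that[of \<alpha>] by simp
qed

end

section \<open>The group ring of \<open>Q\<close>\<close>

lemma perm_group_simps:
  assumes "perm_group Q" "q \<in> Q"
  shows "inv_into UNIV q \<circ> q = id" "q \<circ> inv_into UNIV q = id"
    "inv_into UNIV q \<circ> (q \<circ> h) = h" "q \<circ> (inv_into UNIV q \<circ> h) = h" "inv_into UNIV (inv_into UNIV q) = q"
    "r \<in> Q \<Longrightarrow> inv_into UNIV (q \<circ> r) = inv_into UNIV r \<circ> inv_into UNIV q"
    "q \<circ> h \<in> Q \<longleftrightarrow> h \<in> Q" "h \<circ> q \<in> Q \<longleftrightarrow> h \<in> Q"
proof -
  note D = perm_groupD[OF assms(1)]
  have b: "bij q" using D assms(2) by auto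
  show 1: "inv_into UNIV q \<circ> q = id" "q \<circ> inv_into UNIV q = id"
    using b by (auto simp: bij_is_inj bij_is_surj surj_iff[symmetric])
  show 2: "inv_into UNIV q \<circ> (q \<circ> h) = h" "q \<circ> (inv_into UNIV q \<circ> h) = h" for h
    using 1 by (simp_all add: comp_assoc[symmetric])
  show "inv_into UNIV (inv_into UNIV q) = q" using b by (simp add: inv_inv_eq)
  show "inv_into UNIV (q \<circ> r) = inv_into UNIV r \<circ> inv_into UNIV q" if "r \<in> Q"
    using o_inv_distrib[OF b D(4)[OF that]] .
  show "q \<circ> h \<in> Q \<longleftrightarrow> h \<in> Q" using 2(1) D(3,5) assms(2) by metis
  have "(h \<circ> q) \<circ> inv_into UNIV q = h" using 1 by (simp add: comp_assoc)
  then show "h \<circ> q \<in> Q \<longleftrightarrow> h \<in> Q" using D(3,5) assms(2) by metis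
qed

text \<open>Multiplication in the group ring of \<open>Q\<close>, on coefficient functions.\<close>

definition conv :: "('v \<Rightarrow> 'v) set \<Rightarrow> (('v \<Rightarrow> 'v) \<Rightarrow> int) \<Rightarrow> (('v \<Rightarrow> 'v) \<Rightarrow> int) \<Rightarrow> ('v \<Rightarrow> 'v) \<Rightarrow> int" where
  "conv Q a b g = (\<Sum>q\<in>Q. a q * b (inv_into UNIV q \<circ> g))"

text \<open>An ideal \<open>I\<close> of the group ring \<open>\<int>[Q]\<close> has, modulo \<open>p\<close>, an identity element which is a class
  function: average the images \<open>l q\<close> of the group elements under a linear projection onto \<open>I\<close>.\<close>

lemma ideal_identity:
  fixes Q :: "('v \<Rightarrow> 'v) set"
  assumes p: "Factorial_Ring.prime (p::nat)" and Q: "perm_group Q" "coprime (card Q) p"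
    and I: "\<And>i j k. i \<in> I \<Longrightarrow> j \<in> I \<Longrightarrow> (\<lambda>s. i s + k * j s) \<in> I" "(\<lambda>_. 0) \<in> I"
      "\<And>i s r. i \<in> I \<Longrightarrow> s \<in> Q \<Longrightarrow> r \<in> Q \<Longrightarrow> (\<lambda>h. i (s \<circ> h \<circ> r)) \<in> I" "\<And>i h. i \<in> I \<Longrightarrow> h \<notin> Q \<Longrightarrow> i h = 0"
  obtains e where "e \<in> I" "\<And>s g. s \<in> Q \<Longrightarrow> e (s \<circ> g \<circ> inv_into UNIV s) = e g"
    "\<And>i g. i \<in> I \<Longrightarrow> int p dvd conv Q i e g - i g"
proof -
  note D = perm_groupD[OF Q(1)] and S = perm_group_simps[OF Q(1)]
  have "\<exists>l. (\<forall>s \<in> Q. l s \<in> I) \<and> (\<forall>i \<in> I. (\<forall>s. s \<notin> Q \<longrightarrow> int p dvd i s) \<longrightarrow>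
      (\<forall>t. int p dvd (\<Sum>s\<in>Q. i s * l s t) - i t))"
    by (rule exists_projection_coeffs[OF p D(1)]) (fact I(1), fact I(2))
  then obtain l where l1: "\<forall>s \<in> Q. l s \<in> I" and l2: "\<forall>i \<in> I. (\<forall>s. s \<notin> Q \<longrightarrow> int p dvd i s) \<longrightarrow>
      (\<forall>t. int p dvd (\<Sum>s\<in>Q. i s * l s t) - i t)"
    by (elim exE conjE)
  have l: "\<And>s. s \<in> Q \<Longrightarrow> l s \<in> I" "\<And>i t. i \<in> I \<Longrightarrow> int p dvd (\<Sum>s\<in>Q. i s * l s t) - i t"
    using l1 l2 I(4) by (blast, metis dvd_0_right)
  have "\<not> int p dvd int (card Q)" using Q(2) p by (auto dest: coprime_common_divisor[of _ _ p])
  then obtain m where m: "int p dvd m * int (card Q) - 1" using inverse_mod_prime p by blast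
  define c where "c = m * m"
  let ?i = "inv_into UNIV"
  \<comment> \<open>This is the value at the identity of the averaged projection that sends
    \<open>a\<close> to the mean of \<open>q l(q^-1 a r^-1) r\<close> over all pairs
    \<open>(q, r)\<close>. Averaging on both sides makes it a bimodule map, so multiplying its value
    at the identity by \<open>i\<close> gives the image of \<open>i\<close>, that is,
    \<open>i\<close> itself. The two averages account for the square in \<open>c\<close>.\<close>
  define e where "e g = c * (\<Sum>q\<in>Q. \<Sum>r\<in>Q. l (?i q \<circ> ?i r) (?i q \<circ> g \<circ> ?i r))" for g
  have sumI: "(\<lambda>g. \<Sum>t\<in>T. f t g) \<in> I" if "\<And>t. t \<in> T \<Longrightarrow> f t \<in> I" "finite T" for f :: "'t \<Rightarrow> ('v \<Rightarrow> 'v) \<Rightarrow> int" and T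
    using that(2,1)
  proof (induction T rule: finite_induct)
    case (insert t T)
    then have "(\<lambda>g. f t g + 1 * (\<Sum>t\<in>T. f t g)) \<in> I" by (intro I(1)) auto
    then show ?case using insert by simp
  qed (simp add: I(2))
  have "(\<lambda>g. \<Sum>q\<in>Q. \<Sum>r\<in>Q. l (?i q \<circ> ?i r) (?i q \<circ> g \<circ> ?i r)) \<in> I"
    by (intro sumI I(3) l(1) D(1) D(3) D(5))
  from I(1)[OF I(2) this, of c] have eI: "e \<in> I" unfolding e_def[abs_def] by simp
  have cl: "e (s \<circ> g \<circ> ?i s) = e g" if s: "s \<in> Q" for s g
  proof -
    have "(\<Sum>q\<in>Q. \<Sum>r\<in>Q. l (?i q \<circ> ?i r) (?i q \<circ> (s \<circ> g \<circ> ?i s) \<circ> ?i r)) =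
        (\<Sum>q\<in>Q. \<Sum>r\<in>Q. l (?i (s \<circ> q) \<circ> ?i r) (?i (s \<circ> q) \<circ> (s \<circ> g \<circ> ?i s) \<circ> ?i r))"
      by (rule sum.reindex_bij_betw[OF perm_group_bij[OF Q(1) s], symmetric])
    also have "\<dots> = (\<Sum>q\<in>Q. \<Sum>r\<in>Q. l (?i q \<circ> ?i r) (?i q \<circ> g \<circ> ?i r))"
    proof (rule sum.cong[OF refl])
      fix q assume q: "q \<in> Q"
      show "(\<Sum>r\<in>Q. l (?i (s \<circ> q) \<circ> ?i r) (?i (s \<circ> q) \<circ> (s \<circ> g \<circ> ?i s) \<circ> ?i r)) =
          (\<Sum>r\<in>Q. l (?i q \<circ> ?i r) (?i q \<circ> g \<circ> ?i r))"
        by (rule sum.reindex_bij_witness[of _ "\<lambda>r. r \<circ> ?i s" "\<lambda>r. r \<circ> s"])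
          (use q s D S in \<open>simp_all add: comp_assoc\<close>)
    qed
    finally show ?thesis by (simp add: e_def)
  qed
  have id: "int p dvd conv Q i e g - i g" if i: "i \<in> I" for i g
  proof -
    have "conv Q i e g = c * (\<Sum>t\<in>Q. \<Sum>q\<in>Q. \<Sum>r\<in>Q. i t * l (?i q \<circ> ?i r) (?i q \<circ> (?i t \<circ> g) \<circ> ?i r))"
      by (simp add: conv_def e_def sum_distrib_left mult.left_commute)
    also have "(\<Sum>t\<in>Q. \<Sum>q\<in>Q. \<Sum>r\<in>Q. i t * l (?i q \<circ> ?i r) (?i q \<circ> (?i t \<circ> g) \<circ> ?i r)) =
        (\<Sum>t\<in>Q. \<Sum>s\<in>Q. \<Sum>r\<in>Q. i t * l (?i s \<circ> t \<circ> ?i r) (?i s \<circ> g \<circ> ?i r))"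
    proof (rule sum.cong[OF refl])
      fix t assume t: "t \<in> Q"
      show "(\<Sum>q\<in>Q. \<Sum>r\<in>Q. i t * l (?i q \<circ> ?i r) (?i q \<circ> (?i t \<circ> g) \<circ> ?i r)) =
          (\<Sum>s\<in>Q. \<Sum>r\<in>Q. i t * l (?i s \<circ> t \<circ> ?i r) (?i s \<circ> g \<circ> ?i r))"
        by (rule sum.reindex_bij_witness[of _ "\<lambda>s. ?i t \<circ> s" "\<lambda>q. t \<circ> q"])
          (use t D S in \<open>simp_all add: comp_assoc\<close>)
    qed
    also have "\<dots> = (\<Sum>s\<in>Q. \<Sum>t\<in>Q. \<Sum>r\<in>Q. i t * l (?i s \<circ> t \<circ> ?i r) (?i s \<circ> g \<circ> ?i r))"
      by (rule sum.swap)
    also have "\<dots> = (\<Sum>s\<in>Q. \<Sum>r\<in>Q. \<Sum>t\<in>Q. i t * l (?i s \<circ> t \<circ> ?i r) (?i s \<circ> g \<circ> ?i r))"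
      by (rule sum.cong[OF refl], rule sum.swap)
    also have "\<dots> = (\<Sum>s\<in>Q. \<Sum>r\<in>Q. \<Sum>h\<in>Q. i (s \<circ> h \<circ> r) * l h (?i s \<circ> g \<circ> ?i r))"
    proof (rule sum.cong[OF refl], rule sum.cong[OF refl])
      fix s r assume sr: "s \<in> Q" "r \<in> Q"
      show "(\<Sum>t\<in>Q. i t * l (?i s \<circ> t \<circ> ?i r) (?i s \<circ> g \<circ> ?i r)) =
          (\<Sum>h\<in>Q. i (s \<circ> h \<circ> r) * l h (?i s \<circ> g \<circ> ?i r))"
        by (rule sum.reindex_bij_witness[of _ "\<lambda>h. s \<circ> h \<circ> r" "\<lambda>t. ?i s \<circ> t \<circ> ?i r"])
          (use sr D S in \<open>simp_all add: comp_assoc\<close>)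
    qed
    finally have *: "conv Q i e g = c * (\<Sum>s\<in>Q. \<Sum>r\<in>Q. \<Sum>h\<in>Q. i (s \<circ> h \<circ> r) * l h (?i s \<circ> g \<circ> ?i r))" .
    have "int p dvd (\<Sum>h\<in>Q. i (s \<circ> h \<circ> r) * l h (?i s \<circ> g \<circ> ?i r)) - i g" if "s \<in> Q" "r \<in> Q" for s r
      using l(2)[OF I(3)[OF i that], of "?i s \<circ> g \<circ> ?i r"] that S by (simp add: comp_assoc)
    then have "int p dvd (\<Sum>s\<in>Q. \<Sum>r\<in>Q. (\<Sum>h\<in>Q. i (s \<circ> h \<circ> r) * l h (?i s \<circ> g \<circ> ?i r)) - i g)"
      by (intro dvd_sum)
    then have 1: "int p dvd (\<Sum>s\<in>Q. \<Sum>r\<in>Q. \<Sum>h\<in>Q. i (s \<circ> h \<circ> r) * l h (?i s \<circ> g \<circ> ?i r)) - int (card Q) * (int (card Q) * i g)"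
      by (simp add: sum_subtractf)
    have "conv Q i e g - i g = c * ((\<Sum>s\<in>Q. \<Sum>r\<in>Q. \<Sum>h\<in>Q. i (s \<circ> h \<circ> r) * l h (?i s \<circ> g \<circ> ?i r)) - int (card Q) * (int (card Q) * i g))
        + (m * int (card Q) - 1) * (m * int (card Q) + 1) * i g"
      unfolding * c_def by (simp add: algebra_simps)
    then show ?thesis by (simp only: dvd_add[OF dvd_mult[OF 1] dvd_mult2[OF dvd_mult2[OF m]]])
  qed
  show ?thesis by (rule that[OF eI cl id])
qed

context normalised_module
begin

abbreviation "cj g \<equiv> x \<circ> g \<circ> y"
abbreviation "cj' g \<equiv> y \<circ> g \<circ> x"

lemma xy_comp [simp]: "x \<circ> y = id" "y \<circ> x = id" "x \<circ> (y \<circ> h) = h" "y \<circ> (x \<circ> h) = h"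
  by (auto simp: fun_eq_iff)

lemma bij_cj: "bij_betw (\<lambda>q. cj q) Q Q"
  by (rule bij_betw_byWitness[where f' = "\<lambda>q. cj' q"])
    (use xQ conj_mem' in \<open>auto simp: comp_assoc\<close>)

lemma cj_mem_iff: "cj g \<in> Q \<longleftrightarrow> g \<in> Q"
proof
  assume "cj g \<in> Q"
  then have "cj' (cj g) \<in> Q" by (rule conj_mem')
  then show "g \<in> Q" by (simp add: comp_assoc)
qed (rule xQ)

lemma inv_cj: assumes q: "q \<in> Q" shows "inv_into UNIV (cj q) = cj (inv_into UNIV q)"
proof -
  have by': "bij y" using x(1) by (rule bij_imp_bij_inv)
  have bq: "bij q" using QD(4)[OF q] .
  have "inv_into UNIV (x \<circ> q \<circ> y) = inv_into UNIV y \<circ> inv_into UNIV (x \<circ> q)"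
    by (rule o_inv_distrib[OF bij_comp[OF bq x(1)] by'])
  also have "inv_into UNIV (x \<circ> q) = inv_into UNIV q \<circ> y" by (rule o_inv_distrib[OF x(1) bq])
  also have "inv_into UNIV y = x" by (rule inv_inv_eq[OF x(1)])
  finally show ?thesis by (simp only: comp_assoc)
qed

text \<open>Let \<open>I\<close> be the annihilator of \<open>U\<close> in the group ring and
  \<open>e\<close> its identity. Some \<open>\<alpha>\<close> acts as \<open>N\<close>, and so does
  \<open>\<alpha> (1 - e)\<close>. As \<open>N\<close> commutes with \<open>x\<close>, conjugation
  by \<open>x\<close> changes \<open>\<alpha>\<close> by an element of \<open>I\<close>, which
  \<open>1 - e\<close> kills modulo \<open>p\<close>; \<open>e\<close> itself is invariant modulo
  \<open>p\<close> because the identity of \<open>I\<close> is unique.\<close>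

lemma invariant_coeffs:
  obtains \<beta> :: "('v \<Rightarrow> 'v) \<Rightarrow> int" where "\<And>u. u \<in> U \<Longrightarrow> N u = (\<Sum>q\<in>Q. zscale (\<beta> q) (q u))"
    "\<And>q. q \<in> Q \<Longrightarrow> int p dvd \<beta> (cj q) - \<beta> q"
proof -
  note S = perm_group_simps[OF Q(1)]
  let ?i = "inv_into UNIV :: ('v \<Rightarrow> 'v) \<Rightarrow> 'v \<Rightarrow> 'v"
  define act where "act i u = (\<Sum>q\<in>Q. zscale (i q) (q u))" for i :: "('v \<Rightarrow> 'v) \<Rightarrow> int" and u
  define I where "I = {i. (\<forall>h. h \<notin> Q \<longrightarrow> i h = 0) \<and> (\<forall>u \<in> U. act i u = 0)}"
  have ID: "i h = 0" if "i \<in> I" "h \<notin> Q" for i h using that unfolding I_def by blast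
  have IA: "act i u = 0" if "i \<in> I" "u \<in> U" for i u using that unfolding I_def by blast
  have II: "i \<in> I" if "\<And>h. h \<notin> Q \<Longrightarrow> i h = 0" "\<And>u. u \<in> U \<Longrightarrow> act i u = 0" for i
    using that unfolding I_def by blast
  have act_left: "act (\<lambda>h. i (s \<circ> h)) u = ?i s (act i u)" if s: "s \<in> Q" and u: "u \<in> U" for i s u
  proof -
    have "?i s (act i u) = (\<Sum>q\<in>Q. zscale (i q) ((?i s \<circ> q) u))"
      unfolding act_def using ahom_sum[OF U(1) Q(3)[OF QD(5)[OF s]], of Q "\<lambda>q. zscale (i q) (q u)"]
        ahom_scale[OF U(1) Q(3)[OF QD(5)[OF s]]] u by simp
    also have "\<dots> = (\<Sum>q\<in>Q. zscale (i (s \<circ> q)) ((?i s \<circ> (s \<circ> q)) u))"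
      by (rule sum.reindex_bij_betw[OF perm_group_bij[OF Q(1) s], symmetric])
    finally show ?thesis using s S by (simp add: act_def del: comp_apply)
  qed
  have act_right: "act (\<lambda>h. i (h \<circ> r)) u = act i (?i r u)" if r: "r \<in> Q" for i r u
    unfolding act_def
    by (rule sum.reindex_bij_witness[of _ "\<lambda>q. q \<circ> ?i r" "\<lambda>q. q \<circ> r"])
      (use r S QD bij_is_surj[OF QD(4)[OF r]] in \<open>simp_all add: comp_assoc surj_f_inv_f del: comp_apply, simp add: surj_f_inv_f\<close>)
  have act_cj: "act (\<lambda>h. i (cj h)) u = y (act i (x u))" if u: "u \<in> U" for i u
  proof -
    have "y (act i (x u)) = (\<Sum>q\<in>Q. zscale (i q) (cj' q u))"
      unfolding act_def using ahom_sum[OF U(1) y, of Q "\<lambda>q. zscale (i q) (q (x u))"] ahom_scale[OF U(1) y] u by simp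
    also have "\<dots> = (\<Sum>q\<in>Q. zscale (i (cj q)) (cj' (cj q) u))"
      by (rule sum.reindex_bij_betw[OF bij_cj, symmetric])
    finally show ?thesis by (simp add: act_def)
  qed
  have act_cj': "act (\<lambda>h. i (cj' h)) u = x (act i (y u))" if u: "u \<in> U" for i u
    using act_cj[of "y u" "\<lambda>h. i (cj' h)"] u by (simp add: comp_assoc)
  have act_add: "act (\<lambda>s. i s + k * j s) u = act i u + zscale k (act j u)" for i j k u
    by (simp add: act_def zm.scale_left_distrib sum.distrib zm.scale_sum_right)
  have I_cj: "(\<lambda>h. i (cj h)) \<in> I" if "i \<in> I" for i
    by (rule II) (simp_all add: act_cj IA[OF that] ID[OF that] cj_mem_iff ahom_zero[OF U(1) y] del: comp_apply)
  have cj'_mem: "cj' h \<in> Q \<longleftrightarrow> h \<in> Q" for h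
    using cj_mem_iff[of "cj' h"] by (simp add: comp_assoc)
  have I_cj': "(\<lambda>h. i (cj' h)) \<in> I" if "i \<in> I" for i
    by (rule II) (simp_all add: act_cj' IA[OF that] ID[OF that] cj'_mem ahom_zero[OF U(1) x(2)] del: comp_apply)
  obtain e where e: "e \<in> I" "\<And>s g. s \<in> Q \<Longrightarrow> e (s \<circ> g \<circ> ?i s) = e g"
    "\<And>i g. i \<in> I \<Longrightarrow> int p dvd conv Q i e g - i g"
  proof (rule ideal_identity[OF p Q(1,2), of I])
    show "(\<lambda>s. i s + k * j s) \<in> I" if "i \<in> I" "j \<in> I" for i j k
      by (rule II) (simp_all add: act_add ID[OF that(1)] ID[OF that(2)] IA[OF that(1)] IA[OF that(2)])
    show "(\<lambda>_. 0) \<in> I" by (rule II) (auto simp: act_def)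
    show "(\<lambda>h. i (s \<circ> h \<circ> r)) \<in> I" if i: "i \<in> I" and s: "s \<in> Q" and r: "r \<in> Q" for i s r
    proof (rule II)
      show "i (s \<circ> h \<circ> r) = 0" if "h \<notin> Q" for h
        using ID[OF i] that S(7)[OF s] S(8)[OF r] by metis
      show "act (\<lambda>h. i (s \<circ> h \<circ> r)) u = 0" if u: "u \<in> U" for u
      proof -
        have "act (\<lambda>h. i (s \<circ> h \<circ> r)) u = act (\<lambda>h. i (s \<circ> h)) (?i r u)"
          using act_right[OF r, of "\<lambda>h. i (s \<circ> h)" u] by (simp add: comp_assoc)
        also have "\<dots> = ?i s (act i (?i r u))"
          using act_left[OF s] U_mem(2)[OF QD(5)[OF r] u] by simp
        also have "\<dots> = 0"
          using IA[OF i U_mem(2)[OF QD(5)[OF r] u]] ahom_zero[OF U(1) Q(3)[OF QD(5)[OF s]]] by simp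
        finally show ?thesis .
      qed
    qed
    show "i h = 0" if "i \<in> I" "h \<notin> Q" for i h using ID that .
  qed (rule that)
  \<comment> \<open>A class function is central in the group ring, so the right identity is also a
    left identity.\<close>
  have e_left: "int p dvd conv Q e i g - i g" if i: "i \<in> I" and g: "g \<in> Q" for i g
  proof -
    have "conv Q e i g = (\<Sum>h\<in>Q. i h * e (g \<circ> ?i h))"
      unfolding conv_def
    proof (rule sum.reindex_bij_witness[of _ "\<lambda>h. g \<circ> ?i h" "\<lambda>q. ?i q \<circ> g"])
      fix q assume q: "q \<in> Q"
      have *: "g \<circ> ?i (?i q \<circ> g) = q" by (simp only: S(6)[OF QD(5)[OF q] g] S(5)[OF q] S(4)[OF g])
      then show "g \<circ> ?i (?i q \<circ> g) = q" "i (?i q \<circ> g) * e (g \<circ> ?i (?i q \<circ> g)) = e q * i (?i q \<circ> g)"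
        by (simp_all only: mult.commute)
      show "?i q \<circ> g \<in> Q" by (rule QD(3)[OF QD(5)[OF q] g])
      show "?i (g \<circ> ?i q) \<circ> g = q" by (simp only: S(6)[OF g QD(5)[OF q]] S(5)[OF q] comp_assoc S(1)[OF g] comp_id)
      show "g \<circ> ?i q \<in> Q" by (rule QD(3)[OF g QD(5)[OF q]])
    qed
    also have "\<dots> = conv Q i e g"
      unfolding conv_def
    proof (rule sum.cong[OF refl])
      fix h assume h: "h \<in> Q"
      have "e (h \<circ> (?i h \<circ> g) \<circ> ?i h) = e (?i h \<circ> g)" by (rule e(2)[OF h])
      then show "i h * e (g \<circ> ?i h) = i h * e (?i h \<circ> g)" using S(4)[OF h] by simp
    qed
    finally show ?thesis using e(3)[OF i] by simp
  qed
  define ex where "ex = (\<lambda>h. e (cj h))"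
  have exI: "ex \<in> I" unfolding ex_def by (rule I_cj[OF e(1)])
  have ex_left: "int p dvd conv Q ex i g - i g" if i: "i \<in> I" and g: "g \<in> Q" for i g
  proof -
    have "conv Q e (\<lambda>h. i (cj' h)) (cj g) = (\<Sum>q\<in>Q. e (cj q) * i (cj' (?i (cj q) \<circ> cj g)))"
      unfolding conv_def by (rule sum.reindex_bij_betw[OF bij_cj, symmetric])
    also have "\<dots> = conv Q ex i g"
      unfolding conv_def ex_def by (rule sum.cong[OF refl]) (simp add: inv_cj[unfolded comp_assoc] comp_assoc)
    finally have "conv Q ex i g = conv Q e (\<lambda>h. i (cj' h)) (cj g)" by simp
    moreover have "int p dvd conv Q e (\<lambda>h. i (cj' h)) (cj g) - i (cj' (cj g))"
      using e_left[OF I_cj'[OF i]] g cj_mem_iff by blast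
    ultimately show ?thesis by (simp add: comp_assoc)
  qed
  \<comment> \<open>The conjugate of \<open>e\<close> is a left identity of \<open>I\<close> and
    \<open>e\<close> is a right identity, so both agree modulo \<open>p\<close> with their
    product.\<close>
  have ex_e: "int p dvd ex g - e g" for g
  proof (cases "g \<in> Q")
    case True
    have "ex g - e g = (conv Q ex e g - e g) - (conv Q ex e g - ex g)" by simp
    then show ?thesis using ex_left[OF e(1) True] e(3)[OF exI, of g] by (simp only: dvd_diff)
  next
    case False then show ?thesis using ID[OF e(1)] ID[OF exI] by simp
  qed
  obtain \<alpha>0 :: "('v \<Rightarrow> 'v) \<Rightarrow> int" where \<alpha>0: "\<And>u. u \<in> U \<Longrightarrow> N u = (\<Sum>q\<in>Q. zscale (\<alpha>0 q) (q u))"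
  proof (rule bicommutant[OF N])
    fix f u assume f: "equivariant f" and u: "u \<in> U"
    then have hf: "ahom U U f" by (simp add: equivariant_def)
    show "N (f u) = f (N u)"
      unfolding N_def using x_commutes_equivariant[OF f u] ahom_diff[OF U(1) hf] u by simp
  qed (rule that)
  define \<alpha> where "\<alpha> q = (if q \<in> Q then \<alpha>0 q else 0)" for q
  have \<alpha>: "act \<alpha> u = N u" if "u \<in> U" for u
    using \<alpha>0[OF that] unfolding act_def by (simp add: \<alpha>_def)
  \<comment> \<open>The correction \<open>\<alpha> e\<close> lies in the annihilator, so the action
    is unchanged, while the ambiguity in \<open>\<alpha>\<close> is removed.\<close>
  define \<beta> where "\<beta> g = \<alpha> g - conv Q \<alpha> e g" for g
  have "act (conv Q \<alpha> e) u = 0" if u: "u \<in> U" for u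
  proof -
    have "act (conv Q \<alpha> e) u = (\<Sum>q\<in>Q. \<Sum>r\<in>Q. zscale (\<alpha> r) (zscale (e (?i r \<circ> q)) (q u)))"
      by (simp add: act_def conv_def zm.scale_sum_left)
    also have "\<dots> = (\<Sum>r\<in>Q. \<Sum>q\<in>Q. zscale (\<alpha> r) (zscale (e (?i r \<circ> q)) (q u)))"
      by (rule sum.swap)
    also have "\<dots> = (\<Sum>r\<in>Q. zscale (\<alpha> r) (act (\<lambda>q. e (?i r \<circ> q)) u))"
      by (simp add: act_def zm.scale_sum_right)
    also have "\<dots> = 0"
    proof (rule sum.neutral, rule ballI)
      fix r assume r: "r \<in> Q"
      have "act (\<lambda>q. e (?i r \<circ> q)) u = 0"
        using act_left[OF QD(5)[OF r] u, of e] IA[OF e(1) u] S(5)[OF r] ahom_zero[OF U(1) Q(3)[OF r]] by simp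
      then show "zscale (\<alpha> r) (act (\<lambda>q. e (?i r \<circ> q)) u) = 0" by simp
    qed
    finally show ?thesis .
  qed
  then have 1: "act \<beta> u = N u" if "u \<in> U" for u
    using act_add[of \<alpha> "- 1" "conv Q \<alpha> e" u] \<alpha>[OF that] that by (simp add: \<beta>_def[abs_def])
  have 2: "int p dvd \<beta> (cj g) - \<beta> g" if g: "g \<in> Q" for g
  proof -
    define d where "d = (\<lambda>h. \<alpha> (cj h) + - 1 * \<alpha> h)"
    have dI: "d \<in> I"
    proof (rule II)
      show "d h = 0" if "h \<notin> Q" for h using that cj_mem_iff by (simp add: d_def \<alpha>_def)
      show "act d u = 0" if u: "u \<in> U" for u
        unfolding d_def act_add using act_cj[OF u, of \<alpha>] \<alpha>[OF u] \<alpha>[of "x u"] u yN1[of "x u"] by simp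
    qed
    have "conv Q \<alpha> e (cj g) = (\<Sum>q\<in>Q. \<alpha> (cj q) * e (?i (cj q) \<circ> cj g))"
      unfolding conv_def by (rule sum.reindex_bij_betw[OF bij_cj, symmetric])
    also have "\<dots> = (\<Sum>q\<in>Q. \<alpha> (cj q) * ex (?i q \<circ> g))"
      by (rule sum.cong[OF refl]) (simp add: inv_cj[unfolded comp_assoc] comp_assoc ex_def)
    finally have "\<beta> (cj g) - \<beta> g = - (conv Q d e g - d g) - (\<Sum>q\<in>Q. \<alpha> (cj q) * (ex (?i q \<circ> g) - e (?i q \<circ> g)))"
      by (simp add: \<beta>_def d_def conv_def algebra_simps sum.distrib sum_subtractf sum_negf)
    moreover have "int p dvd (\<Sum>q\<in>Q. \<alpha> (cj q) * (ex (?i q \<circ> g) - e (?i q \<circ> g)))"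
      by (intro dvd_sum dvd_mult ex_e)
    moreover have "int p dvd - (conv Q d e g - d g)" using e(3)[OF dI] by (simp only: dvd_minus_iff)
    ultimately show ?thesis by (simp only: dvd_diff)
  qed
  show ?thesis
  proof (rule that[of \<beta>])
    show "N u = (\<Sum>q\<in>Q. zscale (\<beta> q) (q u))" if "u \<in> U" for u using 1[OF that] by (simp add: act_def)
  qed (rule 2)
qed

text \<open>On \<open>u\<close> with \<open>N (N u) = 0\<close> the iterates of \<open>x\<close> are linear in the exponent, so that a conjugation orbit of
  length \<open>p\<close> contributes sums of polynomials of degree below \<open>p - 1\<close> over \<open>\<int>/p\<close>, which vanish.\<close>

lemma N_kernel_square:
  assumes u: "u \<in> U" and NN: "N (N u) = 0"
  shows "N u = 0"
proof -
  obtain \<beta> :: "('v \<Rightarrow> 'v) \<Rightarrow> int" where \<beta>: "\<And>u. u \<in> U \<Longrightarrow> N u = (\<Sum>q\<in>Q. zscale (\<beta> q) (q u))"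
    "\<And>q. q \<in> Q \<Longrightarrow> int p dvd \<beta> (cj q) - \<beta> q"
    by (rule invariant_coeffs) (rule that)
  define C where "C = {q \<in> Q. cj q = q}"
  define S where "S = Q - C"
  define c where "c q = cj q" for q
  have finS: "finite S" and CQ: "C \<subseteq> Q" and SQ: "\<And>q. q \<in> S \<Longrightarrow> q \<in> Q" using QD(1) by (auto simp: S_def C_def)
  have injc: "inj_on c Q" using bij_cj by (simp add: bij_betw_def c_def[abs_def])
  have cS: "c q \<in> S" if "q \<in> S" for q
  proof -
    have "q \<in> Q" "c q \<noteq> q" using that by (auto simp: S_def C_def c_def)
    then have "c q \<in> Q" "c (c q) \<noteq> c q" using inj_onD[OF injc, of "c q" q] xQ by (auto simp: c_def)
    then show ?thesis by (simp add: S_def C_def c_def)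
  qed
  have bijS: "bij_betw c S S"
  proof -
    have "inj_on c S" by (rule inj_on_subset[OF injc]) (use SQ in blast)
    moreover from this have "c ` S = S" by (intro endo_inj_surj[OF finS]) (use cS in blast)+
    ultimately show ?thesis by (simp add: bij_betw_def)
  qed
  have cpow: "(c ^^ i) q v = (x ^^ i) (q ((y ^^ i) v))" for i q v
  proof (induction i arbitrary: v)
    case (Suc i)
    have "(c ^^ Suc i) q v = x ((c ^^ i) q (y v))" by (simp add: c_def)
    also have "\<dots> = x ((x ^^ i) (q ((y ^^ i) (y v))))" by (simp only: Suc)
    finally show ?case by (simp add: funpow_swap1[of y])
  qed simp
  have xyi: "(x ^^ i) ((y ^^ i) v) = v" for i v
    by (induction i arbitrary: v) (simp_all add: funpow_swap1)
  have cp: "(c ^^ p) q = q" for q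
  proof
    fix v have "(y ^^ p) v = v" using xyi[of p v] x_pow_p by simp
    then show "(c ^^ p) q v = q v" using cpow[of p q v] x_pow_p by simp
  qed
  have free: "c q \<noteq> q" if "q \<in> S" for q using that by (simp add: S_def C_def c_def)
  \<comment> \<open>Counting the free orbits: \<open>card C\<close> is congruent to
    \<open>card Q\<close> modulo \<open>p\<close>. Thus \<open>C\<close>, the centraliser of
    \<open>x\<close> in \<open>Q\<close>, again has order prime to \<open>p\<close> and admits
    equivariant projections.\<close>
  have "int (card S) \<in> {k. int p dvd k}"
    using sum_over_free_orbits[OF p, of "{k. int p dvd k}" S c "\<lambda>_. 1"] finS bijS cp free by simp
  then have "p dvd card S" by simp
  moreover have "card Q = card C + card S" using CQ QD(1)
    by (metis S_def card_mono card_Diff_subset finite_subset le_add_diff_inverse)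
  moreover have "\<not> p dvd card Q" using Q(2) p by (auto dest: coprime_common_divisor[of _ _ p])
  ultimately have "\<not> p dvd card C" by (metis dvd_add)
  then have copC: "coprime (card C) p" using p by (simp add: coprime_commute prime_imp_coprime)
  have pgC: "perm_group C"
    unfolding perm_group_def
  proof (intro conjI ballI)
    show "finite C" using CQ QD(1) finite_subset by blast
    show "id \<in> C" using QD(2) by (simp add: C_def)
  next
    fix q r assume q: "q \<in> C" and r: "r \<in> C"
    have "cj (q \<circ> r) = cj q \<circ> cj r" by (simp add: comp_assoc)
    then show "q \<circ> r \<in> C" using q r QD(3)[of q r] unfolding C_def by simp
  next
    fix q assume "q \<in> C"
    then have q: "q \<in> Q" "cj q = q" by (auto simp: C_def)
    show "bij q" using QD(4)[OF q(1)] .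
    show "inv_into UNIV q \<in> C" using QD(5)[OF q(1)] inv_cj[OF q(1)] q(2) by (simp add: C_def)
  qed
  have xC: "x (q v) = q (x v)" if "q \<in> C" for q v
  proof -
    have "cj q (x v) = q (x v)" using that by (simp add: C_def)
    then show ?thesis by simp
  qed
  have NC: "N (q v) = q (N v)" if "q \<in> C" "v \<in> U" for q v
    using xC[OF that(1), of v] ahom_diff[OF U(1) Q(3)[OF subsetD[OF CQ that(1)]], of "x v" v] that(2)
    by (simp add: N_def)
  define Y where "Y = {v \<in> U. N (N v) = 0}"
  define M where "M = {v \<in> U. N v = 0}"
  have sY: "zm.subspace Y" and sM: "zm.subspace M"
    unfolding Y_def M_def by (auto intro!: zm.subspaceI simp: ahom_zero[OF U(1) N] ahom_add[OF N] ahom_scale[OF U(1) N])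
  have MY: "M \<subseteq> Y" and YU: "Y \<subseteq> U" by (auto simp: M_def Y_def ahom_zero[OF U(1) N])
  \<comment> \<open>Coefficients are constant on conjugation orbits modulo \<open>p\<close>, so each
    free orbit contributes one coefficient times an orbit sum.\<close>
  have NY: "N v = (\<Sum>q\<in>C. zscale (\<beta> q) (q v))" if v: "v \<in> Y" for v
  proof -
    have vU: "v \<in> U" and Nv: "N (N v) = 0" using v by (auto simp: Y_def)
    have \<beta>c: "int p dvd \<beta> ((c ^^ i) q) - \<beta> q" if "q \<in> S" for i q
    proof (induction i)
      case (Suc i)
      have "(c ^^ i) q \<in> S" using that cS by (induction i) auto
      then have "int p dvd \<beta> (c ((c ^^ i) q)) - \<beta> ((c ^^ i) q)" using \<beta>(2) SQ by (simp add: c_def)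
      from dvd_add[OF this Suc] show ?case by simp
    qed simp
    have yi: "(y ^^ i) v = v - zscale (int i) (N v)" for i
    proof (induction i)
      case (Suc i)
      have x1: "x (N v) = N v" using Nv by (simp add: N_def[of "N v"])
      then have y1: "y (N v) = N v" by (metis xy(2))
      have "y v = v - N v"
      proof -
        have "x (v - N v) = x v - N v" using ahom_diff[OF U(1) x(2)] vU x1 by simp
        then have "x (v - N v) = v" by (simp add: N_def)
        then show ?thesis by (metis xy(2))
      qed
      moreover have "y (v - zscale (int i) (N v)) = y v - zscale (int i) (y (N v))"
        using ahom_diff[OF U(1) y] ahom_scale[OF U(1) y] vU by simp
      moreover have "(y ^^ Suc i) v = y (v - zscale (int i) (N v))" using Suc by simp
      ultimately have "(y ^^ Suc i) v = v - N v - zscale (int i) (N v)" using y1 by simp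
      then show ?case by (simp only: of_nat_Suc zm.scale_left_distrib zm.scale_one diff_diff_add)
    qed simp
    have "(\<Sum>q\<in>S. zscale (\<beta> q) (q v)) \<in> {0}"
    proof (rule sum_over_free_orbits[OF p _ _ finS bijS cp free])
      fix q assume q: "q \<in> S"
      note hq = Q(3)[OF SQ[OF q]]
      have qU: "q w \<in> U" if "w \<in> U" for w using ahom_closed[OF hq that] .
      have hx: "ahom U U (x ^^ i)" for i
      proof (induction i)
        case 0 show ?case by (simp add: ahom_def)
      next
        case (Suc i) show ?case using ahom_comp[OF Suc x(2)] by (simp add: comp_def)
      qed
      have summand: "zscale (\<beta> ((c ^^ i) q)) ((c ^^ i) q v) =
          zscale (\<beta> q) ((x ^^ i) (q v) - zscale (int i) ((x ^^ i) (q (N v))))" for i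
      proof -
        have "(c ^^ i) q v = (x ^^ i) (q v) - zscale (int i) ((x ^^ i) (q (N v)))"
          unfolding cpow yi using ahom_diff[OF U(1) hq] ahom_scale[OF U(1) hq] ahom_diff[OF U(1) hx] ahom_scale[OF U(1) hx] vU qU
          by simp
        moreover have "zscale (\<beta> ((c ^^ i) q)) ((x ^^ i) (q v) - zscale (int i) ((x ^^ i) (q (N v)))) =
            zscale (\<beta> q) ((x ^^ i) (q v) - zscale (int i) ((x ^^ i) (q (N v))))"
          by (rule zscale_cong[OF U(3) \<beta>c[OF q]]) (use vU qU in auto)
        ultimately show ?thesis by simp
      qed
      have "(\<Sum>i<p. zscale (\<beta> ((c ^^ i) q)) ((c ^^ i) q v)) =
          zscale (\<beta> q) ((\<Sum>i<p. (x ^^ i) (q v)) - (\<Sum>i<p. zscale (int i) ((x ^^ i) (q (N v)))))"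
        unfolding summand zm.scale_sum_right[symmetric] sum_subtractf ..
      then show "(\<Sum>i<p. zscale (\<beta> ((c ^^ i) q)) ((c ^^ i) q v)) \<in> {0}"
        using sum_x_pow[of "q v"] sum_x_pow[of "q (N v)"] qU vU by simp
    qed auto
    moreover have "(\<Sum>q\<in>Q. zscale (\<beta> q) (q v)) = (\<Sum>q\<in>S. zscale (\<beta> q) (q v)) + (\<Sum>q\<in>C. zscale (\<beta> q) (q v))"
      unfolding S_def by (rule sum.subset_diff[OF CQ QD(1)])
    ultimately show ?thesis using \<beta>(1)[OF vU] by simp
  qed
  have CY1: "q v \<in> Y" if q: "q \<in> C" and v: "v \<in> Y" for q v
  proof -
    have v: "v \<in> U" "N (N v) = 0" using v by (auto simp: Y_def)
    have qQ: "q \<in> Q" using q CQ by blast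
    have "N (N (q v)) = q (N (N v))" using NC[OF q] v(1) by simp
    then show ?thesis using v qQ ahom_zero[OF U(1) Q(3)[OF qQ]] by (simp add: Y_def)
  qed
  have CM: "q v \<in> M" if q: "q \<in> C" and v: "v \<in> M" for q v
  proof -
    have v: "v \<in> U" "N v = 0" using v by (auto simp: M_def)
    have qQ: "q \<in> Q" using q CQ by blast
    show ?thesis using NC[OF q] v qQ ahom_zero[OF U(1) Q(3)[OF qQ]] by (simp add: M_def)
  qed
  obtain \<pi> where \<pi>: "ahom Y M \<pi>" "\<And>m. m \<in> M \<Longrightarrow> \<pi> m = m" "\<And>q v. q \<in> C \<Longrightarrow> v \<in> Y \<Longrightarrow> \<pi> (q v) = q (\<pi> v)"
  proof (rule equivariant_projection[OF p sY finite_subset[OF YU U(2)] U(3) sM MY pgC copC, where a = "\<lambda>q. q"])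
    show "ahom Y Y q" if q: "q \<in> C" for q
    proof (rule ahomI)
      show "q (v + w) = q v + q w" if "v \<in> Y" "w \<in> Y" for v w
        using ahom_add[OF Q(3)[OF subsetD[OF CQ q]]] subsetD[OF YU] that by simp
    qed (rule CY1[OF q])
  qed (use YU CM in \<open>auto intro: that\<close>)
  have uY: "u \<in> Y" using u NN by (simp add: Y_def)
  have CY: "zscale k (q u) \<in> Y" if "q \<in> C" for k q
    by (rule zm.subspace_scale[OF sY CY1[OF that uY]])
  \<comment> \<open>On \<open>Y\<close>, \<open>N\<close> is a combination of elements of
    \<open>C\<close>, all of which commute with \<open>\<pi>\<close>. So \<open>N u\<close>, being
    in \<open>M\<close>, equals \<open>N (\<pi> u)\<close>, and \<open>\<pi> u\<close> lies in the
    kernel of \<open>N\<close>.\<close>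
  have "N u \<in> M" using u NN by (simp add: M_def)
  then have "N u = \<pi> (N u)" using \<pi>(2) by simp
  also have "\<dots> = (\<Sum>q\<in>C. \<pi> (zscale (\<beta> q) (q u)))"
    unfolding NY[OF uY] by (rule ahom_sum[OF sY \<pi>(1) CY])
  also have "\<dots> = (\<Sum>q\<in>C. zscale (\<beta> q) (q (\<pi> u)))"
  proof (rule sum.cong[OF refl])
    fix q assume q: "q \<in> C"
    show "\<pi> (zscale (\<beta> q) (q u)) = zscale (\<beta> q) (q (\<pi> u))"
      using ahom_scale[OF sY \<pi>(1) CY1[OF q uY]] \<pi>(3)[OF q uY] by simp
  qed
  also have "\<dots> = N (\<pi> u)" using NY[OF subsetD[OF MY ahom_closed[OF \<pi>(1) uY]]] by simp
  also have "\<dots> = 0" using ahom_closed[OF \<pi>(1) uY] by (simp add: M_def)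
  finally show ?thesis .
qed

text \<open>Since the kernels of \<open>N\<close> and \<open>N^2\<close> agree, the kernels of all
  positive powers agree, and a nilpotent \<open>N\<close> is zero.\<close>

theorem x_trivial:
  assumes u: "u \<in> U" shows "x u = u"
proof -
  have "(N ^^ Suc k) v = 0 \<Longrightarrow> v \<in> U \<Longrightarrow> N v = 0" for k v
  proof (induction k)
    case (Suc k)
    have "N (N ((N ^^ k) v)) = 0" using Suc.prems by simp
    then have "N ((N ^^ k) v) = 0" by (rule N_kernel_square[OF Nk_mem[OF Suc.prems(2)]])
    then show ?case using Suc by simp
  qed simp
  moreover have "(N ^^ Suc (p - 2)) u = 0" by (rule Nk_zero[OF u]) simp
  ultimately have "N u = 0" using u by blast
  then show ?thesis by (simp add: N_def)
qed

end

section \<open>Conjugation and Sylow subgroups\<close>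

text \<open>The moved points form a union of orbits whose lengths are powers of \<open>p\<close>
  different from 1. Passing to the moved points first removes the singleton orbits from the
  count.\<close>

lemma card_moved_points:
  fixes H (structure)
  assumes H: "Group.group H" "order H = p ^ n" and p: "Factorial_Ring.prime (p::nat)" and E: "finite E"
    and act: "\<And>h e. h \<in> carrier H \<Longrightarrow> e \<in> E \<Longrightarrow> act h e \<in> E" "\<And>e. e \<in> E \<Longrightarrow> act \<one> e = e"
      "\<And>h k e. h \<in> carrier H \<Longrightarrow> k \<in> carrier H \<Longrightarrow> e \<in> E \<Longrightarrow> act (h \<otimes> k) e = act h (act k e)"
  shows "p dvd card {e \<in> E. \<exists>h \<in> carrier H. act h e \<noteq> e}"
proof -
  interpret H: Group.group H by fact
  define F where "F = {e \<in> E. \<exists>h \<in> carrier H. act h e \<noteq> e}"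
  have FE: "F \<subseteq> E" by (auto simp: F_def)
  then have finF: "finite F" using E finite_subset by blast
  have inv_act: "act (inv g) (act g e) = e" if "g \<in> carrier H" "e \<in> E" for g e
    using act(3)[of "inv g" g e] act(2) that by simp
  have clF: "act g e \<in> F" if g: "g \<in> carrier H" and e: "e \<in> F" for g e
  proof -
    obtain h where h: "h \<in> carrier H" "act h e \<noteq> e" and eE: "e \<in> E" using e unfolding F_def by blast
    let ?k = "g \<otimes> h \<otimes> inv g"
    have "act ?k (act g e) = act (g \<otimes> h) e"
      using act(3)[of "g \<otimes> h" "inv g" "act g e"] inv_act[OF g eE] act(1)[OF g eE] g h(1) by simp
    also have "\<dots> = act g (act h e)" using act(3) g h(1) eE by simp
    finally have k: "act ?k (act g e) = act g (act h e)" .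
    have "act ?k (act g e) \<noteq> act g e"
    proof
      assume "act ?k (act g e) = act g e"
      then have "act (inv g) (act g (act h e)) = act (inv g) (act g e)" using k by simp
      then show False using inv_act[OF g] act(1) h eE by simp
    qed
    then show ?thesis using act(1)[OF g eE] g h(1) unfolding F_def by auto
  qed
  \<comment> \<open>Restriction makes the maps extensional on \<open>F\<close>, as membership in
    \<open>Bij F\<close> demands.\<close>
  define \<phi> where "\<phi> g = (\<lambda>e \<in> F. act g e)" for g
  have bij: "\<phi> g \<in> Bij F" if g: "g \<in> carrier H" for g
  proof -
    have "bij_betw (act g) F F"
      by (rule bij_betw_byWitness[where f' = "act (inv g)"])
        (use g clF inv_act[OF g] inv_act[of "inv g"] FE in auto)
    then have "bij_betw (\<phi> g) F F" by (rule bij_betw_cong[THEN iffD1, rotated]) (simp add: \<phi>_def)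
    then show ?thesis by (simp add: Bij_def \<phi>_def)
  qed
  have hom: "\<phi> \<in> hom H (BijGroup F)"
  proof (rule homI)
    fix g h assume gh: "g \<in> carrier H" "h \<in> carrier H"
    have "\<phi> (g \<otimes> h) = compose F (\<phi> g) (\<phi> h)"
    proof
      fix e show "\<phi> (g \<otimes> h) e = compose F (\<phi> g) (\<phi> h) e"
        using gh clF act(3)[OF gh] FE by (cases "e \<in> F") (auto simp: \<phi>_def compose_def)
    qed
    then show "\<phi> (g \<otimes> h) = \<phi> g \<otimes>\<^bsub>BijGroup F\<^esub> \<phi> h" using gh bij by (simp add: BijGroup_def)
  qed (simp add: BijGroup_def bij)
  interpret A: group_action H F \<phi>
    by (simp add: group_action_def group_hom_def group_hom_axioms_def hom group_BijGroup H)
  have "p dvd card orb" if "orb \<in> orbits H F \<phi>" for orb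
  proof -
    obtain e where e: "e \<in> F" "orb = orbit H \<phi> e" using \<open>orb \<in> _\<close> unfolding orbits_def by blast
    have "card orb * card (stabilizer H \<phi> e) = p ^ n"
      using A.orbit_stabilizer_theorem[OF e(1)] H(2) e(2) by simp
    then obtain i where i: "card orb = p ^ i" using p by (metis divides_primepow_nat dvd_triv_left)
    obtain h where h: "h \<in> carrier H" "act h e \<noteq> e" using e(1) unfolding F_def by blast
    have "e \<in> orb" using A.orbit_refl[OF e(1)] e(2) by simp
    moreover have "act h e \<in> orb" using e h by (force simp: orbit_def \<phi>_def)
    ultimately have "card orb \<noteq> 1" using h(2) by (metis card_1_singletonE singletonD)
    then show ?thesis using i by (cases i) auto
  qed
  then have "p dvd (\<Sum>orb\<in>orbits H F \<phi>. card orb)" by (intro dvd_sum)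
  also have "\<dots> = card F" using A.disjoint_sum[OF finF, of "\<lambda>_. 1::nat"] by simp
  finally show ?thesis by (simp add: F_def)
qed

context Group.group
begin

lemma inv_mult_cancel [simp]:
  "g \<in> carrier G \<Longrightarrow> a \<in> carrier G \<Longrightarrow> inv g \<otimes> (g \<otimes> a) = a"
  "g \<in> carrier G \<Longrightarrow> a \<in> carrier G \<Longrightarrow> g \<otimes> (inv g \<otimes> a) = a"
  by (simp_all add: m_assoc[symmetric])

definition cnj :: "'a \<Rightarrow> 'a \<Rightarrow> 'a" where
  "cnj g a = g \<otimes> a \<otimes> inv g"

definition cmt :: "'a \<Rightarrow> 'a \<Rightarrow> 'a" where
  "cmt a b = a \<otimes> b \<otimes> inv a \<otimes> inv b"

lemma cnj_closed [simp]: "g \<in> carrier G \<Longrightarrow> a \<in> carrier G \<Longrightarrow> cnj g a \<in> carrier G"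
  by (simp add: cnj_def)

lemma cmt_closed [simp]: "a \<in> carrier G \<Longrightarrow> b \<in> carrier G \<Longrightarrow> cmt a b \<in> carrier G"
  by (simp add: cmt_def)

lemma cnj_mult: "g \<in> carrier G \<Longrightarrow> h \<in> carrier G \<Longrightarrow> a \<in> carrier G \<Longrightarrow> cnj (g \<otimes> h) a = cnj g (cnj h a)"
  by (simp add: cnj_def m_assoc inv_mult_group)

lemma cnj_hom: "g \<in> carrier G \<Longrightarrow> a \<in> carrier G \<Longrightarrow> b \<in> carrier G \<Longrightarrow> cnj g (a \<otimes> b) = cnj g a \<otimes> cnj g b"
  by (simp add: cnj_def m_assoc)

lemma cnj_one [simp]: "a \<in> carrier G \<Longrightarrow> cnj \<one> a = a" "g \<in> carrier G \<Longrightarrow> cnj g \<one> = \<one>"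
  by (simp_all add: cnj_def)

lemma cnj_inv: "g \<in> carrier G \<Longrightarrow> a \<in> carrier G \<Longrightarrow> cnj g (inv a) = inv (cnj g a)"
  by (simp add: cnj_def m_assoc inv_mult_group)

lemma cnj_cancel [simp]:
  "g \<in> carrier G \<Longrightarrow> a \<in> carrier G \<Longrightarrow> cnj (inv g) (cnj g a) = a"
  "g \<in> carrier G \<Longrightarrow> a \<in> carrier G \<Longrightarrow> cnj g (cnj (inv g) a) = a"
  by (simp_all add: cnj_mult[symmetric])

lemma cnj_pow: "g \<in> carrier G \<Longrightarrow> a \<in> carrier G \<Longrightarrow> cnj g (a [^] (n::nat)) = cnj g a [^] n"
  by (induction n) (simp_all add: cnj_hom)

lemma cnj_eq_iff: "g \<in> carrier G \<Longrightarrow> a \<in> carrier G \<Longrightarrow> cnj g a = a \<longleftrightarrow> g \<otimes> a = a \<otimes> g"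
  unfolding cnj_def using inv_solve_right'[of a "g \<otimes> a" g] by (metis inv_solve_right m_closed)

lemma cmt_cnj: "a \<in> carrier G \<Longrightarrow> b \<in> carrier G \<Longrightarrow> cmt a b = cnj a b \<otimes> inv b"
  by (simp add: cmt_def cnj_def)

lemma subgroup_pow_closed: "subgroup H G \<Longrightarrow> a \<in> H \<Longrightarrow> a [^] (n::nat) \<in> H"
  by (induction n) (auto simp: subgroup.one_closed subgroup.m_closed)

lemma card_rcosets_mult: "finite (carrier G) \<Longrightarrow> subgroup H G \<Longrightarrow> card (rcosets H) * card H = card (carrier G)"
  using lagrange by (simp add: order_def)

lemma finite_rcosets: "finite (carrier G) \<Longrightarrow> finite (rcosets H)"
  by (simp add: RCOSETS_def)

text \<open>The action of \<open>s\<close> is right multiplication by \<open>inv s\<close>; the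
  inverse turns it into a left action.\<close>

lemma moved_rcosets:
  assumes fin: "finite (carrier G)" and S: "subgroup S G" "card S = p ^ n" and P: "subgroup P G"
    and p: "Factorial_Ring.prime (p::nat)"
  shows "p dvd card {C \<in> rcosets P. \<exists>s \<in> S. C #> inv s \<noteq> C}"
proof -
  interpret S: Group.group "G\<lparr>carrier := S\<rparr>" by (rule subgroup_imp_group[OF S(1)])
  have SG: "\<And>s. s \<in> S \<Longrightarrow> s \<in> carrier G" using subgroup.subset[OF S(1)] by blast
  have CG: "\<And>C. C \<in> rcosets P \<Longrightarrow> C \<subseteq> carrier G" using P subgroup.rcosets_carrier is_group by blast
  have "p dvd card {C \<in> rcosets P. \<exists>s \<in> carrier (G\<lparr>carrier := S\<rparr>). C #> inv s \<noteq> C}"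
  proof (rule card_moved_points[where H = "G\<lparr>carrier := S\<rparr>", OF S.is_group _ p finite_rcosets[OF fin]])
    fix h C assume h: "h \<in> carrier (G\<lparr>carrier := S\<rparr>)" and C: "C \<in> rcosets P"
    then obtain a where "a \<in> carrier G" "C = P #> a" unfolding RCOSETS_def by blast
    then have "C #> inv h = P #> (a \<otimes> inv h)"
      using h SG subgroup.subset[OF P] by (simp add: coset_mult_assoc)
    then show "C #> inv h \<in> rcosets P" using \<open>a \<in> carrier G\<close> h SG P by (simp add: rcosetsI subgroup.subset)
  next
    fix h k C assume hk: "h \<in> carrier (G\<lparr>carrier := S\<rparr>)" "k \<in> carrier (G\<lparr>carrier := S\<rparr>)" "C \<in> rcosets P"
    then show "C #> inv (h \<otimes>\<^bsub>G\<lparr>carrier := S\<rparr>\<^esub> k) = (C #> inv k) #> inv h"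
      using SG CG by (simp add: coset_mult_assoc inv_mult_group)
  qed (use S CG in \<open>simp_all add: order_def coset_mult_one\<close>)
  then show ?thesis by simp
qed

lemma fixed_rcoset:
  assumes S: "S \<subseteq> carrier G" and P: "subgroup P G" and a: "a \<in> carrier G" and f: "\<And>s. s \<in> S \<Longrightarrow> (P #> a) #> inv s = P #> a"
    and s: "s \<in> S"
  shows "a \<otimes> inv s \<otimes> inv a \<in> P"
proof -
  have sG: "s \<in> carrier G" using S s by blast
  have "a \<otimes> inv s \<in> P #> (a \<otimes> inv s)" using rcos_self[of "a \<otimes> inv s" P] a sG P by simp
  also have "\<dots> = P #> a" using f[OF s] coset_mult_assoc[OF subgroup.subset[OF P] a inv_closed[OF sG]] by simp
  finally obtain q where q: "q \<in> P" "a \<otimes> inv s = q \<otimes> a" unfolding r_coset_def by blast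
  then show ?thesis using a subgroup.mem_carrier[OF P q(1)] by (simp add: m_assoc)
qed

text \<open>As the index is prime to \<open>p\<close>, the action of \<open>S\<close> on the cosets
  of \<open>P\<close> has a fixed coset \<open>P a\<close>, and fixing it means that
  \<open>a\<close> conjugates \<open>S\<close> into \<open>P\<close>.\<close>

lemma sylow_conjugate:
  assumes fin: "finite (carrier G)" and p: "Factorial_Ring.prime (p::nat)"
    and P: "subgroup P G" "\<not> p dvd card (rcosets P)" and S: "subgroup S G" "card S = p ^ n"
  obtains a where "a \<in> carrier G" "\<And>s. s \<in> S \<Longrightarrow> a \<otimes> s \<otimes> inv a \<in> P"
proof -
  have "p dvd card {C \<in> rcosets P. \<exists>s \<in> S. C #> inv s \<noteq> C}" by (rule moved_rcosets[OF fin S P(1) p])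
  then have "{C \<in> rcosets P. \<exists>s \<in> S. C #> inv s \<noteq> C} \<noteq> rcosets P" using P(2) by metis
  then obtain C where C: "C \<in> rcosets P" "\<forall>s \<in> S. C #> inv s = C" by blast
  then obtain a where a: "a \<in> carrier G" "C = P #> a" unfolding RCOSETS_def by blast
  have "a \<otimes> s \<otimes> inv a \<in> P" if s: "s \<in> S" for s
    using fixed_rcoset[OF subgroup.subset[OF S(1)] P(1) a(1), of "inv s"] C(2) a(2)
      subgroup.m_inv_closed[OF S(1) s] subgroup.mem_carrier[OF S(1) s] by simp
  then show ?thesis using that a(1) by blast
qed

text \<open>Let \<open>M\<close> act on its own cosets. The number of fixed cosets is divisible by
  \<open>p\<close>, and \<open>M\<close> is one of them, so there is another, whose representative
  normalises \<open>M\<close> without lying in it. Maximality makes the normaliser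
  everything.\<close>

lemma maximal_subgroup_normal:
  assumes fin: "finite (carrier G)" and p: "Factorial_Ring.prime (p::nat)" and o: "order G = p ^ n"
    and M: "subgroup M G" "M \<noteq> carrier G" and max: "\<And>L. subgroup L G \<Longrightarrow> M \<subseteq> L \<Longrightarrow> L = M \<or> L = carrier G"
  shows "M \<lhd> G"
proof -
  have MG: "M \<subseteq> carrier G" by (rule subgroup.subset[OF M(1)])
  have finM: "finite M" using MG fin finite_subset by blast
  have cM: "card (rcosets M) * card M = p ^ n" using card_rcosets_mult[OF fin M(1)] o by (simp add: order_def)
  then obtain j where j: "card M = p ^ j" using p by (metis divides_primepow_nat dvd_triv_right)
  obtain i where i: "card (rcosets M) = p ^ i" using cM p by (metis divides_primepow_nat dvd_triv_left)
  have "i \<noteq> 0"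
  proof
    assume "i = 0"
    then have "card M = card (carrier G)" using cM i o by (simp add: order_def)
    then show False using card_subset_eq[OF fin MG] M(2) by simp
  qed
  then have pr: "p dvd card (rcosets M)" using i by (cases i) auto
  define A where "A = {C \<in> rcosets M. \<exists>s \<in> M. C #> inv s \<noteq> C}"
  have "p dvd card A" unfolding A_def by (rule moved_rcosets[OF fin M(1) j M(1) p])
  moreover have AR: "A \<subseteq> rcosets M" by (auto simp: A_def)
  moreover have "card (rcosets M - A) = card (rcosets M) - card A"
    by (rule card_Diff_subset[OF finite_subset[OF AR finite_rcosets[OF fin]] AR])
  ultimately have pd: "p dvd card (rcosets M - A)" using pr by (simp add: dvd_diff_nat)
  have MR: "M \<in> rcosets M" using M(1) by (metis coset_join2 one_closed rcosetsI MG subgroup.one_closed)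
  have MA: "M \<in> rcosets M - A"
    using MR coset_join2[OF _ M(1)] M(1) subgroup.m_inv_closed[OF M(1)] MG unfolding A_def by auto
  have "rcosets M - A \<noteq> {M}"
  proof
    assume "rcosets M - A = {M}"
    then have "p dvd 1" using pd by simp
    then show False using p by simp
  qed
  then obtain C where C: "C \<in> rcosets M" "C \<notin> A" "C \<noteq> M" using MA by blast
  then obtain a where a: "a \<in> carrier G" "C = M #> a" unfolding RCOSETS_def by blast
  have aM: "a \<notin> M" using C(3) a coset_join2[OF a(1) M(1)] by auto
  have fx: "\<And>s. s \<in> M \<Longrightarrow> (M #> a) #> inv s = M #> a" using C(1,2) a(2) unfolding A_def by blast
  have nrm: "a \<otimes> m \<otimes> inv a \<in> M" if m: "m \<in> M" for m
    using fixed_rcoset[OF MG M(1) a(1) fx, of "inv m"] subgroup.m_inv_closed[OF M(1) m] MG m by auto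
  have conj_eq: "(\<lambda>m. g \<otimes> m \<otimes> inv g) ` M = M" if g: "g \<in> carrier G" "\<And>m. m \<in> M \<Longrightarrow> g \<otimes> m \<otimes> inv g \<in> M" for g
  proof (rule endo_inj_surj[OF finM])
    show "inj_on (\<lambda>m. g \<otimes> m \<otimes> inv g) M"
    proof (rule inj_onI)
      fix m m' assume m: "m \<in> M" "m' \<in> M" "g \<otimes> m \<otimes> inv g = g \<otimes> m' \<otimes> inv g"
      have "m \<in> carrier G" "m' \<in> carrier G" using m MG by auto
      then show "m = m'" using m(3) g(1) r_cancel[of "inv g" "g \<otimes> m" "g \<otimes> m'"] by simp
    qed
  qed (use g in auto)
  define K where "K = {g \<in> carrier G. \<forall>m \<in> M. g \<otimes> m \<otimes> inv g \<in> M}"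
  have KI: "g \<in> K" if "g \<in> carrier G" "\<And>m. m \<in> M \<Longrightarrow> g \<otimes> m \<otimes> inv g \<in> M" for g using that by (simp add: K_def)
  have KG: "g \<in> carrier G" and KM: "\<And>m. m \<in> M \<Longrightarrow> g \<otimes> m \<otimes> inv g \<in> M" if "g \<in> K" for g using that by (auto simp: K_def)
  have sK: "subgroup K G"
  proof (rule subgroupI)
    show "K \<subseteq> carrier G" by (auto simp: K_def)
    show "K \<noteq> {}" using KI[OF one_closed] MG by (auto simp: subset_iff)
    fix g assume g: "g \<in> K"
    note gG = KG[OF g]
    show "inv g \<in> K"
    proof (rule KI)
      fix m assume "m \<in> M"
      then obtain m' where m': "m' \<in> M" "m = g \<otimes> m' \<otimes> inv g" using conj_eq[OF gG KM[OF g]] by blast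
      then have "inv g \<otimes> m \<otimes> inv (inv g) = m'" using gG MG by (auto simp: m_assoc subset_iff)
      then show "inv g \<otimes> m \<otimes> inv (inv g) \<in> M" using m' by simp
    qed (use gG in simp)
    fix h assume h: "h \<in> K"
    note hG = KG[OF h]
    show "g \<otimes> h \<in> K"
    proof (rule KI)
      fix m assume m: "m \<in> M"
      have "(g \<otimes> h) \<otimes> m \<otimes> inv (g \<otimes> h) = g \<otimes> (h \<otimes> m \<otimes> inv h) \<otimes> inv g"
        using gG hG m MG by (auto simp: m_assoc inv_mult_group subset_iff)
      then show "(g \<otimes> h) \<otimes> m \<otimes> inv (g \<otimes> h) \<in> M" using KM[OF g] KM[OF h m] by simp
    qed (use gG hG in simp)
  qed
  have "M \<subseteq> K"
    using M(1) MG by (auto intro!: KI simp: subgroup.m_closed subgroup.m_inv_closed)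
  moreover have "a \<in> K" using KI[OF a(1) nrm] .
  ultimately have "K = carrier G" using max[OF sK] aM by blast
  then show ?thesis using KM M(1) by (auto simp: normal_inv_iff)
qed

end

section \<open>Characters of p-groups\<close>

text \<open>The group \<open>\<rat>/\<int>\<close> contains a copy of \<open>\<int>/p\<close> for every \<open>p\<close>, so that characters of elementary
  abelian sections for a variable prime \<open>p\<close> live in one type.\<close>

quotient_type qz = rat / "\<lambda>x y. x - y \<in> \<int>"
proof (rule equivpI)
  show "reflp (\<lambda>x y::rat. x - y \<in> \<int>)" by (simp add: reflp_def)
  show "symp (\<lambda>x y::rat. x - y \<in> \<int>)" by (auto simp: symp_def intro: Ints_minus dest: Ints_minus)
  show "transp (\<lambda>x y::rat. x - y \<in> \<int>)"
  proof (rule transpI)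
    fix x y z :: rat assume "x - y \<in> \<int>" "y - z \<in> \<int>"
    then have "(x - y) + (y - z) \<in> \<int>" by (rule Ints_add)
    then show "x - z \<in> \<int>" by simp
  qed
qed

instantiation qz :: ab_group_add
begin

lift_definition zero_qz :: qz is 0 .

lift_definition plus_qz :: "qz \<Rightarrow> qz \<Rightarrow> qz" is "(+)"
proof -
  fix a b c d :: rat assume "a - b \<in> \<int>" "c - d \<in> \<int>"
  then have "(a - b) + (c - d) \<in> \<int>" by (rule Ints_add)
  then show "a + c - (b + d) \<in> \<int>" by (simp add: algebra_simps)
qed

lift_definition uminus_qz :: "qz \<Rightarrow> qz" is uminus
proof -
  fix a b :: rat assume "a - b \<in> \<int>"
  then have "- (a - b) \<in> \<int>" by (rule Ints_minus)
  then show "- a - - b \<in> \<int>" by simp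
qed

definition minus_qz :: "qz \<Rightarrow> qz \<Rightarrow> qz" where "minus_qz a b = a + - b"

instance
proof
  fix a b c :: qz
  show "a + b + c = a + (b + c)" by transfer (simp add: add.assoc)
  show "a + b = b + a" by transfer (simp add: add.commute)
  show "0 + a = a" by transfer simp
  show "- a + a = 0" by transfer simp
  show "a - b = a + - b" by (rule minus_qz_def)
qed

end

lift_definition qz :: "rat \<Rightarrow> qz" is "\<lambda>r. r" .

lemma qz_add: "qz (r + s) = qz r + qz s"
  by transfer simp

lemma qz_eq_0_iff: "qz r = 0 \<longleftrightarrow> r \<in> \<int>"
  by transfer simp

lemma qz_eq_iff: "qz r = qz s \<longleftrightarrow> r - s \<in> \<int>"
  by transfer simp

lemma qz_surj: "\<exists>r. z = qz r"
  by transfer (metis Ints_0 diff_self)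

lemma zscale_qz: "zscale k (qz r) = qz (of_int k * r)"
proof -
  have n: "nscale n (qz r) = qz (of_nat n * r)" for n
    by (induction n) (simp_all add: qz_add[symmetric] algebra_simps qz_eq_0_iff eq_commute[of 0])
  have d: "qz a - qz b = qz (a - b)" for a b
    using qz_add[of "a - b" b] by (simp add: algebra_simps)
  show ?thesis
    by (cases "k \<ge> 0") (simp_all add: zscale_def n d algebra_simps)
qed

text \<open>Makes character groups of finite subgroups finite, so that minimal submodules
  exist.\<close>

lemma finite_qz_torsion:
  assumes "p > (0::nat)" shows "finite {z::qz. zscale (int p) z = 0}"
proof (rule finite_subset)
  show "{z. zscale (int p) z = 0} \<subseteq> (\<lambda>k. qz (of_int k / of_nat p)) ` {0..<int p}"
  proof
    fix z :: qz assume "z \<in> {z. zscale (int p) z = 0}"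
    moreover obtain r where r: "z = qz r" using qz_surj by blast
    ultimately have "of_nat p * r \<in> \<int>" by (simp add: zscale_qz qz_eq_0_iff)
    then obtain k where k: "of_nat p * r = of_int k" by (auto elim: Ints_cases)
    have "r = of_int (k mod int p) / of_nat p + of_int (k div int p)"
    proof -
      have "of_int k = (of_nat p * of_int (k div int p) + of_int (k mod int p) :: rat)"
        using mult_div_mod_eq[of "int p" k] by (metis of_int_add of_int_mult of_int_of_nat_eq)
      then show ?thesis using k assms by (simp add: field_simps)
    qed
    then have "z = qz (of_int (k mod int p) / of_nat p)" using r by (simp add: qz_eq_iff)
    then show "z \<in> (\<lambda>k. qz (of_int k / of_nat p)) ` {0..<int p}" using assms by auto
  qed
qed simp

context Group.group
begin

text \<open>A maximal subgroup \<open>M\<close> is normal, and the group is \<open>M\<close> times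
  the powers of some \<open>w\<close> with \<open>w^p\<close> in \<open>M\<close>. The character
  sends \<open>m w^k\<close> to \<open>k/p\<close>.\<close>

lemma p_group_nontrivial_character:
  assumes fin: "finite (carrier G)" and p: "Factorial_Ring.prime (p::nat)" and o: "order G = p ^ n"
    and nontrivial: "carrier G \<noteq> {\<one>}"
  obtains \<chi> :: "'a \<Rightarrow> qz" where "\<And>a b. a \<in> carrier G \<Longrightarrow> b \<in> carrier G \<Longrightarrow> \<chi> (a \<otimes> b) = \<chi> a + \<chi> b"
    "\<And>a. zscale (int p) (\<chi> a) = 0" "\<exists>a \<in> carrier G. \<chi> a \<noteq> 0"
proof -
  define S where "S = {M. subgroup M G \<and> M \<noteq> carrier G}"
  have finS: "finite S" by (rule finite_subset[of _ "Pow (carrier G)"]) (use fin subgroup.subset in \<open>auto simp: S_def\<close>)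
  have "{\<one>} \<in> S" using triv_subgroup nontrivial by (simp add: S_def)
  then obtain M where M: "M \<in> S" and mx: "\<And>L. L \<in> S \<Longrightarrow> M \<subseteq> L \<Longrightarrow> L = M"
    using finite_has_maximal[OF finS] by blast
  have sM: "subgroup M G" "M \<noteq> carrier G" using M by (auto simp: S_def)
  have max: "L = M \<or> L = carrier G" if "subgroup L G" "M \<subseteq> L" for L
    using mx[of L] that by (auto simp: S_def)
  have nM: "M \<lhd> G" by (rule maximal_subgroup_normal[OF fin p o sM max])
  then interpret M: normal M G .
  have MG: "\<And>m. m \<in> M \<Longrightarrow> m \<in> carrier G" using M.subset by blast
  obtain w0 where w0: "w0 \<in> carrier G" "w0 \<notin> M" using sM(2) M.subset by blast
  have "w0 [^] (p ^ n) = \<one>" using pow_order_eq_1[OF w0(1)] o by simp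
  then have ex: "w0 [^] (p ^ n) \<in> M" by simp
  \<comment> \<open>The last iterated \<open>p\<close>-th power of \<open>w0\<close> outside
    \<open>M\<close> provides \<open>w\<close>; its own \<open>p\<close>-th power is in
    \<open>M\<close>.\<close>
  define i where "i = (LEAST i. w0 [^] (p ^ i) \<in> M)"
  have i: "w0 [^] (p ^ i) \<in> M" unfolding i_def by (rule LeastI[of "\<lambda>i. w0 [^] (p ^ i) \<in> M", OF ex])
  have "i \<noteq> 0" using i w0 by (intro notI) simp
  then obtain j where j: "i = Suc j" by (cases i) auto
  define w where "w = w0 [^] (p ^ j)"
  have w: "w \<in> carrier G" using w0 by (simp add: w_def)
  have wM: "w \<notin> M" using not_less_Least[of j "\<lambda>i. w0 [^] (p ^ i) \<in> M"] j unfolding w_def i_def by (metis lessI)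
  have wp: "w [^] p \<in> M" using i w0(1) by (simp add: w_def j nat_pow_pow mult.commute)
  have dv: "int p dvd k" if k: "w [^] (k::int) \<in> M" for k
  proof (rule ccontr)
    assume "\<not> ?thesis"
    then obtain c where c: "int p dvd c * k - 1" using inverse_mod_prime[OF p] by blast
    then obtain d where "c * k - 1 = int p * d" by (auto simp: dvd_def)
    then have "1 = k * c + int p * (- d)" by (simp add: algebra_simps)
    then have "w = w [^] (k * c + int p * (- d))" using w by (metis int_pow_1)
    also have "\<dots> = (w [^] k) [^] c \<otimes> (w [^] int p) [^] (- d)"
      using w by (simp only: int_pow_mult int_pow_pow)
    finally have eq: "w = (w [^] k) [^] c \<otimes> (w [^] int p) [^] (- d)" .
    have ip: "m [^] (l::int) \<in> M" if "m \<in> M" for m l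
      using subgroup_int_pow_closed[OF sM(1) that] .
    have "w [^] int p \<in> M" using wp by (simp add: int_pow_int)
    then have "w \<in> M" using eq ip[OF k] ip M.m_closed by metis
    then show False using wM by simp
  qed
  define L where "L = M <#> generate G {w}"
  have sg: "subgroup (generate G {w}) G" using w by (intro generate_is_subgroup) simp
  interpret MW: second_isomorphism_grp M G "generate G {w}"
    using nM sg by (simp add: second_isomorphism_grp_def second_isomorphism_grp_axioms_def)
  have "subgroup L G" unfolding L_def by (rule MW.normal_set_mult_subgroup)
  moreover have "M \<subseteq> L" unfolding L_def by (rule MW.H_contained_in_set_mult)
  moreover have "w \<in> L" unfolding L_def using MW.S_contained_in_set_mult generate.incl[of w "{w}"] by blast
  ultimately have L: "L = carrier G" using max wM by blast
  then have dec: "\<exists>k::int. \<exists>m \<in> M. g = m \<otimes> w [^] k" if "g \<in> carrier G" for g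
  proof -
    have "g \<in> M <#> generate G {w}" using that L unfolding L_def by simp
    then obtain m v where mv: "m \<in> M" "v \<in> generate G {w}" "g = m \<otimes> v"
      unfolding set_mult_def by auto
    then obtain k :: int where "v = w [^] k" using generate_pow[OF w] by auto
    then show ?thesis using mv by blast
  qed
  have uniq: "int p dvd k - l" if mm: "m \<in> M" "m' \<in> M" "m \<otimes> w [^] k = m' \<otimes> w [^] l" for m m' k l
  proof (rule dv)
    have "w [^] k = inv m \<otimes> m' \<otimes> w [^] l" using mm MG w by (simp add: inv_solve_left m_assoc)
    then have "w [^] k \<otimes> inv (w [^] l) = inv m \<otimes> m'" using mm MG w by (simp add: m_assoc)
    then show "w [^] (k - l) \<in> M" using mm w by (simp add: int_pow_diff)
  qed
  \<comment> \<open>The exponent is determined modulo \<open>p\<close> only, by \<open>uniq\<close>;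
    dividing by \<open>p\<close> and passing to Q/Z removes the choice.\<close>
  define \<chi> where "\<chi> g = qz (of_int (SOME k. \<exists>m \<in> M. g = m \<otimes> w [^] (k::int)) / of_nat p)" for g
  have p0: "p > 0" using p prime_gt_0_nat by blast
  have \<chi>: "\<chi> (m \<otimes> w [^] k) = qz (of_int k / of_nat p)" if m: "m \<in> M" for m k
  proof -
    define l where "l = (SOME l. \<exists>m' \<in> M. m \<otimes> w [^] k = m' \<otimes> w [^] (l::int))"
    have "\<exists>m' \<in> M. m \<otimes> w [^] k = m' \<otimes> w [^] l"
      unfolding l_def by (rule someI[of _ k]) (use m in blast)
    then have "int p dvd l - k" using uniq m by metis
    then obtain d where "l = k + int p * d" by (metis dvdE add_diff_cancel_left' diff_add_cancel add.commute)
    then have "of_int l / of_nat p - of_int k / of_nat p = (of_int d :: rat)" using p0 by (simp add: field_simps)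
    then have "qz (of_int l / of_nat p) = qz (of_int k / of_nat p)" by (simp add: qz_eq_iff)
    then show ?thesis unfolding \<chi>_def l_def .
  qed
  show ?thesis
  proof (rule that)
    fix a b assume "a \<in> carrier G" "b \<in> carrier G"
    then obtain k l :: int and m m' where a: "m \<in> M" "a = m \<otimes> w [^] k" and b: "m' \<in> M" "b = m' \<otimes> w [^] l"
      using dec by metis
    have "a \<otimes> b = (m \<otimes> (w [^] k \<otimes> m' \<otimes> inv (w [^] k))) \<otimes> w [^] (k + l)"
      using a b MG w by (simp add: m_assoc int_pow_mult)
    moreover have "m \<otimes> (w [^] k \<otimes> m' \<otimes> inv (w [^] k)) \<in> M" using a b w M.inv_op_closed2 M.m_closed by simp
    ultimately have "\<chi> (a \<otimes> b) = qz (of_int (k + l) / of_nat p)" using \<chi> by metis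
    then show "\<chi> (a \<otimes> b) = \<chi> a + \<chi> b" using \<chi> a b by (simp add: qz_add add_divide_distrib)
  next
    show "zscale (int p) (\<chi> a) = 0" for a
      using p0 by (simp add: \<chi>_def zscale_qz qz_eq_0_iff)
  next
    have "\<chi> w = qz (of_int 1 / of_nat p)" using \<chi>[of \<one> 1] w by simp
    moreover have "(1 / of_nat p :: rat) \<notin> \<int>"
    proof
      assume "(1 / of_nat p :: rat) \<in> \<int>"
      then obtain z where "(1 / of_nat p :: rat) = of_int z" by (auto elim: Ints_cases)
      then have "(1::rat) = of_int (z * int p)" using p0 by (simp add: field_simps)
      then have "z * int p = 1" by (metis of_int_eq_1_iff)
      then have "int p dvd 1" by (metis dvd_triv_right)
      then show False using p by (simp add: not_prime_1)
    qed
    ultimately have "\<chi> w \<noteq> 0" by (simp add: qz_eq_0_iff)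
    then show "\<exists>a \<in> carrier G. \<chi> a \<noteq> 0" using w by blast
  qed
qed

text \<open>Homomorphisms to the \<open>p\<close>-torsion of Q/Z, extended by zero to form a
  subspace of a function type. They kill commutators and \<open>p\<close>-th powers of
  \<open>B\<close>, so this is the dual of its largest elementary abelian
  \<open>p\<close>-quotient.\<close>

definition chars :: "nat \<Rightarrow> 'a set \<Rightarrow> ('a \<Rightarrow> qz) set" where
  "chars p B = {\<chi>. (\<forall>a. a \<notin> B \<longrightarrow> \<chi> a = 0) \<and> (\<forall>a \<in> B. \<forall>b \<in> B. \<chi> (a \<otimes> b) = \<chi> a + \<chi> b) \<and>
     (\<forall>a. zscale (int p) (\<chi> a) = 0)}"

lemma charsD:
  assumes "\<chi> \<in> chars p B"
  shows "a \<notin> B \<Longrightarrow> \<chi> a = 0" "a \<in> B \<Longrightarrow> b \<in> B \<Longrightarrow> \<chi> (a \<otimes> b) = \<chi> a + \<chi> b" "zscale (int p) (\<chi> a) = 0"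
  using assms by (auto simp: chars_def)

lemma charsI:
  "(\<And>a. a \<notin> B \<Longrightarrow> \<chi> a = 0) \<Longrightarrow> (\<And>a b. a \<in> B \<Longrightarrow> b \<in> B \<Longrightarrow> \<chi> (a \<otimes> b) = \<chi> a + \<chi> b) \<Longrightarrow>
    (\<And>a. zscale (int p) (\<chi> a) = 0) \<Longrightarrow> \<chi> \<in> chars p B"
  by (auto simp: chars_def)

lemma chars_one: "\<chi> \<in> chars p B \<Longrightarrow> \<one> \<in> B \<Longrightarrow> \<chi> \<one> = 0"
  using charsD(2)[of \<chi> p B \<one> \<one>] by simp

lemma chars_inv: "\<chi> \<in> chars p B \<Longrightarrow> subgroup B G \<Longrightarrow> a \<in> B \<Longrightarrow> \<chi> (inv a) = - \<chi> a"
  using charsD(2)[of \<chi> p B "inv a" a] chars_one[of \<chi> p B]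
  by (simp add: subgroup.m_inv_closed subgroup.one_closed subgroup.mem_carrier eq_neg_iff_add_eq_0)

lemma chars_subspace: "zm.subspace (chars p B)"
proof (rule zm.subspaceI)
  show "0 \<in> chars p B" by (simp add: chars_def)
  fix \<chi> \<psi> assume *: "\<chi> \<in> chars p B" "\<psi> \<in> chars p B"
  show "\<chi> + \<psi> \<in> chars p B"
    by (rule charsI) (use charsD[OF *(1)] charsD[OF *(2)] in \<open>simp_all add: zm.scale_right_distrib add_ac\<close>)
next
  fix c \<chi> assume *: "\<chi> \<in> chars p B"
  have "zscale (int p) (zscale c (\<chi> a)) = zscale c (zscale (int p) (\<chi> a))" for a
    by (simp add: mult.commute)
  then show "zscale c \<chi> \<in> chars p B"
    by (intro charsI) (simp_all add: zscale_fun_apply charsD[OF *] zm.scale_right_distrib del: zm.scale_scale)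
qed

lemma finite_chars:
  assumes "finite B" "p > 0" shows "finite (chars p B)"
  by (rule finite_subset[OF _ finite_set_of_finite_funs[OF assms(1) finite_qz_torsion[OF assms(2)], of 0]])
    (auto simp: chars_def)

lemma nontrivial_chars:
  assumes B: "subgroup B G" "finite B" "B \<noteq> {\<one>}" "card B = p ^ n" and p: "Factorial_Ring.prime (p::nat)"
  obtains \<chi> a where "\<chi> \<in> chars p B" "a \<in> B" "\<chi> a \<noteq> 0"
proof -
  interpret B: Group.group "G\<lparr>carrier := B\<rparr>" by (rule subgroup_imp_group[OF B(1)])
  obtain \<chi> :: "'a \<Rightarrow> qz" where \<chi>: "\<And>a b. a \<in> B \<Longrightarrow> b \<in> B \<Longrightarrow> \<chi> (a \<otimes> b) = \<chi> a + \<chi> b"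
    "\<And>a. zscale (int p) (\<chi> a) = 0" "\<exists>a \<in> B. \<chi> a \<noteq> 0"
    by (rule B.p_group_nontrivial_character[OF _ p, of n]) (use B in \<open>auto simp: order_def\<close>)
  define \<psi> where "\<psi> a = (if a \<in> B then \<chi> a else 0)" for a
  have "\<psi> \<in> chars p B"
    by (rule charsI) (use \<chi> B(1) in \<open>auto simp: \<psi>_def subgroup.m_closed\<close>)
  then show ?thesis using that \<chi>(3) by (auto simp: \<psi>_def)
qed

end

section \<open>Commutators acting on characters\<close>

context Group.group
begin

lemma card_subgroup_dvd:
  assumes "finite (carrier G)" "subgroup T G" "subgroup K G" "T \<subseteq> K"
  shows "card T dvd card K"
proof -
  interpret K: Group.group "G\<lparr>carrier := K\<rparr>" by (rule subgroup_imp_group[OF assms(3)])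
  have "subgroup T (G\<lparr>carrier := K\<rparr>)" using subgroup_incl[OF assms(2,3,4)] .
  from K.lagrange[OF this] have "card K = card (rcosets\<^bsub>G\<lparr>carrier := K\<rparr>\<^esub> T) * card T" by (simp add: order_def)
  then show ?thesis by simp
qed

lemma cnj_stable_inv:
  assumes B: "finite B" "B \<subseteq> carrier G" and h: "h \<in> carrier G" "\<And>b. b \<in> B \<Longrightarrow> cnj h b \<in> B" and b: "b \<in> B"
  shows "cnj (inv h) b \<in> B"
proof -
  have "inj_on (cnj h) B"
    by (rule inj_on_inverseI[where g = "cnj (inv h)"]) (use B h in auto)
  then have "cnj h ` B = B" using h(2) by (intro endo_inj_surj[OF B(1)]) auto
  then obtain c where c: "c \<in> B" "b = cnj h c" using b by blast
  have "cnj (inv h) b = c" unfolding c(2) by (rule cnj_cancel(1)[OF h(1)]) (use B c in auto)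
  then show ?thesis using c by simp
qed

text \<open>The passage from groups to modules. For a minimal submodule \<open>U\<close> of the
  characters of \<open>B\<close>, the common kernel \<open>B0\<close> is proper because
  \<open>U\<close> is non-zero. Since \<open>x\<close> acts trivially on \<open>U\<close>, so do its
  conjugates by \<open>R\<close>, and hence all \<open>[x, r]\<close>. The chain \<open>Z\<close>
  records only that commutation with \<open>P\<close> lowers the level by one.\<close>

lemma commutator_acts_trivially_on_section:
  fixes Z :: "nat \<Rightarrow> 'a set"
  assumes fin: "finite (carrier G)" and p: "Factorial_Ring.prime (p::nat)"
    and B: "subgroup B G" "card B = p ^ n" "B \<noteq> {\<one>}"
    and R: "subgroup R G" "\<And>r b. r \<in> R \<Longrightarrow> b \<in> B \<Longrightarrow> cnj r b \<in> B"
    and P: "subgroup P G" "x \<in> P"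
    and x: "\<And>b. b \<in> B \<Longrightarrow> cnj x b \<in> B" "\<And>r. r \<in> R \<Longrightarrow> cnj x r \<in> R"
    and T: "subgroup T G" "T \<subseteq> R" "T \<subseteq> P" "\<And>r t. r \<in> R \<Longrightarrow> t \<in> T \<Longrightarrow> cnj r t \<in> T" "\<And>t. t \<in> T \<Longrightarrow> cnj x t \<in> T"
      "card R = card T * m" "coprime m p"
    and Z: "Z 0 = {\<one>}" "B \<subseteq> Z (p - 2)" "\<And>k b g. b \<in> Z (Suc k) \<Longrightarrow> g \<in> P \<Longrightarrow> cmt g b \<in> Z k"
  obtains B0 where "subgroup B0 G" "B0 \<subset> B" "\<And>r b. r \<in> R \<Longrightarrow> b \<in> B0 \<Longrightarrow> cnj r b \<in> B0"
    "\<And>b. b \<in> B0 \<Longrightarrow> cnj x b \<in> B0" "\<And>r b. r \<in> R \<Longrightarrow> b \<in> B \<Longrightarrow> cmt (cmt x r) b \<in> B0"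
proof -
  have BG: "B \<subseteq> carrier G" and RG: "R \<subseteq> carrier G" and PG: "P \<subseteq> carrier G"
    using subgroup.subset B(1) R(1) P(1) by blast+
  have xG: "x \<in> carrier G" using P PG by blast
  have BGe [simp]: "\<And>b. b \<in> B \<Longrightarrow> b \<in> carrier G" using BG by blast
  have finB: "finite B" and finR: "finite R" using BG RG fin finite_subset by blast+
  have Bc: "\<one> \<in> B" "\<And>a b. a \<in> B \<Longrightarrow> b \<in> B \<Longrightarrow> a \<otimes> b \<in> B" "\<And>a. a \<in> B \<Longrightarrow> inv a \<in> B"
    using B(1) by (auto simp: subgroup.one_closed subgroup.m_closed subgroup.m_inv_closed)
  have Rc: "\<one> \<in> R" "\<And>a b. a \<in> R \<Longrightarrow> b \<in> R \<Longrightarrow> a \<otimes> b \<in> R" "\<And>a. a \<in> R \<Longrightarrow> inv a \<in> R"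
    using R(1) by (auto simp: subgroup.one_closed subgroup.m_closed subgroup.m_inv_closed)
  have xi: "\<And>b. b \<in> B \<Longrightarrow> cnj (inv x) b \<in> B" "\<And>r. r \<in> R \<Longrightarrow> cnj (inv x) r \<in> R"
    using cnj_stable_inv[OF finB BG xG x(1)] cnj_stable_inv[OF finR RG xG x(2)] by auto
  define acts where "acts h \<longleftrightarrow> h \<in> carrier G \<and> (\<forall>b \<in> B. cnj h b \<in> B) \<and> (\<forall>b \<in> B. cnj (inv h) b \<in> B)" for h
  have actsD: "h \<in> carrier G" "\<And>b. b \<in> B \<Longrightarrow> cnj h b \<in> B" "\<And>b. b \<in> B \<Longrightarrow> cnj (inv h) b \<in> B" if "acts h" for h
    using that by (auto simp: acts_def)
  have acts_R: "acts r" if "r \<in> R" for r using that RG R(2) Rc(3) by (auto simp: acts_def)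
  have acts_x: "acts x" using xG x(1) xi(1) by (simp add: acts_def)
  have acts_inv: "acts (inv h)" if "acts h" for h using that by (auto simp: acts_def)
  have acts_mult: "acts (h \<otimes> k)" if "acts h" "acts k" for h k
    using actsD[OF that(1)] actsD[OF that(2)] by (simp add: acts_def cnj_mult inv_mult_group)
  \<comment> \<open>The contragredient action; the inverse makes it a left action.\<close>
  define \<rho> where "\<rho> h \<chi> = (\<lambda>b. if b \<in> B then \<chi> (cnj (inv h) b) else (0::qz))" for h and \<chi> :: "'a \<Rightarrow> qz"
  have \<rho>_add: "\<rho> h (\<chi> + \<psi>) = \<rho> h \<chi> + \<rho> h \<psi>" for h \<chi> \<psi> by (auto simp: \<rho>_def)
  have \<rho>_zero: "\<rho> h 0 = 0" for h by (auto simp: \<rho>_def)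
  have \<rho>_scale: "\<rho> h (zscale k \<chi>) = zscale k (\<rho> h \<chi>)" for h k \<chi> by (auto simp: \<rho>_def zscale_fun_apply)
  have \<rho>_mult: "\<rho> (h \<otimes> k) \<chi> = \<rho> h (\<rho> k \<chi>)" if "acts h" "acts k" for h k \<chi>
    using actsD[OF that(1)] actsD[OF that(2)] by (auto simp: \<rho>_def fun_eq_iff inv_mult_group cnj_mult)
  have \<rho>_chars: "\<rho> h \<chi> \<in> chars p B" if "acts h" "\<chi> \<in> chars p B" for h \<chi>
    by (rule charsI) (use actsD[OF that(1)] charsD[OF that(2)] Bc in \<open>simp_all add: \<rho>_def cnj_hom\<close>)
  have \<rho>_one: "\<rho> \<one> \<chi> = \<chi>" if "\<chi> \<in> chars p B" for \<chi>
    using charsD(1)[OF that] by (auto simp: \<rho>_def fun_eq_iff)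
  define Stb where "Stb W \<longleftrightarrow> zm.subspace W \<and> W \<subseteq> chars p B \<and> (\<forall>r \<in> R. \<forall>\<chi> \<in> W. \<rho> r \<chi> \<in> W) \<and> (\<forall>\<chi> \<in> W. \<rho> x \<chi> \<in> W)" for W
  define \<W> where "\<W> = {W. Stb W \<and> W \<noteq> {0}}"
  have p0: "p > 0" using p prime_gt_0_nat by blast
  have fch: "finite (chars p B)" by (rule finite_chars[OF finB p0])
  have "finite \<W>" by (rule finite_subset[of _ "Pow (chars p B)"]) (use fch in \<open>auto simp: \<W>_def Stb_def\<close>)
  moreover have "chars p B \<in> \<W>"
  proof -
    obtain \<chi> a where "\<chi> \<in> chars p B" "a \<in> B" "\<chi> a \<noteq> 0" by (rule nontrivial_chars[OF B(1) finB B(3,2) p])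
    then have "chars p B \<noteq> {0}" by auto
    then show ?thesis using chars_subspace \<rho>_chars acts_R acts_x by (simp add: \<W>_def Stb_def)
  qed
  ultimately obtain U where UW: "U \<in> \<W>" and min: "\<And>W. W \<in> \<W> \<Longrightarrow> W \<subseteq> U \<Longrightarrow> W = U"
    using finite_has_minimal[of \<W>] by blast
  have U: "zm.subspace U" "U \<subseteq> chars p B" "\<And>r \<chi>. r \<in> R \<Longrightarrow> \<chi> \<in> U \<Longrightarrow> \<rho> r \<chi> \<in> U" "\<And>\<chi>. \<chi> \<in> U \<Longrightarrow> \<rho> x \<chi> \<in> U" "U \<noteq> {0}"
    using UW by (auto simp: \<W>_def Stb_def)
  have finU: "finite U" using fch U(2) finite_subset by blast
  have Uch: "\<chi> \<in> chars p B" if "\<chi> \<in> U" for \<chi> using that U(2) by blast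
  have min': "W = {0} \<or> W = U" if "zm.subspace W" "W \<subseteq> U" "\<And>r \<chi>. r \<in> R \<Longrightarrow> \<chi> \<in> W \<Longrightarrow> \<rho> r \<chi> \<in> W" "\<And>\<chi>. \<chi> \<in> W \<Longrightarrow> \<rho> x \<chi> \<in> W" for W
  proof (cases "W = {0}")
    case False
    have "Stb W" using that U(2) by (auto simp: Stb_def)
    then have "W \<in> \<W>" using False by (simp add: \<W>_def)
    then show ?thesis using min that(2) by blast
  qed simp
  have cancel: "\<rho> (inv h) (\<rho> h \<chi>) = \<chi>" "\<rho> h (\<rho> (inv h) \<chi>) = \<chi>" if "acts h" "\<chi> \<in> chars p B" for h \<chi>
    using \<rho>_mult[OF acts_inv[OF that(1)] that(1), of \<chi>] \<rho>_mult[OF that(1) acts_inv[OF that(1)], of \<chi>]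
      actsD(1)[OF that(1)] \<rho>_one[OF that(2)] by simp_all
  have xiU: "\<rho> (inv x) \<chi> \<in> U" if \<chi>: "\<chi> \<in> U" for \<chi>
  proof -
    have "inj_on (\<rho> x) U" by (rule inj_on_inverseI[where g = "\<rho> (inv x)"]) (use cancel(1)[OF acts_x Uch] in auto)
    then have "\<rho> x ` U = U" using U(4) by (intro endo_inj_surj[OF finU]) auto
    then obtain \<psi> where "\<psi> \<in> U" "\<chi> = \<rho> x \<psi>" using \<chi> by blast
    then show ?thesis using cancel(1)[OF acts_x Uch] by simp
  qed
  \<comment> \<open>The filtration of the characters dual to the chain \<open>Z\<close>. For
    \<open>g\<close> in \<open>P\<close> the operator \<open>\<rho> g - 1\<close> raises the level
    by one, and at level \<open>p - 2\<close> only zero is left; this yields the nilpotency of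
    \<open>x - 1\<close>.\<close>
  define kill where "kill \<chi> k \<longleftrightarrow> (\<forall>b \<in> B. b \<in> Z k \<longrightarrow> \<chi> b = (0::qz))" for \<chi> :: "'a \<Rightarrow> qz" and k
  have kill_top: "\<chi> = 0" if "kill \<chi> (p - 2)" "\<chi> \<in> chars p B" for \<chi>
  proof
    fix a show "\<chi> a = 0 a"
      using that(1) Z(2) charsD(1)[OF that(2), of a] by (cases "a \<in> B") (auto simp: kill_def)
  qed
  have kill_0: "kill \<chi> 0" if "\<chi> \<in> chars p B" for \<chi>
    using Z(1) chars_one[OF that Bc(1)] by (simp add: kill_def)
  have kill_Suc: "kill (\<rho> g \<chi> - \<chi>) (Suc k)" if k: "kill \<chi> k" and \<chi>: "\<chi> \<in> chars p B" and g: "acts g" "g \<in> P" for \<chi> k g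
    unfolding kill_def
  proof (intro ballI impI)
    fix b assume b: "b \<in> B" "b \<in> Z (Suc k)"
    have gi: "inv g \<in> P" using P(1) g(2) by (rule subgroup.m_inv_closed)
    have bG: "b \<in> carrier G" and gG: "g \<in> carrier G" using b BG actsD(1)[OF g(1)] by auto
    have c: "cmt (inv g) b \<in> Z k" using Z(3)[OF b(2) gi] .
    have cB: "cmt (inv g) b \<in> B" using cmt_cnj[of "inv g" b] gG bG actsD(3)[OF g(1) b(1)] Bc b(1) by simp
    have "cmt (inv g) b \<otimes> b = cnj (inv g) b" using gG bG by (simp add: cmt_cnj m_assoc)
    then have "\<chi> (cnj (inv g) b) = \<chi> (cmt (inv g) b) + \<chi> b" using charsD(2)[OF \<chi> cB b(1)] by simp
    moreover have "\<chi> (cmt (inv g) b) = 0" using k c cB by (simp add: kill_def)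
    ultimately show "(\<rho> g \<chi> - \<chi>) b = 0" using b(1) by (simp add: \<rho>_def)
  qed
  \<comment> \<open>The fixed points of \<open>T\<close> in \<open>U\<close> form a stable subspace.
    If it were zero, every non-zero character could be moved by some \<open>\<rho> t - 1\<close> to
    a non-zero one of the next level, contradicting the end of the filtration.\<close>
  have T_trivial: "\<rho> t \<chi> = \<chi>" if t: "t \<in> T" and \<chi>: "\<chi> \<in> U" for t \<chi>
  proof -
    define W where "W = {\<chi> \<in> U. \<forall>t \<in> T. \<rho> t \<chi> = \<chi>}"
    have WI: "\<chi> \<in> W" if "\<chi> \<in> U" "\<And>t. t \<in> T \<Longrightarrow> \<rho> t \<chi> = \<chi>" for \<chi> using that by (simp add: W_def)
    have WD: "\<chi> \<in> U" "\<And>t. t \<in> T \<Longrightarrow> \<rho> t \<chi> = \<chi>" if "\<chi> \<in> W" for \<chi> using that by (auto simp: W_def)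
    have stable: "\<rho> h \<chi> \<in> W" if h: "acts h" "\<And>\<chi>. \<chi> \<in> U \<Longrightarrow> \<rho> h \<chi> \<in> U" "\<And>t. t \<in> T \<Longrightarrow> cnj (inv h) t \<in> T" and \<chi>: "\<chi> \<in> W" for h \<chi>
    proof (rule WI)
      show "\<rho> h \<chi> \<in> U" using h(2) WD(1)[OF \<chi>] .
      fix t assume t: "t \<in> T"
      have tG: "t \<in> carrier G" and hG: "h \<in> carrier G" using t T(2) RG actsD(1)[OF h(1)] by auto
      have at: "acts t" and at': "acts (cnj (inv h) t)" using acts_R T(2) t h(3) by auto
      have "t \<otimes> h = h \<otimes> cnj (inv h) t" using tG hG by (simp add: cnj_def m_assoc)
      then have "\<rho> t (\<rho> h \<chi>) = \<rho> h (\<rho> (cnj (inv h) t) \<chi>)"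
        using \<rho>_mult[OF at h(1), of \<chi>] \<rho>_mult[OF h(1) at', of \<chi>] by simp
      then show "\<rho> t (\<rho> h \<chi>) = \<rho> h \<chi>" using WD(2)[OF \<chi> h(3)[OF t]] by simp
    qed
    have xt: "cnj (inv x) t \<in> T" if "t \<in> T" for t
      using cnj_stable_inv[OF _ _ xG T(5) that] T(2) finR RG finite_subset by blast
    have "zm.subspace W"
      by (rule zm.subspaceI)
        (auto simp: W_def \<rho>_zero \<rho>_add \<rho>_scale zm.subspace_0[OF U(1)] zm.subspace_add[OF U(1)] zm.subspace_scale[OF U(1)])
    moreover have "W \<subseteq> U" by (auto simp: W_def)
    moreover have "\<rho> r \<chi> \<in> W" if "r \<in> R" "\<chi> \<in> W" for r \<chi>
      by (rule stable[OF acts_R[OF that(1)] U(3)[OF that(1)] T(4)[OF Rc(3)[OF that(1)]] that(2)])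
    moreover have "\<rho> x \<chi> \<in> W" if "\<chi> \<in> W" for \<chi>
      by (rule stable[OF acts_x U(4) xt that])
    ultimately have "W = {0} \<or> W = U" by (rule min')
    moreover have "W \<noteq> {0}"
    proof
      assume W0: "W = {0}"
      have "\<exists>\<chi> \<in> U. \<chi> \<noteq> 0 \<and> kill \<chi> k" for k
      proof (induction k)
        case 0
        obtain \<chi> where "\<chi> \<in> U" "\<chi> \<noteq> 0" using U(5) zm.subspace_0[OF U(1)] by blast
        then show ?case using kill_0[OF Uch] by blast
      next
        case (Suc k)
        then obtain \<chi> where \<chi>: "\<chi> \<in> U" "\<chi> \<noteq> 0" "kill \<chi> k" by blast
        then have "\<chi> \<notin> W" using W0 by blast
        then obtain t where t: "t \<in> T" "\<rho> t \<chi> \<noteq> \<chi>" using WI[OF \<chi>(1)] by blast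
        have "\<rho> t \<chi> - \<chi> \<in> U" using U(3)[OF subsetD[OF T(2) t(1)] \<chi>(1)] \<chi>(1) zm.subspace_diff[OF U(1)] by blast
        moreover have "kill (\<rho> t \<chi> - \<chi>) (Suc k)"
          using kill_Suc[OF \<chi>(3) Uch[OF \<chi>(1)] acts_R] t(1) T(2,3) by blast
        moreover have "\<rho> t \<chi> - \<chi> \<noteq> 0" using t(2) by (simp only: right_minus_eq not_False_eq_True)
        ultimately show ?case by blast
      qed
      then show False using kill_top Uch by blast
    qed
    ultimately have "\<chi> \<in> W" using \<chi> by simp
    then show ?thesis using WD(2) t by blast
  qed
  \<comment> \<open>Extended by the identity to a permutation of the whole type, the format required
    of \<open>Q\<close> and \<open>x\<close> in the locale.\<close>
  define rep where "rep h = (\<lambda>\<chi>. if \<chi> \<in> U then \<rho> h \<chi> else \<chi>)" for h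
  define A where "A = {h. acts h \<and> (\<forall>\<chi> \<in> U. \<rho> h \<chi> \<in> U) \<and> (\<forall>\<chi> \<in> U. \<rho> (inv h) \<chi> \<in> U)}"
  have AD: "acts h" "\<And>\<chi>. \<chi> \<in> U \<Longrightarrow> \<rho> h \<chi> \<in> U" "h \<in> carrier G" if "h \<in> A" for h using that actsD(1) by (auto simp: A_def)
  have RA: "r \<in> A" if "r \<in> R" for r using that acts_R U(3) Rc(3) by (auto simp: A_def)
  have xA: "x \<in> A" using acts_x U(4) xiU by (simp add: A_def)
  have Ai: "inv h \<in> A" if "h \<in> A" for h using that acts_inv actsD(1) by (auto simp: A_def)
  have A_mult: "h \<otimes> k \<in> A" if "h \<in> A" "k \<in> A" for h k
    using AD[OF that(1)] AD[OF that(2)] AD[OF Ai[OF that(1)]] AD[OF Ai[OF that(2)]]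
    by (simp add: A_def acts_mult \<rho>_mult inv_mult_group)
  have rep_mult: "rep h \<circ> rep k = rep (h \<otimes> k)" if "h \<in> A" "k \<in> A" for h k
    using AD[OF that(1)] AD[OF that(2)] \<rho>_mult by (auto simp: rep_def fun_eq_iff)
  have rep_one: "rep \<one> = id" using \<rho>_one Uch by (auto simp: rep_def fun_eq_iff)
  have rep_inv: "rep h \<circ> rep (inv h) = id" "rep (inv h) \<circ> rep h = id" if "h \<in> A" for h
    using rep_mult[OF that Ai[OF that]] rep_mult[OF Ai[OF that] that] AD(3)[OF that] rep_one by simp_all
  have rep_bij: "bij (rep h)" if "h \<in> A" for h using o_bij[OF rep_inv(2)[OF that] rep_inv(1)[OF that]] .
  have rep_inv_into: "inv_into UNIV (rep h) = rep (inv h)" if "h \<in> A" for h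
    using inv_unique_comp[OF rep_inv[OF that]] .
  have rep_ahom: "ahom U U (rep h)" if "h \<in> A" for h
    by (rule ahomI) (use AD[OF that] zm.subspace_add[OF U(1)] \<rho>_add in \<open>auto simp: rep_def\<close>)
  define Q where "Q = rep ` R"
  have pgQ: "perm_group Q"
    unfolding perm_group_def
  proof (intro conjI ballI)
    show "finite Q" using finR by (simp add: Q_def)
    show "id \<in> Q" using rep_one Rc(1) unfolding Q_def by (metis imageI)
  next
    fix q q' assume "q \<in> Q" "q' \<in> Q"
    then obtain r s where rs: "r \<in> R" "q = rep r" "s \<in> R" "q' = rep s" unfolding Q_def by blast
    then have "q \<circ> q' = rep (r \<otimes> s)" using rep_mult RA by simp
    then show "q \<circ> q' \<in> Q" using Rc(2)[OF rs(1,3)] unfolding Q_def by (metis imageI)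
  next
    fix q assume "q \<in> Q"
    then obtain r where r: "r \<in> R" "q = rep r" unfolding Q_def by blast
    show "bij q" using rep_bij[OF RA[OF r(1)]] r(2) by simp
    show "inv_into UNIV q \<in> Q" using rep_inv_into[OF RA[OF r(1)]] r Rc(3)[OF r(1)] unfolding Q_def by (metis imageI)
  qed
  \<comment> \<open>All fibres of \<open>rep\<close> on \<open>R\<close> have the size of its kernel
    \<open>K\<close>. As \<open>K\<close> contains \<open>T\<close>, the order of \<open>Q\<close>
    divides the index \<open>m\<close>.\<close>
  have copQ: "coprime (card Q) p"
  proof -
    define K where "K = {r \<in> R. rep r = id}"
    have sK: "subgroup K G"
    proof (rule subgroupI)
      show "K \<subseteq> carrier G" using RG by (auto simp: K_def)
      show "K \<noteq> {}" using Rc(1) rep_one by (auto simp: K_def)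
      show "inv a \<in> K" if "a \<in> K" for a
        using that rep_inv(1)[OF RA, of a] Rc(3) by (simp add: K_def)
      show "a \<otimes> b \<in> K" if "a \<in> K" "b \<in> K" for a b
        using that rep_mult[OF RA RA, of a b] Rc(2) by (simp add: K_def)
    qed
    have "T \<subseteq> K" using T(2) T_trivial by (auto simp: K_def rep_def fun_eq_iff)
    then obtain j where j: "card K = card T * j" using card_subgroup_dvd[OF fin T(1) sK] by (auto simp: dvd_def)
    have fiber: "card {r \<in> R. rep r = q} = card K" if q: "q \<in> Q" for q
    proof -
      obtain s where s: "s \<in> R" "q = rep s" using q unfolding Q_def by blast
      have sG: "s \<in> carrier G" using s(1) RG by blast
      have "{r \<in> R. rep r = q} = (\<lambda>k. s \<otimes> k) ` K"
      proof (intro subset_antisym subsetI)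
        fix r assume "r \<in> {r \<in> R. rep r = q}"
        then have r: "r \<in> R" "rep r = rep s" using s by auto
        have "rep (inv s \<otimes> r) = rep (inv s) \<circ> rep s"
          using rep_mult[OF Ai[OF RA[OF s(1)]] RA[OF r(1)]] r(2) by simp
        then have "inv s \<otimes> r \<in> K" using rep_inv(2)[OF RA[OF s(1)]] Rc(2)[OF Rc(3)[OF s(1)] r(1)] by (simp add: K_def)
        moreover have "r = s \<otimes> (inv s \<otimes> r)" using sG r(1) RG by auto
        ultimately show "r \<in> (\<lambda>k. s \<otimes> k) ` K" by blast
      next
        fix r assume "r \<in> (\<lambda>k. s \<otimes> k) ` K"
        then obtain k where k: "k \<in> R" "rep k = id" "r = s \<otimes> k" by (auto simp: K_def)
        then show "r \<in> {r \<in> R. rep r = q}" using s Rc(2) rep_mult[OF RA[OF s(1)] RA[OF k(1)]] by simp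
      qed
      moreover have "inj_on (\<lambda>k. s \<otimes> k) K"
        by (rule inj_onI) (use sG subsetD[OF RG] in \<open>simp add: K_def\<close>)
      ultimately show ?thesis by (simp add: card_image)
    qed
    have "card R = (\<Sum>q\<in>Q. card {r \<in> R. rep r = q})"
      using sum.group[OF finR, of Q rep "\<lambda>_. 1::nat"] finR by (simp add: Q_def)
    then have "card T * m = card Q * card K" using fiber T(6) by simp
    moreover have "card T \<noteq> 0" using T(1,2) finR finite_subset[OF T(2)] subgroup.one_closed[OF T(1)] by auto
    ultimately have "m = card Q * j" using j by (simp add: mult.left_commute)
    then show ?thesis using T(7) by simp
  qed
  define D where "D = (\<lambda>v. rep x v - v)"
  have D: "D v = \<rho> x v - v" if "v \<in> U" for v using that by (simp only: D_def rep_def if_True)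
  have nil: "(D ^^ k) \<chi> \<in> U \<and> kill ((D ^^ k) \<chi>) k" if "\<chi> \<in> U" for \<chi> k
  proof (induction k)
    case 0 then show ?case using that kill_0[OF Uch[OF that]] by simp
  next
    case (Suc k)
    let ?c = "(D ^^ k) \<chi>"
    have "(D ^^ Suc k) \<chi> = \<rho> x ?c - ?c" using D Suc by simp
    moreover have "\<rho> x ?c - ?c \<in> U" using Suc U(4) zm.subspace_diff[OF U(1)] by blast
    moreover have "kill (\<rho> x ?c - ?c) (Suc k)" using kill_Suc[OF _ Uch acts_x P(2)] Suc by blast
    ultimately show ?case by (simp only: simp_thms)
  qed
  interpret M: normalised_module p U Q "rep x"
  proof
    show "Factorial_Ring.prime p" by (rule p)
    show "zm.subspace U" "finite U" by (rule U(1), rule finU)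
    show "zscale (int p) u = 0" if "u \<in> U" for u
      using charsD(3)[OF Uch[OF that]] by (simp add: fun_eq_iff zscale_fun_apply)
    show "perm_group Q" "coprime (card Q) p" by (rule pgQ, rule copQ)
    show "ahom U U q" if "q \<in> Q" for q using that rep_ahom[OF RA] unfolding Q_def by blast
    show "bij (rep x)" "ahom U U (rep x)" by (rule rep_bij[OF xA], rule rep_ahom[OF xA])
    show "rep x u = u" if "u \<notin> U" for u using that by (simp add: rep_def)
    show "rep x \<circ> q \<circ> inv_into UNIV (rep x) \<in> Q" if q: "q \<in> Q" for q
    proof -
      obtain r where r: "r \<in> R" "q = rep r" using q unfolding Q_def by blast
      have xr: "x \<otimes> r \<in> A" by (rule A_mult[OF xA RA[OF r(1)]])
      have "rep x \<circ> q \<circ> inv_into UNIV (rep x) = rep (cnj x r)"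
        unfolding rep_inv_into[OF xA] r(2) rep_mult[OF xA RA[OF r(1)]] rep_mult[OF xr Ai[OF xA]] cnj_def ..
      then show ?thesis using x(2)[OF r(1)] unfolding Q_def by (metis imageI)
    qed
    show "((\<lambda>v. rep x v - v) ^^ (p - 2)) u = 0" if "u \<in> U" for u
      using nil[OF that, of "p - 2"] kill_top Uch unfolding D_def by blast
    show "W = {0} \<or> W = U" if W: "zm.subspace W" "W \<subseteq> U" "\<And>q w. q \<in> Q \<Longrightarrow> w \<in> W \<Longrightarrow> q w \<in> W" "\<And>w. w \<in> W \<Longrightarrow> rep x w \<in> W" for W
    proof (rule min'[OF W(1,2)])
      show "\<rho> r \<chi> \<in> W" if "r \<in> R" "\<chi> \<in> W" for r \<chi>
        using W(3)[of "rep r" \<chi>] that W(2) unfolding Q_def rep_def by auto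
      show "\<rho> x \<chi> \<in> W" if "\<chi> \<in> W" for \<chi>
        using W(4)[OF that] subsetD[OF W(2) that] by (simp add: rep_def)
    qed
  qed
  have x_triv: "\<rho> x \<chi> = \<chi>" if "\<chi> \<in> U" for \<chi> using M.x_trivial[OF that] that by (simp add: rep_def)
  \<comment> \<open>The annihilator of \<open>U\<close> in \<open>B\<close>; stability of
    \<open>U\<close> under the action passes to it.\<close>
  define B0 where "B0 = {b \<in> B. \<forall>\<chi> \<in> U. \<chi> b = 0}"
  have B0I: "b \<in> B0" if "b \<in> B" "\<And>\<chi>. \<chi> \<in> U \<Longrightarrow> \<chi> b = 0" for b using that by (simp add: B0_def)
  have B0D: "b \<in> B" "\<And>\<chi>. \<chi> \<in> U \<Longrightarrow> \<chi> b = 0" if "b \<in> B0" for b using that by (auto simp: B0_def)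
  have stable: "cnj h b \<in> B0" if h: "h \<in> A" and b: "b \<in> B0" for h b
  proof (rule B0I)
    show hb: "cnj h b \<in> B" using actsD(2)[OF AD(1)[OF h] B0D(1)[OF b]] .
    fix \<chi> assume \<chi>: "\<chi> \<in> U"
    have "\<rho> (inv h) \<chi> b = \<chi> (cnj h b)" using B0D(1)[OF b] AD(3)[OF h] by (simp add: \<rho>_def)
    then show "\<chi> (cnj h b) = 0" using B0D(2)[OF b AD(2)[OF Ai[OF h] \<chi>]] by simp
  qed
  show ?thesis
  proof (rule that)
    show "subgroup B0 G"
    proof (rule subgroupI)
      show "B0 \<subseteq> carrier G" using BG by (auto simp: B0_def)
      show "B0 \<noteq> {}" using Bc(1) chars_one[OF Uch Bc(1)] by (auto simp: B0_def)
      show "inv a \<in> B0" if "a \<in> B0" for a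
      proof (rule B0I[OF Bc(3)[OF B0D(1)[OF that]]])
        show "\<chi> (inv a) = 0" if \<chi>: "\<chi> \<in> U" for \<chi>
          using chars_inv[OF Uch[OF \<chi>] B(1) B0D(1)[OF \<open>a \<in> B0\<close>]] B0D(2)[OF \<open>a \<in> B0\<close> \<chi>] by simp
      qed
      show "a \<otimes> b \<in> B0" if "a \<in> B0" "b \<in> B0" for a b
      proof (rule B0I[OF Bc(2)[OF B0D(1)[OF that(1)] B0D(1)[OF that(2)]]])
        show "\<chi> (a \<otimes> b) = 0" if \<chi>: "\<chi> \<in> U" for \<chi>
          using charsD(2)[OF Uch[OF \<chi>] B0D(1)[OF \<open>a \<in> B0\<close>] B0D(1)[OF \<open>b \<in> B0\<close>]]
            B0D(2)[OF \<open>a \<in> B0\<close> \<chi>] B0D(2)[OF \<open>b \<in> B0\<close> \<chi>] by simp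
      qed
    qed
    have "B0 \<noteq> B"
    proof
      assume eq: "B0 = B"
      have "\<chi> = 0" if "\<chi> \<in> U" for \<chi>
      proof
        fix a show "\<chi> a = 0 a"
          using B0D(2)[of a, OF _ that] charsD(1)[OF Uch[OF that], of a] eq by (cases "a \<in> B") auto
      qed
      then have "U \<subseteq> {0}" by blast
      then show False using U(5) zm.subspace_0[OF U(1)] by blast
    qed
    then show "B0 \<subset> B" by (auto simp: B0_def)
    show "cnj r b \<in> B0" if "r \<in> R" "b \<in> B0" for r b by (rule stable[OF RA[OF that(1)] that(2)])
    show "cnj x b \<in> B0" if "b \<in> B0" for b by (rule stable[OF xA that])
    fix r b assume r: "r \<in> R" and b: "b \<in> B"
    have rG: "r \<in> carrier G" and bG: "b \<in> carrier G" using r RG b BG by auto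
    let ?c = "cmt x r"
    have cR: "?c \<in> R" using cmt_cnj[OF xG rG] x(2)[OF r] Rc(2,3) r by simp
    have bc: "cnj ?c b \<in> B" using R(2)[OF cR b] .
    show "cmt ?c b \<in> B0"
    proof (rule B0I)
      have cG: "?c \<in> carrier G" using xG rG by simp
      show "cmt ?c b \<in> B" using cmt_cnj[OF cG bG] bc Bc b by simp
      fix \<chi> assume \<chi>: "\<chi> \<in> U"
      \<comment> \<open>With \<open>c = [x, r]\<close>, both \<open>x\<close> and
        \<open>r x r^-1 = c^-1 x\<close> act trivially on \<open>U\<close>, hence so does
        \<open>c\<close>.\<close>
      have e: "inv ?c \<otimes> x = r \<otimes> (x \<otimes> inv r)" using xG rG by (simp add: cmt_def inv_mult_group m_assoc)
      have ar: "acts r" and ari: "acts (inv r)" and ac: "acts (inv ?c)" using acts_R r Rc(3) cR by auto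
      have axr: "\<rho> (x \<otimes> inv r) \<chi> = \<rho> (inv r) \<chi>"
        using \<rho>_mult[OF acts_x ari] x_triv[OF U(3)[OF Rc(3)[OF r] \<chi>]] by simp
      have "\<rho> (r \<otimes> (x \<otimes> inv r)) \<chi> = \<rho> r (\<rho> (inv r) \<chi>)" using \<rho>_mult[OF ar acts_mult[OF acts_x ari]] axr by simp
      then have "\<rho> (inv ?c \<otimes> x) \<chi> = \<chi>" unfolding e using cancel(2)[OF ar Uch[OF \<chi>]] by simp
      then have "\<rho> (inv ?c) \<chi> = \<chi>" using \<rho>_mult[OF ac acts_x, of \<chi>] x_triv[OF \<chi>] by simp
      then have "\<rho> (inv ?c) \<chi> b = \<chi> b" by simp
      then have "\<chi> (cnj ?c b) = \<chi> b" using b cG by (simp add: \<rho>_def)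
      then show "\<chi> (cmt ?c b) = 0"
        unfolding cmt_cnj[OF cG bG] using charsD(2)[OF Uch[OF \<chi>] bc Bc(3)[OF b]] chars_inv[OF Uch[OF \<chi>] B(1) b] by simp
    qed
  qed
qed

end

section \<open>Coprime action\<close>

context Group.group
begin

lemma coprime_pow_eq_one:
  assumes "c \<in> carrier G" "c [^] (n::nat) = \<one>" "c [^] (m::nat) = \<one>" "coprime n m"
  shows "c = \<one>"
proof -
  have "ord c dvd n" "ord c dvd m" using assms by (simp_all add: pow_eq_id[symmetric])
  then have "ord c dvd 1" using assms(4) coprime_common_divisor by blast
  then have "c [^] (1::nat) = \<one>" using assms(1) pow_eq_id by blast
  then show ?thesis using assms(1) by simp
qed

lemma pow_card_subgroup:
  assumes "finite (carrier G)" "subgroup S G" "c \<in> S" shows "c [^] card S = \<one>"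
proof -
  interpret S: Group.group "G\<lparr>carrier := S\<rparr>" by (rule subgroup_imp_group[OF assms(2)])
  have "c [^]\<^bsub>G\<lparr>carrier := S\<rparr>\<^esub> order (G\<lparr>carrier := S\<rparr>) = \<one>"
    using S.pow_order_eq_1[of c] assms(3) by simp
  then show ?thesis by (simp add: order_def nat_pow_consistent[symmetric])
qed

lemma pow_index_in_normal:
  assumes fin: "finite (carrier G)" and N: "N \<lhd> G" and g: "g \<in> carrier G"
  shows "g [^] card (rcosets N) \<in> N"
proof -
  interpret N: normal N G by fact
  interpret Q: Group.group "G Mod N" by (rule N.factorgroup_is_group)
  have "(N #> g) [^]\<^bsub>G Mod N\<^esub> order (G Mod N) = \<one>\<^bsub>G Mod N\<^esub>"
    using g by (intro Q.pow_order_eq_1) (simp add: FactGroup_def rcosetsI N.subset)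
  moreover have "order (G Mod N) = card (rcosets N)" "\<one>\<^bsub>G Mod N\<^esub> = N"
    by (simp_all add: order_def FactGroup_def)
  ultimately have "N #> (g [^] card (rcosets N)) = N" by (simp only: N.FactGroup_pow[OF g])
  then show ?thesis using coset_join1[OF _ _ N.subgroup_axioms] g by simp
qed

lemma pow_index_in_subgroup:
  assumes fin: "finite (carrier G)" and R: "subgroup R G" and T: "subgroup T G" "T \<subseteq> R" "\<And>r t. r \<in> R \<Longrightarrow> t \<in> T \<Longrightarrow> cnj r t \<in> T"
    and m: "card R = card T * m" and r: "r \<in> R"
  shows "r [^] m \<in> T"
proof -
  have finR: "finite R" using fin subgroup.subset[OF R] finite_subset by blast
  interpret R: Group.group "G\<lparr>carrier := R\<rparr>" by (rule subgroup_imp_group[OF R])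
  have sT: "subgroup T (G\<lparr>carrier := R\<rparr>)" by (rule subgroup_incl[OF T(1) R T(2)])
  have nT: "T \<lhd> G\<lparr>carrier := R\<rparr>"
    unfolding R.normal_inv_iff using sT T(3) m_inv_consistent[OF R] by (simp add: cnj_def)
  have "card (rcosets\<^bsub>G\<lparr>carrier := R\<rparr>\<^esub> T) * card T = card R"
    using R.lagrange[OF sT] by (simp add: order_def)
  moreover have "card T \<noteq> 0" using finR finite_subset[OF T(2)] subgroup.one_closed[OF T(1)] by auto
  ultimately have "card (rcosets\<^bsub>G\<lparr>carrier := R\<rparr>\<^esub> T) = m" using m by (simp add: mult.commute)
  then show ?thesis using R.pow_index_in_normal[OF _ nT, of r] finR r by (simp add: nat_pow_consistent[symmetric])
qed

lemma cauchy:
  assumes fin: "finite (carrier G)" and p: "Factorial_Ring.prime (p::nat)" and K: "subgroup K G" "p dvd card K"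
  obtains h where "h \<in> K" "h \<noteq> \<one>" "h [^] p = \<one>"
proof -
  have finK: "finite K" using fin subgroup.subset[OF K(1)] finite_subset by blast
  obtain m where "card K = p ^ 1 * m" using K(2) by auto
  then have "\<exists>H. subgroup H (G\<lparr>carrier := K\<rparr>) \<and> card H = p ^ 1"
    using finK by (intro sylow_thm[OF p subgroup_imp_group[OF K(1)], of 1 m]) (simp_all add: order_def)
  then obtain H where H: "subgroup H (G\<lparr>carrier := K\<rparr>)" "card H = p" by auto
  have HK: "H \<subseteq> K" using subgroup.subset[OF H(1)] by simp
  have sH: "subgroup H G" by (rule incl_subgroup[OF K(1) H(1)])
  have "H \<noteq> {\<one>}" using H(2) p by (auto simp: not_prime_1)
  then obtain h where "h \<in> H" "h \<noteq> \<one>" using subgroup.one_closed[OF sH] by blast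
  then show ?thesis using that[of h] pow_card_subgroup[OF fin sH, of h] H(2) HK by auto
qed

lemma coprime_card_subgroup:
  assumes fin: "finite (carrier G)" and p: "Factorial_Ring.prime (p::nat)" and K: "subgroup K G"
    and n: "\<And>g. g \<in> K \<Longrightarrow> g [^] (n::nat) = \<one>" "coprime n p"
  shows "coprime (card K) p"
proof (rule ccontr)
  assume "\<not> ?thesis"
  then have "p dvd card K" using p by (metis coprime_commute prime_imp_coprime)
  then obtain h where h: "h \<in> K" "h \<noteq> \<one>" "h [^] p = \<one>" by (rule cauchy[OF fin p K])
  then show False using coprime_pow_eq_one[of h n p] n subgroup.mem_carrier[OF K] by blast
qed

text \<open>Since \<open>g\<close> fixes \<open>c = cmt g b\<close>, conjugating \<open>b\<close> by
  \<open>g^i\<close> gives \<open>c^i b\<close>. At \<open>i = n\<close> this yields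
  \<open>c^n = 1\<close>, and \<open>c^m = 1\<close> with \<open>m\<close> prime to \<open>n\<close>
  forces \<open>c = 1\<close>.\<close>

lemma coprime_action_trivial:
  assumes g: "g \<in> carrier G" "g [^] (n::nat) = \<one>" and b: "b \<in> carrier G" and c: "cnj g (cmt g b) = cmt g b"
    "cmt g b [^] (m::nat) = \<one>" and cop: "coprime n m"
  shows "cnj g b = b"
proof -
  let ?c = "cmt g b"
  have cG: "?c \<in> carrier G" using g b by simp
  have step: "cnj g b = ?c \<otimes> b" using g b by (simp add: cmt_cnj m_assoc)
  have "cnj (g [^] i) b = ?c [^] i \<otimes> b" for i :: nat
  proof (induction i)
    case (Suc i)
    have "cnj (g [^] Suc i) b = cnj g (cnj (g [^] i) b)"
      using nat_pow_Suc2[OF g(1)] cnj_mult[OF g(1) _ b] g(1) by simp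
    also have "\<dots> = cnj g ?c [^] i \<otimes> cnj g b" unfolding Suc using g b cG by (simp add: cnj_hom cnj_pow)
    also have "\<dots> = ?c [^] Suc i \<otimes> b" unfolding c(1) step using cG b by (simp add: m_assoc)
    finally show ?case .
  qed (use b in simp)
  from this[of n] have "b = ?c [^] n \<otimes> b" using g(2) b by simp
  then have "?c [^] n = \<one>" using b cG r_cancel_one'[of b "?c [^] n"] by simp
  then have "?c = \<one>" using coprime_pow_eq_one[OF cG _ c(2) cop] by simp
  then show ?thesis using step b by simp
qed

text \<open>Collection: each \<open>a\<close> moved to the left past a preceding \<open>b\<close>
  costs one factor \<open>z\<close>, and \<open>n choose 2\<close> such exchanges occur.\<close>

lemma class_two_pow:
  assumes a: "a \<in> carrier G" and b: "b \<in> carrier G" and z: "z \<in> carrier G" and ba: "b \<otimes> a = a \<otimes> b \<otimes> z"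
    and za: "z \<otimes> a = a \<otimes> z" and zb: "z \<otimes> b = b \<otimes> z"
  shows "b [^] (n::nat) \<otimes> a = a \<otimes> b [^] n \<otimes> z [^] n" "(a \<otimes> b) [^] (n::nat) = a [^] n \<otimes> b [^] n \<otimes> z [^] (n choose 2)"
proof -
  have zp: "z [^] k \<otimes> a = a \<otimes> z [^] k" "z [^] k \<otimes> b = b \<otimes> z [^] k" for k :: nat
    using group_commutes_pow[OF za z a] group_commutes_pow[OF zb z b] by simp_all
  show 1: "b [^] n \<otimes> a = a \<otimes> b [^] n \<otimes> z [^] n" for n :: nat
  proof (induction n)
    case (Suc n)
    have "b [^] Suc n \<otimes> a = b [^] n \<otimes> (a \<otimes> b \<otimes> z)" using a b z ba by (simp add: m_assoc)
    also have "\<dots> = (b [^] n \<otimes> a) \<otimes> (b \<otimes> z)" using a b z by (simp add: m_assoc)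
    also have "\<dots> = a \<otimes> b [^] n \<otimes> (z [^] n \<otimes> b) \<otimes> z" unfolding Suc using a b z by (simp add: m_assoc)
    also have "\<dots> = a \<otimes> b [^] Suc n \<otimes> z [^] Suc n" unfolding zp using a b z by (simp add: m_assoc)
    finally show ?case .
  qed (use a in simp)
  show "(a \<otimes> b) [^] n = a [^] n \<otimes> b [^] n \<otimes> z [^] (n choose 2)"
  proof (induction n)
    case (Suc n)
    let ?k = "n choose 2"
    have "(a \<otimes> b) [^] Suc n = a [^] n \<otimes> b [^] n \<otimes> (z [^] ?k \<otimes> a) \<otimes> b" using Suc a b z by (simp add: m_assoc)
    also have "\<dots> = a [^] n \<otimes> (b [^] n \<otimes> a) \<otimes> (z [^] ?k \<otimes> b)" unfolding zp(1) using a b z by (simp add: m_assoc)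
    also have "\<dots> = a [^] n \<otimes> a \<otimes> b [^] n \<otimes> (z [^] n \<otimes> (b \<otimes> z [^] ?k))" unfolding 1 zp(2) using a b z by (simp add: m_assoc)
    also have "\<dots> = a [^] n \<otimes> a \<otimes> b [^] n \<otimes> (z [^] n \<otimes> b) \<otimes> z [^] ?k" using a b z by (simp add: m_assoc)
    also have "\<dots> = a [^] Suc n \<otimes> b [^] Suc n \<otimes> z [^] (n + ?k)" unfolding zp(2) using a b z by (simp add: m_assoc nat_pow_mult[symmetric])
    also have "n + ?k = Suc n choose 2" by (simp add: numeral_2_eq_2)
    finally show ?case .
  qed (use a in \<open>simp add: binomial_eq_0\<close>)
qed

text \<open>In a minimal counterexample every proper \<open>g\<close>-invariant normal subgroup is central, so \<open>S\<close> has
  class at most two and \<open>p\<close>-th powers multiply; then each \<open>[g, s]\<close> has order \<open>p\<close> and is fixed by \<open>g\<close>.\<close>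

lemma coprime_action_trivial_if_trivial_on_order_p:
  assumes fin: "finite (carrier G)" and p: "Factorial_Ring.prime (p::nat)" "odd p"
    and g: "g \<in> carrier G" "g [^] (m::nat) = \<one>" "coprime m p"
  shows "subgroup S G \<Longrightarrow> card S = p ^ n \<Longrightarrow> (\<And>s. s \<in> S \<Longrightarrow> cnj g s \<in> S) \<Longrightarrow>
    (\<And>s. s \<in> S \<Longrightarrow> s [^] p = \<one> \<Longrightarrow> cnj g s = s) \<Longrightarrow> s \<in> S \<Longrightarrow> cnj g s = s"
proof (induction "card S" arbitrary: S n s rule: less_induct)
  case less
  note S = less.prems(1)
  have SG: "S \<subseteq> carrier G" by (rule subgroup.subset[OF S])
  have SGe [simp]: "\<And>s. s \<in> S \<Longrightarrow> s \<in> carrier G" using SG by blast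
  have Sc: "\<one> \<in> S" "\<And>a b. a \<in> S \<Longrightarrow> b \<in> S \<Longrightarrow> a \<otimes> b \<in> S" "\<And>a. a \<in> S \<Longrightarrow> inv a \<in> S"
    using S by (auto simp: subgroup.one_closed subgroup.m_closed subgroup.m_inv_closed)
  have finS: "finite S" using fin SG finite_subset by blast
  have fix_sub: "cnj g s = s" if L: "subgroup L G" "L \<subset> S" "\<And>s. s \<in> L \<Longrightarrow> cnj g s \<in> L" "s \<in> L" for L s
  proof -
    have "card L dvd p ^ n" using card_subgroup_dvd[OF fin L(1) S] L(2) less.prems(2) by auto
    then obtain k where k: "card L = p ^ k" using p(1) by (auto simp: divides_primepow_nat)
    show ?thesis
      by (rule less.hyps[OF psubset_card_mono[OF finS L(2)] L(1) k L(3) _ L(4)]) (use L(2) less.prems(4) in auto)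
  qed
  show ?case
  proof (cases "S = {\<one>}")
    case True then show ?thesis using less.prems(5) g by simp
  next
    case False
    \<comment> \<open>The Frattini subgroup of \<open>S\<close>, obtained as the common kernel of
      characters: a proper, normal, \<open>g\<close>-invariant subgroup which contains all
      commutators and \<open>p\<close>-th powers.\<close>
    define M where "M = {s \<in> S. \<forall>\<chi> \<in> chars p S. \<chi> s = 0}"
    have MI: "s \<in> M" if "s \<in> S" "\<And>\<chi>. \<chi> \<in> chars p S \<Longrightarrow> \<chi> s = 0" for s using that by (simp add: M_def)
    have MS: "s \<in> S" and M0: "\<And>\<chi>. \<chi> \<in> chars p S \<Longrightarrow> \<chi> s = 0" if "s \<in> M" for s using that by (auto simp: M_def)
    have cm: "\<chi> (a \<otimes> b) = \<chi> a + \<chi> b" if "\<chi> \<in> chars p S" "a \<in> S" "b \<in> S" for \<chi> a b using charsD(2)[OF that] .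
    have ci: "\<chi> (inv a) = - \<chi> a" if "\<chi> \<in> chars p S" "a \<in> S" for \<chi> a using chars_inv[OF that(1) S that(2)] .
    have sM: "subgroup M G"
    proof (rule subgroupI)
      show "M \<subseteq> carrier G" using MS by auto
      show "M \<noteq> {}" using Sc(1) chars_one[OF _ Sc(1)] by (auto simp: M_def)
      show "inv a \<in> M" if a: "a \<in> M" for a
        by (rule MI[OF Sc(3)[OF MS[OF a]]]) (simp only: ci[OF _ MS[OF a]] M0[OF a] minus_zero)
      show "a \<otimes> b \<in> M" if a: "a \<in> M" and b: "b \<in> M" for a b
        by (rule MI[OF Sc(2)[OF MS[OF a] MS[OF b]]]) (simp only: cm[OF _ MS[OF a] MS[OF b]] M0[OF a] M0[OF b] add_0_left)
    qed
    obtain \<chi> a where "\<chi> \<in> chars p S" "a \<in> S" "\<chi> a \<noteq> 0" by (rule nontrivial_chars[OF S finS False less.prems(2) p(1)])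
    then have "M \<noteq> S" using M0 by blast
    then have MpS: "M \<subset> S" using MS by blast
    have gM: "cnj g s \<in> M" if s: "s \<in> M" for s
    proof (rule MI[OF less.prems(3)[OF MS[OF s]]])
      fix \<chi> assume \<chi>: "\<chi> \<in> chars p S"
      define \<psi> where "\<psi> a = (if a \<in> S then \<chi> (cnj g a) else 0)" for a
      have "\<psi> \<in> chars p S"
      proof (rule charsI)
        show "\<psi> (a \<otimes> b) = \<psi> a + \<psi> b" if "a \<in> S" "b \<in> S" for a b
          using that Sc(2) cm[OF \<chi> less.prems(3)[OF that(1)] less.prems(3)[OF that(2)]] g(1) by (simp add: \<psi>_def cnj_hom)
        show "zscale (int p) (\<psi> a) = 0" for a using charsD(3)[OF \<chi>] by (simp add: \<psi>_def)
      qed (simp add: \<psi>_def)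
      from M0[OF s this] show "\<chi> (cnj g s) = 0" using MS[OF s] by (simp add: \<psi>_def)
    qed
    have nM: "cnj t s \<in> M" if t: "t \<in> S" and s: "s \<in> M" for t s
    proof (rule MI)
      show "cnj t s \<in> S" using t MS[OF s] Sc by (simp add: cnj_def)
      fix \<chi> assume \<chi>: "\<chi> \<in> chars p S"
      show "\<chi> (cnj t s) = 0"
        unfolding cnj_def cm[OF \<chi> Sc(2)[OF t MS[OF s]] Sc(3)[OF t]] cm[OF \<chi> t MS[OF s]] ci[OF \<chi> t] M0[OF s \<chi>] by simp
    qed
    have fixM: "cnj g s = s" if "s \<in> M" for s by (rule fix_sub[OF sM MpS gM that])
    have powM: "s [^] p \<in> M" if s: "s \<in> S" for s
    proof (rule MI[OF subgroup_pow_closed[OF S s]])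
      fix \<chi> assume \<chi>: "\<chi> \<in> chars p S"
      have "\<chi> (s [^] k) = nscale k (\<chi> s)" for k :: nat
      proof (induction k)
        case 0 show ?case using chars_one[OF \<chi> Sc(1)] by simp
      next
        case (Suc k)
        show ?case using cm[OF \<chi> subgroup_pow_closed[OF S s] s, of k] Suc by (simp add: add.commute)
      qed
      then have "\<chi> (s [^] p) = zscale (int p) (\<chi> s)" by (simp add: zscale_def)
      then show "\<chi> (s [^] p) = 0" using charsD(3)[OF \<chi>] by simp
    qed
    have cgS: "cmt g t \<in> S" if "t \<in> S" for t using that less.prems(3) Sc g(1) by (simp add: cmt_cnj)
    \<comment> \<open>This is \<open>[g, S]\<close>. If it is proper, induction lets
      \<open>g\<close> fix each \<open>cmt g t\<close>, and coprimality finishes; otherwise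
      \<open>S\<close> is generated by these commutators.\<close>
    define W where "W = generate G (cmt g ` S)"
    have genS: "cmt g ` S \<subseteq> S" using cgS by blast
    have sW: "subgroup W G" unfolding W_def using genS SG by (intro generate_is_subgroup) blast
    have WS: "W \<subseteq> S" unfolding W_def by (rule generate_subgroup_incl[OF genS S])
    have gen: "cmt g t \<in> W" if "t \<in> S" for t unfolding W_def using that by (intro generate.incl) simp
    have in_W_induct: "W \<subseteq> L" if "subgroup L G" "\<And>t. t \<in> S \<Longrightarrow> cmt g t \<in> L" for L
      unfolding W_def using that by (intro generate_subgroup_incl) auto
    have "cnj g t = t" if t: "t \<in> S" for t
    proof (cases "W = S")
      case W: False
      have gW: "cnj g w \<in> W" if "w \<in> W" for w
      proof -
        have "W \<subseteq> {w \<in> carrier G. cnj g w \<in> W}"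
        proof (rule in_W_induct)
          show "subgroup {w \<in> carrier G. cnj g w \<in> W} G"
            by (rule subgroupI)
              (use g(1) sW in \<open>auto simp: cnj_hom cnj_inv subgroup.m_closed subgroup.m_inv_closed subgroup.one_closed intro!: exI[of _ \<one>]\<close>)
          show "cmt g t \<in> {w \<in> carrier G. cnj g w \<in> W}" if t: "t \<in> S" for t
          proof -
            have "cnj g (cmt g t) = cmt g (cnj g t)" using g(1) t by (simp add: cmt_cnj cnj_hom cnj_inv)
            then show ?thesis using gen[OF less.prems(3)[OF t]] t g(1) by simp
          qed
        qed
        then show ?thesis using that by blast
      qed
      have "cnj g (cmt g t) = cmt g t" by (rule fix_sub[OF sW _ gW gen[OF t]]) (use W WS in blast)
      moreover have "cmt g t [^] (p ^ n) = \<one>" using pow_card_subgroup[OF fin S cgS[OF t]] less.prems(2) by simp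
      ultimately show ?thesis using coprime_action_trivial[OF g(1,2)] g(3) t by (simp add: coprime_power_right_iff)
    next
      case True
      \<comment> \<open>The three subgroups argument: \<open>g\<close> centralises the normal
        subgroup \<open>M\<close>, so \<open>g u g^-1\<close> and \<open>u\<close> act alike on
        \<open>M\<close>, and \<open>cmt g u\<close> centralises it. These commutators generate
        \<open>S\<close>.\<close>
      have cen: "c \<otimes> z = z \<otimes> c" if c: "c \<in> S" and z: "z \<in> M" for c z
      proof -
        have zG: "z \<in> carrier G" using MS[OF z] by simp
        have "W \<subseteq> {w \<in> carrier G. cnj w z = z}"
        proof (rule in_W_induct)
          show "subgroup {w \<in> carrier G. cnj w z = z} G"
          proof (rule subgroupI)
            show "inv a \<in> {w \<in> carrier G. cnj w z = z}" if "a \<in> {w \<in> carrier G. cnj w z = z}" for a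
              using that zG by auto (metis cnj_cancel(1))
          qed (use zG in \<open>auto simp: cnj_mult intro!: exI[of _ \<one>]\<close>)
          show "cmt g u \<in> {w \<in> carrier G. cnj w z = z}" if u: "u \<in> S" for u
          proof -
            let ?y = "cnj (inv u) z"
            have yM: "?y \<in> M" by (rule nM[OF Sc(3)[OF u] z])
            have uG: "u \<in> carrier G" and yG: "?y \<in> carrier G" using u zG by auto
            have zy: "z = cnj u ?y" using uG zG by simp
            have gu: "cnj (cnj g u) ?y = z"
            proof -
              have "cnj (cnj g u) ?y = cnj g (cnj u (cnj (inv g) ?y))"
                using g(1) uG yG by (simp add: cnj_def m_assoc inv_mult_group)
              also have "cnj (inv g) ?y = ?y" using fixM[OF yM] cnj_cancel(1)[OF g(1) yG] by simp
              finally show ?thesis using zy fixM[OF z] by simp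
            qed
            have "cnj (cmt g u) z = cnj (cnj g u \<otimes> inv u) z" using g(1) uG by (simp add: cmt_cnj)
            also have "\<dots> = z" using cnj_mult[of "cnj g u" "inv u" z] g(1) uG zG gu by simp
            finally show ?thesis using g(1) uG by simp
          qed
        qed
        then have "cnj c z = z" using c True by blast
        then show ?thesis using cnj_eq_iff zG c by simp
      qed
      \<comment> \<open>It is enough that \<open>cmt g u\<close> has order dividing
        \<open>p\<close>. It is the product of \<open>g u g^-1\<close> and \<open>inv u\<close>,
        whose \<open>p\<close>-th powers are mutually inverse because \<open>g\<close> fixes
        \<open>u^p\<close> in \<open>M\<close>.\<close>
      have fix_gen: "cnj g (cmt g u) = cmt g u" if u: "u \<in> S" for u
      proof (rule less.prems(4)[OF cgS[OF u]])
        let ?a = "cnj g u" and ?b = "inv u"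
        have aS: "?a \<in> S" and bS: "?b \<in> S" using less.prems(3)[OF u] Sc(3)[OF u] by auto
        define z where "z = inv ?b \<otimes> (inv ?a \<otimes> (?b \<otimes> ?a))"
        have aG: "?a \<in> carrier G" and bG: "?b \<in> carrier G" using aS bS by auto
        have zS: "z \<in> S" unfolding z_def by (intro Sc(2,3) aS bS u)
        have zM: "z \<in> M"
        proof (rule MI[OF zS])
          fix \<chi> assume \<chi>: "\<chi> \<in> chars p S"
          note i = Sc(3)[OF aS] Sc(3)[OF bS] and d = Sc(2)[OF bS aS]
          show "\<chi> z = 0"
            unfolding z_def cm[OF \<chi> i(2) Sc(2)[OF i(1) d]] cm[OF \<chi> i(1) d] cm[OF \<chi> bS aS] ci[OF \<chi> aS] ci[OF \<chi> bS] by simp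
        qed
        have zG: "z \<in> carrier G" using zS by simp
        have ba: "?b \<otimes> ?a = ?a \<otimes> ?b \<otimes> z"
          unfolding z_def using aG bG by (simp only: m_assoc inv_closed m_closed inv_mult_cancel)
        note c2 = class_two_pow[OF aG bG zG ba cen[OF aS zM, symmetric] cen[OF bS zM, symmetric]]
        have "?b [^] p \<otimes> ?a = ?a \<otimes> ?b [^] p" using cen[OF aS powM[OF bS]] by simp
        then have "?a \<otimes> ?b [^] p \<otimes> z [^] p = ?a \<otimes> ?b [^] p" using c2(1)[of p] by simp
        then have zp: "z [^] p = \<one>" using aG bG zG l_cancel_one[of "?a \<otimes> ?b [^] p" "z [^] p"] by simp
        \<comment> \<open>Here oddness enters: \<open>p\<close> divides \<open>p choose 2\<close>,
          so the correction term of the class two formula disappears.\<close>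
        have "p > 2" using p prime_ge_2_nat[OF p(1)] by (cases "p = 2") auto
        then have "p dvd p choose 2" using p(1) by (intro dvd_choose_prime) auto
        then have "z [^] (p choose 2) = \<one>" using zp zG by (metis dvdE nat_pow_one nat_pow_pow)
        then have "(?a \<otimes> ?b) [^] p = ?a [^] p \<otimes> ?b [^] p" using c2(2)[of p] aG bG by simp
        also have "?a [^] p = u [^] p" using cnj_pow[OF g(1), of u p] fixM[OF powM[OF u]] u by simp
        also have "?b [^] p = inv (u [^] p)" using nat_pow_inv u by simp
        finally show "cmt g u [^] p = \<one>" using u g(1) by (simp add: cmt_cnj)
      qed
      have "W \<subseteq> {w \<in> carrier G. cnj g w = w}"
      proof (rule in_W_induct)
        show "subgroup {w \<in> carrier G. cnj g w = w} G"
          by (rule subgroupI) (use g(1) in \<open>auto simp: cnj_hom cnj_inv intro!: exI[of _ \<one>]\<close>)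
        show "cmt g u \<in> {w \<in> carrier G. cnj g w = w}" if "u \<in> S" for u
          using fix_gen[OF that] that g(1) by simp
      qed
      then show ?thesis using t True by blast
    qed
    then show ?thesis using less.prems(5) by blast
  qed
qed

end

context Group.group
begin

text \<open>Induction down the invariant subgroups: \<open>[x, r]\<close> acts trivially modulo
  \<open>B0\<close>, so \<open>[h, b]\<close> lies in \<open>B0\<close>, where \<open>h\<close> acts
  trivially by induction. As the order of \<open>h\<close> is prime to \<open>p\<close>, coprimality
  lifts this to \<open>B\<close>.\<close>

lemma p'_power_of_commutator_centralises:
  fixes Z :: "nat \<Rightarrow> 'a set"
  assumes fin: "finite (carrier G)" and p: "Factorial_Ring.prime (p::nat)"
    and R: "subgroup R G" and P: "subgroup P G" "x \<in> P"
    and x: "\<And>r. r \<in> R \<Longrightarrow> cnj x r \<in> R"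
    and T: "subgroup T G" "T \<subseteq> R" "T \<subseteq> P" "\<And>r t. r \<in> R \<Longrightarrow> t \<in> T \<Longrightarrow> cnj r t \<in> T" "\<And>t. t \<in> T \<Longrightarrow> cnj x t \<in> T"
      "card R = card T * m" "coprime m p"
    and Z: "Z 0 = {\<one>}" "\<And>k b g. b \<in> Z (Suc k) \<Longrightarrow> g \<in> P \<Longrightarrow> cmt g b \<in> Z k"
    and r: "r \<in> R" and h: "h = cmt x r [^] (k::nat)" "h [^] (j::nat) = \<one>" "coprime j p"
  shows "subgroup B G \<Longrightarrow> card B = p ^ n \<Longrightarrow> (\<And>r b. r \<in> R \<Longrightarrow> b \<in> B \<Longrightarrow> cnj r b \<in> B) \<Longrightarrow>
    (\<And>b. b \<in> B \<Longrightarrow> cnj x b \<in> B) \<Longrightarrow> B \<subseteq> Z (p - 2) \<Longrightarrow> b \<in> B \<Longrightarrow> cnj h b = b"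
proof (induction "card B" arbitrary: B n b rule: less_induct)
  case less
  have RG: "R \<subseteq> carrier G" and BG: "B \<subseteq> carrier G"
    using subgroup.subset[OF R] subgroup.subset[OF less.prems(1)] by simp_all
  have xG: "x \<in> carrier G" and rG: "r \<in> carrier G" using subgroup.mem_carrier[OF P] subsetD[OF RG r] by simp_all
  define c where "c = cmt x r"
  have cG: "c \<in> carrier G" using xG rG by (simp add: c_def)
  have hG: "h \<in> carrier G" using h(1) cG by (simp add: c_def)
  have finB: "finite B" using fin BG finite_subset by blast
  show ?case
  proof (cases "B = {\<one>}")
    case True then show ?thesis using less.prems(6) hG by simp
  next
    case False
    obtain B0 where B0: "subgroup B0 G" "B0 \<subset> B" "\<And>r b. r \<in> R \<Longrightarrow> b \<in> B0 \<Longrightarrow> cnj r b \<in> B0"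
      "\<And>b. b \<in> B0 \<Longrightarrow> cnj x b \<in> B0" "\<And>r b. r \<in> R \<Longrightarrow> b \<in> B \<Longrightarrow> cmt (cmt x r) b \<in> B0"
    proof (rule commutator_acts_trivially_on_section[where p = p and B = B and n = n and R = R and P = P
          and x = x and T = T and m = m and Z = Z])
      show "B \<noteq> {\<one>}" by (rule False)
      show "B \<subseteq> Z (p - 2)" by (rule less.prems(5))
      show "cnj r b \<in> B" if "r \<in> R" "b \<in> B" for r b by (rule less.prems(3)[OF that])
      show "cnj x b \<in> B" if "b \<in> B" for b by (rule less.prems(4)[OF that])
    qed (rule fin p less.prems R P x T Z that; assumption)+
    have "card B0 dvd p ^ n" using card_subgroup_dvd[OF fin B0(1) less.prems(1)] B0(2) less.prems(2) by auto
    then obtain i where i: "card B0 = p ^ i" using p by (auto simp: divides_primepow_nat)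
    have fix0: "cnj h d = d" if "d \<in> B0" for d
      by (rule less.hyps[OF psubset_card_mono[OF finB B0(2)] B0(1) i B0(3) B0(4) _ that]) (use B0(2) less.prems(5) in auto)
    have cR: "c \<in> R" using x[OF r] R r xG rG by (simp add: c_def cmt_cnj subgroup.m_closed subgroup.m_inv_closed)
    \<comment> \<open>Acting trivially modulo \<open>B0\<close> passes from \<open>c\<close> to its
      powers, hence to \<open>h\<close>.\<close>
    have cB0: "cmt (c [^] l) b' \<in> B0" if b': "b' \<in> B" for l :: nat and b'
    proof (induction l)
      case 0
      have "cmt (c [^] (0::nat)) b' = \<one>" using b' BG by (auto simp: cmt_def)
      then show ?case using subgroup.one_closed[OF B0(1)] by simp
    next
      case (Suc l)
      have bG: "b' \<in> carrier G" using b' BG by blast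
      let ?b = "cnj (c [^] l) b'"
      have "?b \<in> B" using less.prems(3)[OF subgroup_pow_closed[OF R cR] b'] .
      then have "cmt c ?b \<in> B0" using B0(5)[OF r] by (simp add: c_def)
      moreover have "cmt (c [^] Suc l) b' = cmt c ?b \<otimes> cmt (c [^] l) b'"
      proof -
        have "cnj (c [^] Suc l) b' = cnj c ?b" using nat_pow_Suc2[OF cG] cnj_mult[OF cG _ bG] cG by simp
        then show ?thesis using cG bG by (simp add: cmt_cnj m_assoc)
      qed
      ultimately show ?case using Suc subgroup.m_closed[OF B0(1)] by simp
    qed
    have bG: "b \<in> carrier G" using less.prems(6) BG by blast
    have "cmt h b \<in> B0" using cB0[OF less.prems(6), of k] h(1) by (simp add: c_def)
    moreover from this have "cmt h b [^] (p ^ i) = \<one>" using pow_card_subgroup[OF fin B0(1)] i by simp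
    ultimately show ?thesis
      using coprime_action_trivial[OF hG h(2) bG fix0] h(3) by (simp add: coprime_power_right_iff)
  qed
qed

text \<open>The transfer into a central Hall subgroup \<open>D\<close> of index \<open>n\<close> restricts to the \<open>n\<close>-th power map on
  \<open>D\<close>; its kernel is the set of elements whose \<open>n\<close>-th power is trivial.\<close>

lemma central_hall_complement:
  assumes fin: "finite (carrier G)" and D: "subgroup D G" "\<And>d g. d \<in> D \<Longrightarrow> g \<in> carrier G \<Longrightarrow> d \<otimes> g = g \<otimes> d"
    and cop: "coprime (card (rcosets D)) (card D)"
  shows "subgroup {g \<in> carrier G. g [^] card (rcosets D) = \<one>} G"
proof -
  define n where "n = card (rcosets D)"
  have DG: "\<And>d. d \<in> D \<Longrightarrow> d \<in> carrier G" using subgroup.subset[OF D(1)] by blast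
  have nD: "D \<lhd> G" unfolding normal_inv_iff
  proof (intro conjI ballI)
    fix g d assume gd: "g \<in> carrier G" "d \<in> D"
    have "g \<otimes> d \<otimes> inv g = d \<otimes> g \<otimes> inv g" using D(2)[OF gd(2,1)] by simp
    then show "g \<otimes> d \<otimes> inv g \<in> D" using gd DG by (simp add: m_assoc)
  qed (rule D(1))
  interpret DD: Group.group "G\<lparr>carrier := D\<rparr>" by (rule subgroup_imp_group[OF D(1)])
  interpret DC: comm_group "G\<lparr>carrier := D\<rparr>"
  proof (rule DD.group_comm_groupI)
    fix a b assume "a \<in> carrier (G\<lparr>carrier := D\<rparr>)" "b \<in> carrier (G\<lparr>carrier := D\<rparr>)"
    then show "a \<otimes>\<^bsub>G\<lparr>carrier := D\<rparr>\<^esub> b = b \<otimes>\<^bsub>G\<lparr>carrier := D\<rparr>\<^esub> a" using D(2)[of a b] DG[of b] by simp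
  qed
  define s where "s C = (SOME c. c \<in> C)" for C :: "'a set"
  have s: "s C \<in> C" if C: "C \<in> rcosets D" for C
  proof -
    obtain a where "a \<in> carrier G" "C = D #> a" using C unfolding RCOSETS_def by blast
    then have "a \<in> C" using rcos_self[OF _ D(1)] by blast
    then show ?thesis unfolding s_def by (rule someI)
  qed
  have RC: "C #> g \<in> rcosets D" if C: "C \<in> rcosets D" "g \<in> carrier G" for C g
  proof -
    obtain a where a: "a \<in> carrier G" "C = D #> a" using C(1) unfolding RCOSETS_def by blast
    then have "C #> g = D #> (a \<otimes> g)" using C(2) subgroup.subset[OF D(1)] by (simp add: coset_mult_assoc)
    then show ?thesis using a(1) C(2) subgroup.subset[OF D(1)] by (simp add: rcosetsI)
  qed
  have CG: "C \<subseteq> carrier G" if "C \<in> rcosets D" for C using subgroup.rcosets_carrier[OF D(1) is_group that] .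
  have sG: "s C \<in> carrier G" if "C \<in> rcosets D" for C using s[OF that] CG[OF that] by blast
  \<comment> \<open>The transfer factor of the transversal \<open>s\<close>: how far
    \<open>s C g\<close> deviates, inside \<open>D\<close>, from the representative of its own
    coset.\<close>
  define t where "t C g = s C \<otimes> g \<otimes> inv (s (C #> g))" for C g
  have tD: "t C g \<in> D" if C: "C \<in> rcosets D" and g: "g \<in> carrier G" for C g
  proof -
    obtain a where a: "a \<in> carrier G" "C #> g = D #> a" using RC[OF C g] unfolding RCOSETS_def by blast
    have "s (C #> g) \<in> D #> a" using s[OF RC[OF C g]] a(2) by simp
    then have "C #> g = D #> s (C #> g)" using repr_independence[OF _ a(1) D(1)] a(2) by simp
    moreover have "s C \<otimes> g \<in> C #> g" using s[OF C] unfolding r_coset_def by blast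
    ultimately have "s C \<otimes> g \<in> D #> s (C #> g)" by metis
    then obtain d where d: "d \<in> D" "s C \<otimes> g = d \<otimes> s (C #> g)" unfolding r_coset_def by blast
    then show ?thesis using DG[OF d(1)] sG[OF RC[OF C g]] by (simp add: t_def m_assoc)
  qed
  define \<tau> where "\<tau> g = finprod (G\<lparr>carrier := D\<rparr>) (\<lambda>C. t C g) (rcosets D)" for g
  have \<tau>D: "\<tau> g \<in> D" if "g \<in> carrier G" for g
    using DC.finprod_closed[of "\<lambda>C. t C g" "rcosets D"] tD that by (auto simp: \<tau>_def)
  have \<tau>_mult: "\<tau> (g \<otimes> g') = \<tau> g \<otimes> \<tau> g'" if g: "g \<in> carrier G" "g' \<in> carrier G" for g g'
  proof -
    have inj: "inj_on (\<lambda>C. C #> g) (rcosets D)"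
      by (rule inj_on_inverseI[where g = "\<lambda>C. C #> inv g"]) (use CG g in \<open>simp add: coset_mult_assoc\<close>)
    have "(\<lambda>C. C #> g) ` (rcosets D) = rcosets D"
      using RC[OF _ g(1)] by (intro endo_inj_surj[OF finite_rcosets[OF fin] _ inj]) blast
    then have "\<tau> g' = finprod (G\<lparr>carrier := D\<rparr>) (\<lambda>C. t C g') ((\<lambda>C. C #> g) ` (rcosets D))" by (simp add: \<tau>_def)
    also have "\<dots> = finprod (G\<lparr>carrier := D\<rparr>) (\<lambda>C. t (C #> g) g') (rcosets D)"
      by (rule DC.finprod_reindex[OF _ inj]) (use RC[OF _ g(1)] tD[OF _ g(2)] in auto)
    finally have "\<tau> g \<otimes> \<tau> g' = finprod (G\<lparr>carrier := D\<rparr>) (\<lambda>C. t C g \<otimes> t (C #> g) g') (rcosets D)"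
      using DC.finprod_multf[of "\<lambda>C. t C g" "rcosets D" "\<lambda>C. t (C #> g) g'"] tD g RC by (auto simp: \<tau>_def Pi_def)
    also have "\<dots> = \<tau> (g \<otimes> g')"
      unfolding \<tau>_def
    proof (rule DC.finprod_cong'[OF refl])
      fix C assume C: "C \<in> rcosets D"
      show "t C g \<otimes> t (C #> g) g' = t C (g \<otimes> g')"
        using sG[OF C] sG[OF RC[OF C g(1)]] sG[OF RC[OF RC[OF C g(1)] g(2)]] g CG[OF C]
        by (simp add: t_def m_assoc coset_mult_assoc)
    qed (use tD g in auto)
    finally show ?thesis by simp
  qed
  have \<tau>_D: "\<tau> d = d [^] n" if d: "d \<in> D" for d
  proof -
    have "t C d = d" if C: "C \<in> rcosets D" for C
    proof -
      obtain a where a: "a \<in> carrier G" "C = D #> a" using C unfolding RCOSETS_def by blast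
      have "C #> d = D #> (d \<otimes> a)" using a DG[OF d] D(2)[OF d a(1)] subgroup.subset[OF D(1)] by (simp add: coset_mult_assoc)
      also have "\<dots> = (D #> d) #> a" using a DG[OF d] subgroup.subset[OF D(1)] by (simp add: coset_mult_assoc)
      also have "\<dots> = C" using a coset_join2[OF DG[OF d] D(1) d] by simp
      finally have "C #> d = C" .
      then have "t C d = d \<otimes> s C \<otimes> inv (s C)" using D(2)[OF d sG[OF C]] by (simp add: t_def)
      then show ?thesis using DG[OF d] sG[OF C] by (simp add: m_assoc)
    qed
    then have "\<tau> d = finprod (G\<lparr>carrier := D\<rparr>) (\<lambda>C. d) (rcosets D)"
      unfolding \<tau>_def using d by (intro DC.finprod_cong') auto
    then show ?thesis using DC.finprod_const[of d "rcosets D"] d by (simp add: n_def nat_pow_consistent[symmetric])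
  qed
  have \<tau>_one: "\<tau> \<one> = \<one>" using \<tau>_D[OF subgroup.one_closed[OF D(1)]] by simp
  have \<tau>_pow: "\<tau> (g [^] k) = \<tau> g [^] k" if "g \<in> carrier G" for g and k :: nat
    using that by (induction k) (simp_all add: \<tau>_one \<tau>_mult)
  have key: "g [^] n = \<one> \<longleftrightarrow> \<tau> g = \<one>" if g: "g \<in> carrier G" for g
  proof
    assume "g [^] n = \<one>"
    then have "\<tau> g [^] n = \<one>" using \<tau>_pow[OF g, of n] \<tau>_one by simp
    moreover have "\<tau> g [^] card D = \<one>" using pow_card_subgroup[OF fin D(1) \<tau>D[OF g]] .
    ultimately show "\<tau> g = \<one>" using coprime_pow_eq_one[OF DG[OF \<tau>D[OF g]]] cop by (simp add: n_def)
  next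
    assume t1: "\<tau> g = \<one>"
    have gn: "g [^] n \<in> D" using pow_index_in_normal[OF fin nD g] by (simp add: n_def)
    have "(g [^] n) [^] n = \<one>" using \<tau>_D[OF gn] \<tau>_pow[OF g, of n] t1 by simp
    moreover have "(g [^] n) [^] card D = \<one>" using pow_card_subgroup[OF fin D(1) gn] .
    ultimately show "g [^] n = \<one>" using coprime_pow_eq_one[of "g [^] n"] g cop by (simp add: n_def)
  qed
  have "subgroup {g \<in> carrier G. \<tau> g = \<one>} G"
  proof (rule subgroupI)
    show "inv a \<in> {g \<in> carrier G. \<tau> g = \<one>}" if "a \<in> {g \<in> carrier G. \<tau> g = \<one>}" for a
      using that \<tau>_mult[of a "inv a"] \<tau>_one \<tau>D[of "inv a"] DG by simp
    show "{g \<in> carrier G. \<tau> g = \<one>} \<noteq> {}" using \<tau>_one one_closed by blast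
  qed (use \<tau>_mult in auto)
  moreover have "{g \<in> carrier G. \<tau> g = \<one>} = {g \<in> carrier G. g [^] n = \<one>}" using key by blast
  ultimately show ?thesis by (simp add: n_def)
qed

section \<open>Products of subgroups and maximality of Sylow subgroups\<close>

lemma pow_coprime_in_subgroup:
  assumes T: "subgroup T G" and c: "c \<in> carrier G" "c [^] (m::nat) \<in> T" "c [^] (n::nat) \<in> T" "coprime m n"
  shows "c \<in> T"
proof -
  obtain u v where "u * int m + v * int n = 1" using c(4) bezout_int[of "int m" "int n"] by auto
  then have "c = c [^] (int m * u + int n * v)" using c(1) by (metis int_pow_1 mult.commute)
  also have "\<dots> = (c [^] int m) [^] u \<otimes> (c [^] int n) [^] v" using c(1) by (simp only: int_pow_mult int_pow_pow)
  also have "\<dots> \<in> T" using c(2,3) T by (simp add: int_pow_int subgroup_int_pow_closed subgroup.m_closed)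
  finally show ?thesis .
qed

lemma card_set_mult:
  assumes fin: "finite (carrier G)" and N: "N \<lhd> G" and M: "subgroup M G"
  shows "card (N <#> M) * card (N \<inter> M) = card N * card M"
proof -
  interpret second_isomorphism_grp N G M
    using N M by (simp add: second_isomorphism_grp_def second_isomorphism_grp_axioms_def)
  have NM: "subgroup (N <#> M) G" by (rule normal_set_mult_subgroup)
  interpret NM: Group.group "G\<lparr>carrier := N <#> M\<rparr>" by (rule subgroup_imp_group[OF NM])
  interpret M: Group.group "G\<lparr>carrier := M\<rparr>" by (rule subgroup_imp_group[OF M])
  have sN: "subgroup N (G\<lparr>carrier := N <#> M\<rparr>)"
    using H_contained_in_set_mult NM is_subgroup subgroup_incl by blast
  have sI: "subgroup (N \<inter> M) (G\<lparr>carrier := M\<rparr>)"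
    by (metis inf_commute normal_imp_subgroup normal_subgrp_intersection_normal)
  have e1: "card (rcosets\<^bsub>G\<lparr>carrier := N <#> M\<rparr>\<^esub> N) = card (rcosets\<^bsub>G\<lparr>carrier := M\<rparr>\<^esub> (N \<inter> M))"
    using iso_same_card[OF is_isoI[OF normal_intersection_quotient_isom]]
    by (simp add: FactGroup_def)
  have e2: "card (rcosets\<^bsub>G\<lparr>carrier := N <#> M\<rparr>\<^esub> N) * card N = card (N <#> M)"
    using NM.lagrange[OF sN] by (simp add: order_def)
  have e3: "card (rcosets\<^bsub>G\<lparr>carrier := M\<rparr>\<^esub> (N \<inter> M)) * card (N \<inter> M) = card M"
    using M.lagrange[OF sI] by (simp add: order_def)
  show ?thesis unfolding e2[symmetric] e3[symmetric] e1 by (simp only: ac_simps)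
qed

lemma set_mult_mem:
  assumes "N \<lhd> G" "subgroup M G"
  shows "subgroup (N <#> M) G" "N \<subseteq> N <#> M" "M \<subseteq> N <#> M"
proof -
  interpret second_isomorphism_grp N G M
    using assms by (simp add: second_isomorphism_grp_def second_isomorphism_grp_axioms_def)
  show "subgroup (N <#> M) G" "N \<subseteq> N <#> M" "M \<subseteq> N <#> M"
    by (rule normal_set_mult_subgroup, rule H_contained_in_set_mult, rule S_contained_in_set_mult)
qed

lemma sylow_maximal:
  assumes fin: "finite (carrier G)" and p: "Factorial_Ring.prime (p::nat)"
    and P: "subgroup P G" "coprime (card (rcosets P)) p" and S: "subgroup S G" "card S = p ^ j" "P \<subseteq> S"
  shows "S = P"
proof
  show "S \<subseteq> P"
  proof
    fix s assume s: "s \<in> S"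
    have finS: "finite S" using fin subgroup.subset[OF S(1)] finite_subset by blast
    have "card S dvd card (rcosets P) * card P"
      using card_subgroup_dvd[OF fin S(1) subgroup_self] subgroup.subset[OF S(1)] card_rcosets_mult[OF fin P(1)] by simp
    moreover have "coprime (card S) (card (rcosets P))" using P(2) S(2) by (simp add: coprime_commute coprime_power_right_iff)
    ultimately have "card S dvd card P" using coprime_dvd_mult_right_iff by blast
    moreover have "card P \<noteq> 0" using finite_subset[OF S(3) finS] subgroup.one_closed[OF P(1)] by auto
    ultimately have "card S \<le> card P" by (simp add: dvd_imp_le)
    then show "s \<in> P" using card_seteq[OF finS S(3)] s by simp
  qed
qed (rule S(3))

end

section \<open>Normality of the Sylow subgroup\<close>

text \<open>The form of \<open>p\<close>-solubility used by the Hall-Higman arguments: it speaks of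
  subgroups normal in the whole group, and it passes to quotients by taking preimages.\<close>

definition p_chief_factors :: "nat \<Rightarrow> ('a, 'b) monoid_scheme \<Rightarrow> bool" where
  "p_chief_factors p G \<longleftrightarrow> (\<forall>N M. N \<lhd> G \<longrightarrow> M \<lhd> G \<longrightarrow> N \<subset> M \<longrightarrow>
     (\<exists>L k. L \<lhd> G \<and> N \<subset> L \<and> L \<subseteq> M \<and> card L = card N * k \<and> ((\<exists>i. k = p ^ i) \<or> coprime k p)))"

context Group.group
begin

lemma normal_cnj_iff: "N \<lhd> G \<longleftrightarrow> subgroup N G \<and> (\<forall>g \<in> carrier G. \<forall>h \<in> N. cnj g h \<in> N)"
  by (simp add: normal_inv_iff cnj_def)

text \<open>The Hall-Higman centraliser argument occurs twice, in \<open>G\<close> and in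
  \<open>G/T\<close>. The second layer is treated inside \<open>G\<close>, with commutators required
  to lie in \<open>T\<close>, so no second quotient group is formed.\<close>

lemma sylow_normal:
  fixes Z :: "nat \<Rightarrow> 'a set"
  assumes fin: "finite (carrier G)" and p: "Factorial_Ring.prime (p::nat)" "odd p"
    and cf: "p_chief_factors p G" and O: "\<And>N. N \<lhd> G \<Longrightarrow> coprime (card N) p \<Longrightarrow> N = {\<one>}"
    and P: "subgroup P G" "card P = p ^ a" "coprime (card (rcosets P)) p"
    and Z: "Z 0 = {\<one>}" "\<And>k b g. b \<in> Z (Suc k) \<Longrightarrow> g \<in> P \<Longrightarrow> cmt g b \<in> Z k"
      "subgroup (Z (p - 2)) G" "\<And>s. s \<in> P \<Longrightarrow> s [^] p = \<one> \<Longrightarrow> s \<in> Z (p - 2)"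
  shows "P \<lhd> G"
proof -
  let ?n = "card (rcosets P)"
  have PG: "\<And>g. g \<in> P \<Longrightarrow> g \<in> carrier G" using subgroup.subset[OF P(1)] by blast
  have order: "order G = ?n * p ^ a" using card_rcosets_mult[OF fin P(1)] P(2) by (simp add: order_def)
  have finS: "finite S" if "subgroup S G" for S using fin subgroup.subset[OF that] finite_subset by blast
  have cpos: "card S \<noteq> 0" if "subgroup S G" for S
    using finS[OF that] subgroup.one_closed[OF that] by auto
  define T where "T = p_core p G"
  have nT: "T \<lhd> G" unfolding T_def by (rule p_core_greatest(1)[OF fin p(1)])
  have sT: "subgroup T G" using nT by (rule normal_imp_subgroup)
  obtain t where t: "card T = p ^ t"
    using p_core_greatest(2)[OF fin p(1)] unfolding T_def by (auto simp: p_group_def order_def)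
  have T_max: "N \<subseteq> T" if "N \<lhd> G" "card N = p ^ i" for N i
    unfolding T_def
    by (rule p_core_greatest(3)[OF fin p(1) that(1)])
      (use that subgroup_imp_group[OF normal_imp_subgroup[OF that(1)]] finS[OF normal_imp_subgroup[OF that(1)]] in \<open>auto simp: p_group_def order_def\<close>)
  have nTc: "cnj g s \<in> T" if "g \<in> carrier G" "s \<in> T" for g s using nT that by (simp add: normal_cnj_iff)
  have TP: "T \<subseteq> P"
  proof -
    note TPm = set_mult_mem[OF nT P(1)]
    have "card (T <#> P) dvd p ^ (t + a)"
      using card_set_mult[OF fin nT P(1)] t P(2) by (simp add: power_add) (metis dvd_triv_left)
    then obtain j where "card (T <#> P) = p ^ j" using p(1) by (auto simp: divides_primepow_nat)
    then have "T <#> P = P" using sylow_maximal[OF fin p(1) P(1,3) TPm(1) _ TPm(3)] by blast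
    then show ?thesis using TPm(2) by simp
  qed
  \<comment> \<open>A maximal member corresponds to the largest normal \<open>p'\<close>-subgroup of
    \<open>G/T\<close>.\<close>
  define \<R> where "\<R> = {R. R \<lhd> G \<and> T \<subseteq> R \<and> (\<exists>m. card R = card T * m \<and> coprime m p)}"
  have "finite \<R>"
    by (rule finite_subset[of _ "Pow (carrier G)"]) (use fin in \<open>auto simp: \<R>_def normal_inv_iff dest: subgroup.mem_carrier\<close>)
  moreover have "T \<in> \<R>" using nT by (auto simp: \<R>_def intro: exI[of _ 1])
  ultimately obtain R where R\<R>: "R \<in> \<R>" and R_max: "\<And>L. L \<in> \<R> \<Longrightarrow> R \<subseteq> L \<Longrightarrow> L = R"
    using finite_has_maximal[of \<R>] by blast
  obtain m where nR: "R \<lhd> G" and TR: "T \<subseteq> R" and m: "card R = card T * m" "coprime m p"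
    using R\<R> unfolding \<R>_def by blast
  have sR: "subgroup R G" using nR by (rule normal_imp_subgroup)
  have nRc: "cnj g r \<in> R" if "g \<in> carrier G" "r \<in> R" for g r using nR that by (simp add: normal_cnj_iff)
  have RG: "\<And>g. g \<in> R \<Longrightarrow> g \<in> carrier G" using subgroup.subset[OF sR] by blast
  have TG: "\<And>g. g \<in> T \<Longrightarrow> g \<in> carrier G" using TR RG by blast

  define E where "E = {g \<in> carrier G. \<forall>s \<in> T. cnj g s = s}"
  have EI: "g \<in> E" if "g \<in> carrier G" "\<And>s. s \<in> T \<Longrightarrow> cnj g s = s" for g using that by (simp add: E_def)
  have EG: "g \<in> carrier G" and ED: "\<And>s. s \<in> T \<Longrightarrow> cnj g s = s" if "g \<in> E" for g using that by (auto simp: E_def)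
  have nE: "E \<lhd> G"
    unfolding normal_cnj_iff
  proof (intro conjI ballI subgroupI)
    show "E \<subseteq> carrier G" using EG by blast
    show "E \<noteq> {}" using EI[OF one_closed] TG by force
    show "inv g \<in> E" if g: "g \<in> E" for g
    proof (rule EI)
      show "cnj (inv g) s = s" if "s \<in> T" for s
        using cnj_cancel(1)[OF EG[OF g] TG[OF that]] ED[OF g that] by simp
    qed (use EG[OF g] in simp)
    show "g \<otimes> h \<in> E" if "g \<in> E" "h \<in> E" for g h
      by (rule EI) (use that EG ED TG in \<open>simp_all add: cnj_mult\<close>)
    show "cnj g h \<in> E" if g: "g \<in> carrier G" and h: "h \<in> E" for g h
    proof (rule EI)
      fix s assume s: "s \<in> T"
      have "cnj (cnj g h) s = cnj g (cnj h (cnj (inv g) s))"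
        using g EG[OF h] TG[OF s] by (simp add: cnj_def m_assoc inv_mult_group)
      also have "cnj h (cnj (inv g) s) = cnj (inv g) s" using ED[OF h nTc[OF inv_closed[OF g] s]] .
      finally show "cnj (cnj g h) s = s" using g TG[OF s] by simp
    qed (use g EG[OF h] in simp)
  qed
  \<comment> \<open>Otherwise take \<open>L\<close> normal between \<open>T \<inter> E\<close> and
    \<open>E\<close> with index a power of \<open>p\<close> or prime to \<open>p\<close>. In the
    first case \<open>L\<close> is a normal \<open>p\<close>-subgroup, hence inside
    \<open>T\<close>. In the second, \<open>T \<inter> E\<close> is a central Hall subgroup of
    \<open>L\<close> and the transfer supplies a normal \<open>p'\<close>-subgroup.\<close>
  have ET: "E \<subseteq> T"
  proof (rule ccontr)
    assume "\<not> E \<subseteq> T"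
    then have "T \<inter> E \<subset> E" by blast
    moreover have nTE: "T \<inter> E \<lhd> G"
      using nT nE unfolding normal_cnj_iff by (auto intro: subgroups_Inter_pair)
    ultimately obtain L k where nL: "L \<lhd> G" and L: "T \<inter> E \<subset> L" "L \<subseteq> E" and k: "card L = card (T \<inter> E) * k" "(\<exists>i. k = p ^ i) \<or> coprime k p"
      using cf nE unfolding p_chief_factors_def by metis
    have sL: "subgroup L G" using nL by (rule normal_imp_subgroup)
    have sD: "subgroup (T \<inter> E) G" using nTE by (rule normal_imp_subgroup)
    have "card (T \<inter> E) dvd p ^ t" using card_subgroup_dvd[OF fin sD sT] t by simp
    then obtain d where d: "card (T \<inter> E) = p ^ d" using p(1) by (auto simp: divides_primepow_nat)
    show False
    proof (cases "\<exists>i. k = p ^ i")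
      case True
      then obtain i where "card L = p ^ (d + i)" using k(1) d by (auto simp: power_add)
      then show False using T_max[OF nL] L by blast
    next
      case False
      then have ck: "coprime k p" using k(2) by blast
      interpret L: Group.group "G\<lparr>carrier := L\<rparr>" by (rule subgroup_imp_group[OF sL])
      have finL: "finite L" by (rule finS[OF sL])
      have LG: "\<And>g. g \<in> L \<Longrightarrow> g \<in> carrier G" using subgroup.subset[OF sL] by blast
      have sDL: "subgroup (T \<inter> E) (G\<lparr>carrier := L\<rparr>)" using subgroup_incl[OF sD sL] L(1) by blast
      have "card (rcosets\<^bsub>G\<lparr>carrier := L\<rparr>\<^esub> (T \<inter> E)) * card (T \<inter> E) = card L"
        using L.lagrange[OF sDL] by (simp add: order_def)
      then have idx: "card (rcosets\<^bsub>G\<lparr>carrier := L\<rparr>\<^esub> (T \<inter> E)) = k" using k(1) cpos[OF sD] by (simp add: mult.commute)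
      \<comment> \<open>The transfer kernel. Its description by a power condition makes it invariant
        under conjugation by \<open>G\<close>, so it is trivial. Then the \<open>p^d\<close>-th
        power of every \<open>g\<close> in \<open>L\<close> is trivial as well.\<close>
      define K where "K = {g \<in> L. g [^] k = \<one>}"
      have "subgroup {g \<in> carrier (G\<lparr>carrier := L\<rparr>). g [^]\<^bsub>G\<lparr>carrier := L\<rparr>\<^esub> card (rcosets\<^bsub>G\<lparr>carrier := L\<rparr>\<^esub> (T \<inter> E)) = \<one>\<^bsub>G\<lparr>carrier := L\<rparr>\<^esub>} (G\<lparr>carrier := L\<rparr>)"
      proof (rule L.central_hall_complement[OF _ sDL])
        show "finite (carrier (G\<lparr>carrier := L\<rparr>))" using finL by simp
        show "coprime (card (rcosets\<^bsub>G\<lparr>carrier := L\<rparr>\<^esub> (T \<inter> E))) (card (T \<inter> E))"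
          unfolding idx d using ck by (simp add: coprime_power_right_iff)
        fix s g assume s: "s \<in> T \<inter> E" and g: "g \<in> carrier (G\<lparr>carrier := L\<rparr>)"
        have "cnj g s = s" using ED[of g s] s g L(2) by auto
        then show "s \<otimes>\<^bsub>G\<lparr>carrier := L\<rparr>\<^esub> g = g \<otimes>\<^bsub>G\<lparr>carrier := L\<rparr>\<^esub> s"
          using cnj_eq_iff[of g s] TG[of s] LG[of g] s g by simp
      qed
      then have "subgroup K (G\<lparr>carrier := L\<rparr>)" unfolding idx K_def by (simp add: nat_pow_consistent[symmetric])
      then have sK: "subgroup K G" by (rule incl_subgroup[OF sL])
      have "K \<lhd> G"
        unfolding normal_cnj_iff
      proof (intro conjI ballI)
        fix g h assume gh: "g \<in> carrier G" "h \<in> K"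
        then have "cnj g h \<in> L" using nL by (simp add: normal_cnj_iff K_def)
        moreover have "cnj g h [^] k = cnj g (h [^] k)" by (rule cnj_pow[OF gh(1) LG, symmetric]) (use gh(2) in \<open>simp add: K_def\<close>)
        ultimately show "cnj g h \<in> K" using gh by (simp add: K_def)
      qed (rule sK)
      moreover have "coprime (card K) p"
        by (rule coprime_card_subgroup[OF fin p(1) sK _ ck]) (simp add: K_def)
      ultimately have K1: "K = {\<one>}" by (rule O)
      have "L \<subseteq> T \<inter> E"
      proof
        fix g assume g: "g \<in> L"
        have gk: "g [^] k \<in> T \<inter> E"
          by (rule pow_index_in_subgroup[OF fin sL sD _ _ k(1) g])
            (use L(1) nTE LG in \<open>auto simp: normal_cnj_iff\<close>)
        have "(g [^] p ^ d) [^] k = (g [^] k) [^] p ^ d" using LG[OF g] by (simp add: nat_pow_pow mult.commute)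
        also have "\<dots> = \<one>" using pow_card_subgroup[OF fin sD gk] d by simp
        finally have "g [^] p ^ d \<in> K" using subgroup_pow_closed[OF sL g] by (simp add: K_def)
        then have "g [^] p ^ d \<in> T \<inter> E" using K1 subgroup.one_closed[OF sD] by simp
        then show "g \<in> T \<inter> E"
          using pow_coprime_in_subgroup[OF sD LG[OF g] gk] ck by (simp add: coprime_power_right_iff)
      qed
      then show False using L(1) by blast
    qed
  qed

  define \<Omega> where "\<Omega> = generate G {s \<in> T. s [^] p = \<one>}"
  have genT: "{s \<in> T. s [^] p = \<one>} \<subseteq> T" by blast
  have s\<Omega>: "subgroup \<Omega> G" unfolding \<Omega>_def using TG by (intro generate_is_subgroup) blast
  have \<Omega>T: "\<Omega> \<subseteq> T" unfolding \<Omega>_def by (rule generate_subgroup_incl[OF genT sT])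
  have \<Omega>Z: "\<Omega> \<subseteq> Z (p - 2)" unfolding \<Omega>_def by (rule generate_subgroup_incl[OF _ Z(3)]) (use TP Z(4) in auto)
  have n\<Omega>: "cnj g s \<in> \<Omega>" if g: "g \<in> carrier G" and s: "s \<in> \<Omega>" for g s
  proof -
    have \<Omega>G: "\<And>s. s \<in> \<Omega> \<Longrightarrow> s \<in> carrier G" using \<Omega>T TG by blast
    have "subgroup {s \<in> carrier G. cnj g s \<in> \<Omega>} G"
    proof (rule subgroupI)
      show "{s \<in> carrier G. cnj g s \<in> \<Omega>} \<noteq> {}" using g subgroup.one_closed[OF s\<Omega>] by (auto intro: exI[of _ \<one>])
    qed (use g s\<Omega> in \<open>auto simp: cnj_hom cnj_inv subgroup.m_closed subgroup.m_inv_closed\<close>)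
    moreover have "cnj g u \<in> \<Omega>" if u: "u \<in> T" "u [^] p = \<one>" for u
      unfolding \<Omega>_def using nTc[OF g u(1)] cnj_pow[OF g TG[OF u(1)], of p] u(2) g by (intro generate.incl) simp
    ultimately have "\<Omega> \<subseteq> {s \<in> carrier G. cnj g s \<in> \<Omega>}"
      using TG by (subst (1) \<Omega>_def) (intro generate_subgroup_incl, auto)
    then show ?thesis using s by blast
  qed
  have "card \<Omega> dvd p ^ t" using card_subgroup_dvd[OF fin s\<Omega> sT \<Omega>T] t by simp
  then obtain w where w: "card \<Omega> = p ^ w" using p(1) by (auto simp: divides_primepow_nat)

  have cmtT: "cmt x r \<in> T" if x: "x \<in> P" and r: "r \<in> R" for x r
  proof -
    have xG: "x \<in> carrier G" and rG: "r \<in> carrier G" using PG[OF x] RG[OF r] by auto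
    define c where "c = cmt x r"
    have cG: "c \<in> carrier G" using xG rG by (simp add: c_def)
    have cR: "c \<in> R" using nRc[OF xG r] sR r xG rG by (simp add: c_def cmt_cnj subgroup.m_closed subgroup.m_inv_closed)
    \<comment> \<open>Raising to \<open>p^a\<close>, the order of \<open>P\<close>, removes the
      \<open>p\<close>-part: the order of \<open>h\<close> divides the index of \<open>P\<close>.
      The exponent is explicit, so \<open>c\<close> need not be split into commuting parts.\<close>
    define h where "h = c [^] p ^ a"
    have hG: "h \<in> carrier G" using cG by (simp add: h_def)
    have hn: "h [^] ?n = \<one>"
      using pow_order_eq_1[OF cG] order cG by (simp add: h_def nat_pow_pow mult.commute)
    have fix\<Omega>: "cnj h b = b" if b: "b \<in> \<Omega>" for b
    proof (rule p'_power_of_commutator_centralises[where p = p and R = R and P = P and x = x and T = T and m = m and Z = Z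
          and r = r and h = h and k = "p ^ a" and j = "?n" and B = \<Omega> and n = w])
      show "h = cmt x r [^] p ^ a" by (simp add: h_def c_def)
      show "cnj x r \<in> R" if "r \<in> R" for r using nRc[OF xG that] .
      show "cnj r t \<in> T" if "r \<in> R" "t \<in> T" for r t using nTc[OF RG[OF that(1)] that(2)] .
      show "cnj x t \<in> T" if "t \<in> T" for t using nTc[OF xG that] .
      show "cnj r b \<in> \<Omega>" if "r \<in> R" "b \<in> \<Omega>" for r b using n\<Omega>[OF RG[OF that(1)] that(2)] .
      show "cnj x b \<in> \<Omega>" if "b \<in> \<Omega>" for b using n\<Omega>[OF xG that] .
    qed (rule fin p(1) sR P x sT TR TP m Z(1,2) r hn P(3) s\<Omega> w \<Omega>Z b; assumption)+
    have "cnj h s = s" if s: "s \<in> T" for s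
    proof (rule coprime_action_trivial_if_trivial_on_order_p[OF fin p hG hn P(3) sT t])
      show "cnj h s = s" if "s \<in> T" "s [^] p = \<one>" for s
        by (rule fix\<Omega>) (use that in \<open>auto simp: \<Omega>_def intro: generate.incl\<close>)
    qed (use nTc[OF hG] s in auto)
    \<comment> \<open>A \<open>p'\<close>-element in the \<open>p\<close>-group \<open>T\<close> is
      trivial. So the powers of \<open>c\<close> with the coprime exponents \<open>p^a\<close> and
      \<open>m\<close> both lie in \<open>T\<close>, and \<open>c\<close> does too.\<close>
    then have hT: "h \<in> T" using ET EI[OF hG] by blast
    have "h [^] p ^ t = \<one>" using pow_card_subgroup[OF fin sT hT] t by simp
    then have "h = \<one>" using coprime_pow_eq_one[OF hG hn] P(3) by (simp add: coprime_power_right_iff)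
    then have 1: "c [^] p ^ a \<in> T" using subgroup.one_closed[OF sT] by (simp add: h_def)
    have 2: "c [^] m \<in> T"
      by (rule pow_index_in_subgroup[OF fin sR sT TR _ m(1) cR]) (use nTc RG in auto)
    have "c \<in> T" by (rule pow_coprime_in_subgroup[OF sT cG 2 1]) (use m(2) in \<open>simp add: coprime_power_right_iff\<close>)
    then show ?thesis by (simp add: c_def)
  qed

  \<comment> \<open>The preimage of the centraliser of \<open>R/T\<close> in
    \<open>G/T\<close>.\<close>
  define C where "C = {g \<in> carrier G. \<forall>r \<in> R. cmt g r \<in> T}"
  have CI: "g \<in> C" if "g \<in> carrier G" "\<And>r. r \<in> R \<Longrightarrow> cmt g r \<in> T" for g using that by (simp add: C_def)
  have CG: "g \<in> carrier G" and CD: "\<And>r. r \<in> R \<Longrightarrow> cmt g r \<in> T" if "g \<in> C" for g using that by (auto simp: C_def)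
  have Tm: "\<And>u v. u \<in> T \<Longrightarrow> v \<in> T \<Longrightarrow> u \<otimes> v \<in> T" and Ti: "\<And>u. u \<in> T \<Longrightarrow> inv u \<in> T"
    using sT by (auto simp: subgroup.m_closed subgroup.m_inv_closed)
  have nC: "C \<lhd> G"
    unfolding normal_cnj_iff
  proof (intro conjI ballI subgroupI)
    show "C \<subseteq> carrier G" using CG by blast
    have "\<one> \<in> C" by (rule CI) (use RG subgroup.one_closed[OF sT] in \<open>auto simp: cmt_cnj\<close>)
    then show "C \<noteq> {}" by blast
    show "inv g \<in> C" if g: "g \<in> C" for g
    proof (rule CI)
      fix r assume r: "r \<in> R"
      have "cmt (inv g) r = cnj (inv g) (inv (cmt g r))"
        using CG[OF g] RG[OF r] by (simp add: cmt_def cnj_def m_assoc inv_mult_group)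
      then show "cmt (inv g) r \<in> T" using nTc[OF inv_closed[OF CG[OF g]] Ti[OF CD[OF g r]]] by simp
    qed (use CG[OF g] in simp)
    show "g \<otimes> h \<in> C" if g: "g \<in> C" and h: "h \<in> C" for g h
    proof (rule CI)
      fix r assume r: "r \<in> R"
      have "cmt (g \<otimes> h) r = cnj g (cmt h r) \<otimes> cmt g r"
        using CG[OF g] CG[OF h] RG[OF r] by (simp add: cmt_def cnj_def m_assoc inv_mult_group)
      then show "cmt (g \<otimes> h) r \<in> T" using Tm[OF nTc[OF CG[OF g] CD[OF h r]] CD[OF g r]] by simp
    qed (use CG[OF g] CG[OF h] in simp)
    show "cnj g c \<in> C" if g: "g \<in> carrier G" and c: "c \<in> C" for g c
    proof (rule CI)
      fix r assume r: "r \<in> R"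
      have "cmt (cnj g c) r = cnj g (cmt c (cnj (inv g) r))"
        using g CG[OF c] RG[OF r] by (simp add: cmt_def cnj_def m_assoc inv_mult_group)
      then show "cmt (cnj g c) r \<in> T" using nTc[OF g CD[OF c nRc[OF inv_closed[OF g] r]]] by simp
    qed (use g CG[OF c] in simp)
  qed
  have TC: "T \<subseteq> C"
  proof
    fix u assume u: "u \<in> T"
    show "u \<in> C"
    proof (rule CI)
      fix r assume r: "r \<in> R"
      have "cmt u r = u \<otimes> cnj r (inv u)" using TG[OF u] RG[OF r] by (simp add: cmt_def cnj_def m_assoc)
      then show "cmt u r \<in> T" using Tm[OF u nTc[OF RG[OF r] Ti[OF u]]] by simp
    qed (rule TG[OF u])
  qed
  \<comment> \<open>The same argument one layer up. An extension of \<open>p'\<close>-index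
    contradicts the maximality of \<open>R\<close>; one of \<open>p\<close>-power index produces a
    normal \<open>p\<close>-subgroup not contained in \<open>T\<close>.\<close>
  have CR: "C \<subseteq> R"
  proof (rule ccontr)
    assume "\<not> C \<subseteq> R"
    then have "R \<inter> C \<subset> C" by blast
    moreover have nD: "R \<inter> C \<lhd> G"
      using nR nC unfolding normal_cnj_iff by (auto intro: subgroups_Inter_pair)
    ultimately obtain L k where nL: "L \<lhd> G" and L: "R \<inter> C \<subset> L" "L \<subseteq> C" and k: "card L = card (R \<inter> C) * k" "(\<exists>i. k = p ^ i) \<or> coprime k p"
      using cf nC unfolding p_chief_factors_def by metis
    have sL: "subgroup L G" and sD: "subgroup (R \<inter> C) G" using nL nD by (auto intro: normal_imp_subgroup)
    have LG: "\<And>g. g \<in> L \<Longrightarrow> g \<in> carrier G" using subgroup.subset[OF sL] by blast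
    have RL: "R \<inter> L = R \<inter> C" using L by blast
    show False
    proof (cases "coprime k p")
      case True
      note RLm = set_mult_mem[OF nR sL]
      have "card (R <#> L) * card (R \<inter> C) = card R * card L" using card_set_mult[OF fin nR sL] RL by simp
      then have "card (R <#> L) = card T * (m * k)" using k(1) m(1) cpos[OF sD] by (simp add: mult.assoc mult.left_commute)
      moreover have "coprime (m * k) p" using m(2) True by simp
      ultimately have "R <#> L \<in> \<R>" unfolding \<R>_def using normal_subgroup_set_mult_closed[OF nR nL] RLm(2) TR by blast
      then have "R <#> L = R" using R_max RLm(2) by blast
      then show False using RLm(3) L RL by blast
    next
      case False
      then obtain i where i: "k = p ^ i" using k(2) by blast
      \<comment> \<open>A Sylow subgroup of \<open>L\<close>, as \<open>L\<close> is normal in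
        \<open>G\<close>. Comparing indices shows that \<open>S\<close> and
        \<open>R \<inter> C\<close> together generate all of \<open>L\<close>.\<close>
      define S where "S = L \<inter> P"
      have sS: "subgroup S G" unfolding S_def by (rule subgroups_Inter_pair[OF sL P(1)])
      note LPm = set_mult_mem[OF nL P(1)]
      have LP: "card (L <#> P) * card S = card L * card P" unfolding S_def by (rule card_set_mult[OF fin nL P(1)])
      obtain e where e: "card (L <#> P) = card P * e" using card_subgroup_dvd[OF fin P(1) LPm(1,3)] by (auto simp: dvd_def)
      have "card P * e dvd ?n * card P"
        using card_subgroup_dvd[OF fin LPm(1) subgroup_self] subgroup.subset[OF LPm(1)] card_rcosets_mult[OF fin P(1)] e by simp
      then have "e dvd ?n" using cpos[OF P(1)] by (simp add: mult.commute)
      then have ce: "coprime e p" using P(3) by (meson coprime_divisors dvd_refl)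
      have "card P * card L = card P * (card S * e)" using LP unfolding e by (metis mult.assoc mult.commute)
      then have LS: "card L = card S * e" using cpos[OF P(1)] by simp
      have "card S dvd p ^ a" using card_subgroup_dvd[OF fin sS P(1)] P(2) by (simp add: S_def)
      then obtain b where b: "card S = p ^ b" using p(1) by (auto simp: divides_primepow_nat)
      note DSm = set_mult_mem[OF nD sS]
      have DSL: "R \<inter> C <#> S \<subseteq> L"
        using L(1) subgroup.m_closed[OF sL] unfolding S_def set_mult_def by auto
      obtain f where f: "card L = card (R \<inter> C <#> S) * f" using card_subgroup_dvd[OF fin DSm(1) sL DSL] by (auto simp: dvd_def)
      obtain f1 where "card (R \<inter> C <#> S) = card (R \<inter> C) * f1" using card_subgroup_dvd[OF fin sD DSm(1,2)] by (auto simp: dvd_def)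
      then have f1: "f dvd p ^ i" using f k(1) i cpos[OF sD] by (simp add: mult.assoc)
      obtain f2 where "card (R \<inter> C <#> S) = card S * f2" using card_subgroup_dvd[OF fin sS DSm(1,3)] by (auto simp: dvd_def)
      then have "f dvd e" using f LS cpos[OF sS] by (simp add: mult.assoc)
      moreover have "coprime e (p ^ i)" using ce by (simp add: coprime_power_right_iff)
      ultimately have "f = 1" using f1 coprime_common_divisor_nat by blast
      then have "R \<inter> C <#> S = L" using f card_subset_eq[OF finS[OF sL] DSL] by simp
      then have dec: "\<exists>d s. d \<in> R \<inter> C \<and> s \<in> S \<and> g = d \<otimes> s" if "g \<in> L" for g
        using that unfolding set_mult_def by blast
      have TS: "T \<subseteq> S" using TC TR TP L(1) by (auto simp: S_def)
      have SG: "\<And>g. g \<in> S \<Longrightarrow> g \<in> carrier G" using subgroup.subset[OF sS] by blast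
      \<comment> \<open>Elements of \<open>R \<inter> C\<close> commute with those of
        \<open>S\<close> modulo \<open>T\<close>, because \<open>S\<close> lies in \<open>C\<close>;
        and \<open>T\<close> is contained in \<open>S\<close>.\<close>
      have nSL: "cnj g s \<in> S" if g: "g \<in> L" and s: "s \<in> S" for g s
      proof -
        obtain d u where du: "d \<in> R" "d \<in> C" "u \<in> S" "g = d \<otimes> u" using dec[OF g] by blast
        have us: "cnj u s \<in> S" using sS du(3) s by (simp add: cnj_def subgroup.m_closed subgroup.m_inv_closed)
        let ?v = "cnj u s"
        have vC: "?v \<in> C" using us L(2) by (auto simp: S_def)
        have dG: "d \<in> carrier G" and vG: "?v \<in> carrier G" using RG[OF du(1)] SG[OF us] by auto
        have "inv (cmt ?v d) \<in> S" using TS Ti[OF CD[OF vC du(1)]] by blast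
        then have "inv (cmt ?v d) \<otimes> ?v \<in> S" using us sS by (simp add: subgroup.m_closed)
        moreover have "inv (cmt ?v d) \<otimes> ?v = cnj d ?v" using dG vG by (simp add: cmt_def cnj_def m_assoc inv_mult_group)
        ultimately show ?thesis using cnj_mult[OF dG SG[OF du(3)] SG[OF s]] du(4) by simp
      qed
      have SL: "S \<subseteq> L" by (simp add: S_def)
      \<comment> \<open>A normal Sylow subgroup of \<open>L\<close> contains every element of
        \<open>p\<close>-power order in \<open>L\<close>, hence is invariant under
        \<open>G\<close>.\<close>
      have "S \<lhd> G"
        unfolding normal_cnj_iff
      proof (intro conjI ballI)
        fix g s assume g: "g \<in> carrier G" and s: "s \<in> S"
        have gL: "cnj g s \<in> L" using nL g s SL by (auto simp: normal_cnj_iff)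
        have 1: "cnj g s [^] e \<in> S" by (rule pow_index_in_subgroup[OF fin sL sS SL nSL LS gL])
        have "cnj g s [^] p ^ b = cnj g (s [^] p ^ b)" using cnj_pow[OF g SG[OF s]] by simp
        also have "\<dots> = \<one>" using pow_card_subgroup[OF fin sS s] b g by simp
        finally have 2: "cnj g s [^] p ^ b \<in> S" using subgroup.one_closed[OF sS] by simp
        show "cnj g s \<in> S" by (rule pow_coprime_in_subgroup[OF sS LG[OF gL] 1 2]) (use ce in \<open>simp add: coprime_power_right_iff\<close>)
      qed (rule sS)
      then have "S \<subseteq> T" using T_max b by blast
      then have "S \<subseteq> R \<inter> C" using TR TC by blast
      then have "L \<subseteq> R \<inter> C" using dec subgroup.m_closed[OF sD] by blast
      then show False using L(1) by blast
    qed
  qed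
  \<comment> \<open>Now \<open>P\<close> lies in \<open>C\<close>, hence in \<open>R\<close>, and
    \<open>R\<close> has index over \<open>T\<close> prime to \<open>p\<close>.\<close>
  have "P \<subseteq> T"
  proof
    fix g assume g: "g \<in> P"
    have "g \<in> C" using CI[OF PG[OF g]] cmtT[OF g] by blast
    then have gR: "g \<in> R" using CR by blast
    have 1: "g [^] m \<in> T" by (rule pow_index_in_subgroup[OF fin sR sT TR _ m(1) gR]) (use nTc RG in auto)
    have 2: "g [^] p ^ a \<in> T" using pow_card_subgroup[OF fin P(1) g] P(2) subgroup.one_closed[OF sT] by simp
    show "g \<in> T" by (rule pow_coprime_in_subgroup[OF sT PG[OF g] 1 2]) (use m(2) in \<open>simp add: coprime_power_right_iff\<close>)
  qed
  then show ?thesis using TP nT by simp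
qed

end

section \<open>The upper central series and chief factors\<close>

context Group.group
begin

text \<open>Trades the centre of a quotient for commutators, the form in which the series meets the
  filtration of characters.\<close>

lemma upper_central_Suc:
  assumes Z: "upper_central G k \<lhd> G"
  shows "upper_central G (Suc k) = {b \<in> carrier G. \<forall>g \<in> carrier G. cmt g b \<in> upper_central G k}"
proof -
  define Y where "Y = upper_central G k"
  interpret Y: normal Y G using Z by (simp add: Y_def)
  have YG: "Y \<subseteq> carrier G" by (rule Y.subset)
  have "Y #> b \<in> center (G Mod Y) \<longleftrightarrow> (\<forall>g \<in> carrier G. cmt g b \<in> Y)" if b: "b \<in> carrier G" for b
  proof -
    have *: "(Y #> b) <#> (Y #> g) = (Y #> g) <#> (Y #> b) \<longleftrightarrow> cmt g b \<in> Y" if g: "g \<in> carrier G" for g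
    proof -
      have "(Y #> b) <#> (Y #> g) = (Y #> g) <#> (Y #> b) \<longleftrightarrow> Y #> (b \<otimes> g) = Y #> (g \<otimes> b)"
        using Y.rcos_sum b g by simp
      also have "\<dots> \<longleftrightarrow> g \<otimes> b \<in> Y #> (b \<otimes> g)"
        using repr_independence[of "g \<otimes> b" Y "b \<otimes> g"] rcos_self[of "g \<otimes> b" Y] b g Y.subgroup_axioms by auto
      also have "\<dots> \<longleftrightarrow> cmt g b \<in> Y"
      proof
        assume "g \<otimes> b \<in> Y #> (b \<otimes> g)"
        then obtain u where u: "u \<in> Y" "g \<otimes> b = u \<otimes> (b \<otimes> g)" unfolding r_coset_def by blast
        then have "cmt g b = u" using b g YG by (auto simp: cmt_def m_assoc)
        then show "cmt g b \<in> Y" using u by simp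
      next
        assume "cmt g b \<in> Y"
        moreover have "g \<otimes> b = cmt g b \<otimes> (b \<otimes> g)" using b g by (simp add: cmt_def m_assoc)
        ultimately show "g \<otimes> b \<in> Y #> (b \<otimes> g)" unfolding r_coset_def by blast
      qed
      finally show ?thesis .
    qed
    have "Y #> b \<in> carrier (G Mod Y)" using b YG by (simp add: FactGroup_def rcosetsI)
    then have "Y #> b \<in> center (G Mod Y) \<longleftrightarrow> (\<forall>g \<in> carrier G. (Y #> b) <#> (Y #> g) = (Y #> g) <#> (Y #> b))"
      by (auto simp: center_def FactGroup_def RCOSETS_def)
    then show ?thesis using * by blast
  qed
  then show ?thesis unfolding upper_central.simps Y_def[symmetric] by blast
qed

lemma upper_central_normal: "upper_central G k \<lhd> G"
proof (induction k)
  case 0 then show ?case using one_is_normal by simp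
next
  case (Suc k)
  define Y where "Y = upper_central G k"
  define Z where "Z = upper_central G (Suc k)"
  have Y: "subgroup Y G" "\<And>g h. g \<in> carrier G \<Longrightarrow> h \<in> Y \<Longrightarrow> cnj g h \<in> Y"
    using Suc by (auto simp: Y_def normal_cnj_iff)
  have Zeq: "Z = {b \<in> carrier G. \<forall>g \<in> carrier G. cmt g b \<in> Y}" unfolding Z_def Y_def by (rule upper_central_Suc[OF Suc])
  have ZI: "b \<in> Z" if "b \<in> carrier G" "\<And>g. g \<in> carrier G \<Longrightarrow> cmt g b \<in> Y" for b using that by (simp add: Zeq)
  have ZG: "b \<in> carrier G" and ZD: "\<And>g. g \<in> carrier G \<Longrightarrow> cmt g b \<in> Y" if "b \<in> Z" for b using that by (auto simp: Zeq)
  have "Z \<lhd> G"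
    unfolding normal_cnj_iff
  proof (intro conjI ballI subgroupI)
    show "Z \<subseteq> carrier G" using ZG by blast
    have "\<one> \<in> Z" by (rule ZI) (use subgroup.one_closed[OF Y(1)] in \<open>auto simp: cmt_cnj\<close>)
    then show "Z \<noteq> {}" by blast
    show "inv b \<in> Z" if b: "b \<in> Z" for b
    proof (rule ZI)
      fix g assume g: "g \<in> carrier G"
      have "cmt g (inv b) = cnj (inv b) (inv (cmt g b))"
        using g ZG[OF b] by (simp add: cmt_def cnj_def m_assoc inv_mult_group)
      then show "cmt g (inv b) \<in> Y" using Y(2)[OF inv_closed[OF ZG[OF b]] subgroup.m_inv_closed[OF Y(1) ZD[OF b g]]] by simp
    qed (use ZG[OF b] in simp)
    show "b \<otimes> c \<in> Z" if b: "b \<in> Z" and c: "c \<in> Z" for b c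
    proof (rule ZI)
      fix g assume g: "g \<in> carrier G"
      have "cmt g (b \<otimes> c) = cmt g b \<otimes> cnj b (cmt g c)"
        using g ZG[OF b] ZG[OF c] by (simp add: cmt_def cnj_def m_assoc inv_mult_group)
      then show "cmt g (b \<otimes> c) \<in> Y" using subgroup.m_closed[OF Y(1) ZD[OF b g] Y(2)[OF ZG[OF b] ZD[OF c g]]] by simp
    qed (use ZG[OF b] ZG[OF c] in simp)
    show "cnj h b \<in> Z" if h: "h \<in> carrier G" and b: "b \<in> Z" for h b
    proof (rule ZI)
      fix g assume g: "g \<in> carrier G"
      have "cmt g (cnj h b) = cnj h (cmt (cnj (inv h) g) b)"
        using g h ZG[OF b] by (simp add: cmt_def cnj_def m_assoc inv_mult_group)
      then show "cmt g (cnj h b) \<in> Y" using Y(2)[OF h ZD[OF b]] g h by simp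
    qed (use h ZG[OF b] in simp)
  qed
  then show ?case by (simp add: Z_def)
qed

lemma cmt_upper_central: "b \<in> upper_central G (Suc k) \<Longrightarrow> g \<in> carrier G \<Longrightarrow> cmt g b \<in> upper_central G k"
  using upper_central_Suc[OF upper_central_normal] by blast

text \<open>Ascending along the subnormal series, the largest \<open>\<tau>\<close>-extension of \<open>N\<close> inside \<open>M\<close> that is normal in
  one term is normal in the next.\<close>

lemma subnormal_extension_step:
  fixes \<tau> :: "nat \<Rightarrow> bool"
  assumes fin: "finite (carrier G)" and \<tau>: "\<And>k l. \<tau> k \<Longrightarrow> \<tau> l \<Longrightarrow> \<tau> (k * l)" "\<And>k l. \<tau> k \<Longrightarrow> l dvd k \<Longrightarrow> \<tau> l"
    and N: "N \<lhd> G" and M: "M \<lhd> G" and W: "subgroup W G" and V: "subgroup V G" "\<And>g h. g \<in> V \<Longrightarrow> h \<in> W \<Longrightarrow> cnj g h \<in> W"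
    and WV: "W \<subseteq> V"
  defines "ext \<equiv> \<lambda>W L. subgroup L G \<and> N \<subset> L \<and> L \<subseteq> M \<and> L \<subseteq> W \<and> (\<forall>g \<in> W. \<forall>h \<in> L. cnj g h \<in> L) \<and>
      (\<exists>k. card L = card N * k \<and> \<tau> k)"
  assumes L: "ext W L"
  shows "\<exists>L'. ext V L'"
proof -
  have finS: "finite S" if "subgroup S G" for S using fin subgroup.subset[OF that] finite_subset by blast
  have cpos: "card S \<noteq> 0" if "subgroup S G" for S
    using finS[OF that] subgroup.one_closed[OF that] by auto
  have sN: "subgroup N G" and nN: "\<And>g h. g \<in> carrier G \<Longrightarrow> h \<in> N \<Longrightarrow> cnj g h \<in> N"
    using N by (auto simp: normal_cnj_iff)
  have sM: "subgroup M G" and nM: "\<And>g h. g \<in> carrier G \<Longrightarrow> h \<in> M \<Longrightarrow> cnj g h \<in> M"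
    using M by (auto simp: normal_cnj_iff)
  have VG: "\<And>g. g \<in> V \<Longrightarrow> g \<in> carrier G" using subgroup.subset[OF V(1)] by blast
  interpret WW: Group.group "G\<lparr>carrier := W\<rparr>" by (rule subgroup_imp_group[OF W])
  \<comment> \<open>The index of \<open>N\<close> in a product divides the product of the two
    indices. So a maximal extension contains all others; it is the largest one.\<close>
  have prod: "ext W (L1 <#> L2)" if L1: "ext W L1" and L2: "ext W L2" for L1 L2
  proof -
    have s: "subgroup L1 G" "subgroup L2 G" "N \<subset> L1" "N \<subset> L2" "L1 \<subseteq> M" "L2 \<subseteq> M" "L1 \<subseteq> W" "L2 \<subseteq> W"
      and n1: "\<And>g h. g \<in> W \<Longrightarrow> h \<in> L1 \<Longrightarrow> cnj g h \<in> L1" and n2: "\<And>g h. g \<in> W \<Longrightarrow> h \<in> L2 \<Longrightarrow> cnj g h \<in> L2"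
      using L1 L2 by (auto simp: ext_def)
    obtain k1 k2 where k: "card L1 = card N * k1" "\<tau> k1" "card L2 = card N * k2" "\<tau> k2"
      using L1 L2 by (auto simp: ext_def)
    have G1: "\<And>g. g \<in> L1 \<Longrightarrow> g \<in> carrier G" and G2: "\<And>g. g \<in> L2 \<Longrightarrow> g \<in> carrier G" and GW: "\<And>g. g \<in> W \<Longrightarrow> g \<in> carrier G"
      using subgroup.subset[OF s(1)] subgroup.subset[OF s(2)] subgroup.subset[OF W] by blast+
    have nL1: "L1 \<lhd> G\<lparr>carrier := W\<rparr>"
      unfolding WW.normal_inv_iff using subgroup_incl[OF s(1) W s(7)] n1 m_inv_consistent[OF W] by (simp add: cnj_def)
    have sL2: "subgroup L2 (G\<lparr>carrier := W\<rparr>)" by (rule subgroup_incl[OF s(2) W s(8)])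
    have seq: "L1 <#>\<^bsub>G\<lparr>carrier := W\<rparr>\<^esub> L2 = L1 <#> L2" by (simp add: set_mult_def)
    note m = WW.set_mult_mem[OF nL1 sL2, unfolded seq]
    have sP: "subgroup (L1 <#> L2) G" by (rule incl_subgroup[OF W m(1)])
    have cm: "card (L1 <#> L2) * card (L1 \<inter> L2) = card L1 * card L2"
      using WW.card_set_mult[OF _ nL1 sL2] finS[OF W] seq by simp
    obtain c where c: "card (L1 \<inter> L2) = card N * c"
      using card_subgroup_dvd[OF fin sN subgroups_Inter_pair[OF s(1,2)]] s(3,4) by (auto simp: dvd_def)
    obtain d where d: "card (L1 <#> L2) = card N * d"
      using card_subgroup_dvd[OF fin sN sP] s(3) m(2) by (auto simp: dvd_def)
    have "(card N * card N) * (d * c) = (card N * card N) * (k1 * k2)"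
      using cm unfolding c d k(1,3) by (simp only: ac_simps)
    then have "d * c = k1 * k2" using cpos[OF sN] by simp
    then have "\<tau> d" using \<tau>(2)[OF \<tau>(1)[OF k(2,4)], of d] by (metis dvd_triv_left)
    moreover have "cnj g h \<in> L1 <#> L2" if g: "g \<in> W" and h: "h \<in> L1 <#> L2" for g h
    proof -
      obtain a b where ab: "a \<in> L1" "b \<in> L2" "h = a \<otimes> b" using h unfolding set_mult_def by blast
      have "cnj g h = cnj g a \<otimes> cnj g b" using ab G1 G2 GW[OF g] by (simp add: cnj_hom)
      then show ?thesis using n1[OF g ab(1)] n2[OF g ab(2)] unfolding set_mult_def by blast
    qed
    moreover have "L1 <#> L2 \<subseteq> M" using s(5,6) subgroup.m_closed[OF sM] unfolding set_mult_def by blast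
    moreover have "L1 <#> L2 \<subseteq> W" using subgroup.subset[OF m(1)] by simp
    ultimately show ?thesis unfolding ext_def using sP s(3) m(2) d by blast
  qed
  define \<E> where "\<E> = {L. ext W L}"
  have "finite \<E>"
    by (rule finite_subset[of _ "Pow (carrier G)"]) (use fin subgroup.subset in \<open>auto simp: \<E>_def ext_def\<close>)
  moreover have "L \<in> \<E>" using L by (simp add: \<E>_def)
  ultimately obtain K where K\<E>: "K \<in> \<E>" and max: "\<And>L. L \<in> \<E> \<Longrightarrow> K \<subseteq> L \<Longrightarrow> L = K"
    using finite_has_maximal[of \<E>] by blast
  have eK: "ext W K" using K\<E> by (simp add: \<E>_def)
  then have sK: "subgroup K G" "N \<subset> K" "K \<subseteq> M" "K \<subseteq> W" and nK: "\<And>g h. g \<in> W \<Longrightarrow> h \<in> K \<Longrightarrow> cnj g h \<in> K"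
    by (auto simp: ext_def)
  obtain k where k: "card K = card N * k" "\<tau> k" using eK by (auto simp: ext_def)
  have KG: "\<And>g. g \<in> K \<Longrightarrow> g \<in> carrier G" using subgroup.subset[OF sK(1)] by blast
  have contain: "L1 \<subseteq> K" if L1: "ext W L1" for L1
  proof -
    have s1: "subgroup L1 G" "L1 \<subseteq> W" using L1 by (auto simp: ext_def)
    have nK': "K \<lhd> G\<lparr>carrier := W\<rparr>"
      unfolding WW.normal_inv_iff using subgroup_incl[OF sK(1) W sK(4)] nK m_inv_consistent[OF W] by (simp add: cnj_def)
    note m = WW.set_mult_mem[OF nK' subgroup_incl[OF s1(1) W s1(2)]]
    have "K <#> L1 \<in> \<E>" using prod[OF eK L1] by (simp add: \<E>_def)
    then have "K <#> L1 = K" using max m(2) by (simp add: set_mult_def)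
    then show ?thesis using m(3) by (simp add: set_mult_def)
  qed
  \<comment> \<open>Conjugation by \<open>g\<close> in \<open>V\<close> preserves \<open>N\<close>,
    \<open>M\<close> and \<open>W\<close>, so it carries extensions to extensions of the same index;
    the largest one is therefore invariant.\<close>
  have "cnj g h \<in> K" if g: "g \<in> V" and h: "h \<in> K" for g h
  proof -
    have gG: "g \<in> carrier G" by (rule VG[OF g])
    have gi: "inv g \<in> V" using V(1) g by (rule subgroup.m_inv_closed)
    have inj: "inj_on (cnj g) K" by (rule inj_on_inverseI[where g = "cnj (inv g)"]) (use gG KG in simp)
    have "ext W (cnj g ` K)"
      unfolding ext_def
    proof (intro conjI ballI)
      show "subgroup (cnj g ` K) G"
      proof (rule subgroupI)
        show "cnj g ` K \<subseteq> carrier G" using gG KG by auto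
        show "cnj g ` K \<noteq> {}" using subgroup.one_closed[OF sK(1)] by blast
        show "inv a \<in> cnj g ` K" if "a \<in> cnj g ` K" for a
          using that gG KG subgroup.m_inv_closed[OF sK(1)] by (auto simp: cnj_inv[symmetric])
        show "a \<otimes> b \<in> cnj g ` K" if "a \<in> cnj g ` K" "b \<in> cnj g ` K" for a b
          using that gG KG subgroup.m_closed[OF sK(1)] by (auto simp: cnj_hom[symmetric])
      qed
      have "N \<subseteq> cnj g ` K"
      proof
        fix u assume u: "u \<in> N"
        then have "u = cnj g (cnj (inv g) u)" using gG subgroup.mem_carrier[OF sN] by simp
        moreover have "cnj (inv g) u \<in> K" using nN[OF inv_closed[OF gG] u] sK(2) by blast
        ultimately show "u \<in> cnj g ` K" by blast
      qed
      moreover have "card (cnj g ` K) = card K" by (rule card_image[OF inj])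
      ultimately show "N \<subset> cnj g ` K"
        using psubset_card_mono[OF finS[OF sK(1)] sK(2)] by auto
      show "cnj g ` K \<subseteq> M" using nM[OF gG] sK(3) by blast
      show "cnj g ` K \<subseteq> W" using V(2)[OF g] sK(4) by blast
      show "\<exists>k. card (cnj g ` K) = card N * k \<and> \<tau> k" using k card_image[OF inj] by metis
      fix u v assume u: "u \<in> W" and "v \<in> cnj g ` K"
      then obtain w where w: "w \<in> K" "v = cnj g w" by blast
      have uG: "u \<in> carrier G" using subgroup.mem_carrier[OF W u] .
      have "cnj u v = cnj g (cnj (cnj (inv g) u) w)"
        using w gG uG KG by (simp add: cnj_def m_assoc inv_mult_group)
      moreover have "cnj (cnj (inv g) u) w \<in> K" using nK[OF V(2)[OF gi u] w(1)] .
      ultimately show "cnj u v \<in> cnj g ` K" by blast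
    qed
    then show ?thesis using contain h by blast
  qed
  then have "ext V K" unfolding ext_def using sK WV k by blast
  then show ?thesis by blast
qed

text \<open>At the first term of the series where \<open>M\<close> leaves \<open>N\<close>, the
  product of \<open>N\<close> with the intersection is an extension of the right kind, normal only
  locally. The chain of the groups \<open>N H l\<close> leads from there up to \<open>G\<close>, and
  each step restores normality one term higher.\<close>

lemma p_soluble_imp_p_chief_factors:
  assumes p: "Factorial_Ring.prime (p::nat)" and sol: "p_soluble p G"
  shows "p_chief_factors p G"
  unfolding p_chief_factors_def
proof (intro allI impI)
  fix N M assume N: "N \<lhd> G" and M: "M \<lhd> G" and NM: "N \<subset> M"
  have fin: "finite (carrier G)" using sol by (simp add: p_soluble_def)
  obtain n :: nat and H where H0: "H 0 = {\<one>}" and Hn: "H n = carrier G" and sH: "\<And>i. i \<le> n \<Longrightarrow> subgroup (H i) G"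
    and nH: "\<And>i. i < n \<Longrightarrow> H i \<lhd> G\<lparr>carrier := H (Suc i)\<rparr>"
    and fH: "\<And>i. i < n \<Longrightarrow> p_group p (G\<lparr>carrier := H (Suc i)\<rparr> Mod H i) \<or> p'_group p (G\<lparr>carrier := H (Suc i)\<rparr> Mod H i)"
    using sol unfolding p_soluble_def by blast
  have finS: "finite S" if "subgroup S G" for S using fin subgroup.subset[OF that] finite_subset by blast
  have cpos: "card S \<noteq> 0" if "subgroup S G" for S
    using finS[OF that] subgroup.one_closed[OF that] by auto
  have sN: "subgroup N G" and nN: "\<And>g h. g \<in> carrier G \<Longrightarrow> h \<in> N \<Longrightarrow> cnj g h \<in> N"
    using N by (auto simp: normal_cnj_iff)
  have sM: "subgroup M G" and nM: "\<And>g h. g \<in> carrier G \<Longrightarrow> h \<in> M \<Longrightarrow> cnj g h \<in> M"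
    using M by (auto simp: normal_cnj_iff)
  define i where "i = (LEAST i. \<not> M \<inter> H i \<subseteq> N)"
  have "\<not> M \<inter> H n \<subseteq> N" using NM subgroup.subset[OF sM] Hn by blast
  then have i: "\<not> M \<inter> H i \<subseteq> N" and i_le: "i \<le> n" unfolding i_def by (rule LeastI, rule Least_le)
  have "i \<noteq> 0" using i H0 subgroup.one_closed[OF sN] by (intro notI) auto
  then obtain j where j: "i = Suc j" by (cases i) auto
  have jN: "M \<inter> H j \<subseteq> N" using not_less_Least[of j "\<lambda>i. \<not> M \<inter> H i \<subseteq> N"] j unfolding i_def by (metis lessI)
  have jn: "j < n" using i_le j by simp
  have sHi: "subgroup (H i) G" and sHj: "subgroup (H j) G" using sH i_le jn by auto
  interpret Hi: Group.group "G\<lparr>carrier := H i\<rparr>" by (rule subgroup_imp_group[OF sHi])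
  have nHj: "H j \<lhd> G\<lparr>carrier := H i\<rparr>" using nH[OF jn] j by simp
  define q where "q = order (G\<lparr>carrier := H i\<rparr> Mod H j)"
  have q: "q * card (H j) = card (H i)"
    using Hi.lagrange[OF normal_imp_subgroup[OF nHj]] by (simp add: q_def order_def FactGroup_def)
  \<comment> \<open>The type is fixed once by the order of the critical factor. Closure under
    products and divisors is all that the ascent asks of it.\<close>
  define \<tau> where "\<tau> = (if \<exists>i. q = p ^ i then (\<lambda>k. \<exists>i. k = p ^ i) else (\<lambda>k. coprime k p))"
  have \<tau>q: "\<tau> q" using fH[OF jn] j by (auto simp: \<tau>_def q_def p_group_def p'_group_def)
  have \<tau>_mult: "\<tau> (k * l)" if "\<tau> k" "\<tau> l" for k l
    using that by (auto simp: \<tau>_def power_add[symmetric] split: if_splits)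
  have \<tau>_dvd: "\<tau> l" if "\<tau> k" "l dvd k" for k l
  proof (cases "\<exists>i. q = p ^ i")
    case True then show ?thesis using that p by (auto simp: \<tau>_def divides_primepow_nat)
  next
    case False
    then have "coprime k p" using that(1) by (simp add: \<tau>_def)
    then have "coprime l p" using that(2) coprime_divisors dvd_refl by blast
    then show ?thesis using False by (simp add: \<tau>_def)
  qed
  define A where "A = M \<inter> H i"
  have sA: "subgroup A G" unfolding A_def by (rule subgroups_Inter_pair[OF sM sHi])
  have AG: "\<And>g. g \<in> A \<Longrightarrow> g \<in> carrier G" using subgroup.subset[OF sA] by blast
  define L where "L = N <#> A"
  note Lm = set_mult_mem[OF N sA, folded L_def]
  \<comment> \<open>The original series multiplied by \<open>N\<close>; every term contains
    \<open>N\<close> and is normalised by the next.\<close>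
  define Y where "Y l = N <#> H l" for l
  have Ym: "subgroup (Y l) G" "N \<subseteq> Y l" "H l \<subseteq> Y l" if "l \<le> n" for l
    unfolding Y_def using set_mult_mem[OF N sH[OF that]] by auto
  have NG: "\<And>g. g \<in> N \<Longrightarrow> g \<in> carrier G" using subgroup.subset[OF sN] by blast
  have stable: "cnj g h \<in> W" if W: "subgroup W G" "N \<subseteq> W" and Hs: "\<And>g h. g \<in> H l \<Longrightarrow> h \<in> W \<Longrightarrow> cnj g h \<in> W"
    and l: "l \<le> n" and g: "g \<in> Y l" and h: "h \<in> W" for W l g h
  proof -
    obtain u v where uv: "u \<in> N" "v \<in> H l" "g = u \<otimes> v" using g unfolding Y_def set_mult_def by blast
    have vG: "v \<in> carrier G" using subgroup.mem_carrier[OF sH[OF l] uv(2)] .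
    have "cnj g h = cnj u (cnj v h)" using uv(3) cnj_mult[OF NG[OF uv(1)] vG subgroup.mem_carrier[OF W(1) h]] by simp
    moreover have "cnj v h \<in> W" by (rule Hs[OF uv(2) h])
    moreover have "u \<in> W" using uv(1) W(2) by blast
    ultimately show ?thesis using W(1) by (simp add: cnj_def subgroup.m_closed subgroup.m_inv_closed)
  qed
  define ext where "ext = (\<lambda>W L. subgroup L G \<and> N \<subset> L \<and> L \<subseteq> M \<and> L \<subseteq> W \<and> (\<forall>g \<in> W. \<forall>h \<in> L. cnj g h \<in> L) \<and>
      (\<exists>k. card L = card N * k \<and> \<tau> k))"
  have base: "ext (Y i) L"
    unfolding ext_def
  proof (intro conjI ballI)
    show "subgroup L G" by (rule Lm(1))
    show "N \<subset> L" using Lm(2,3) i by (auto simp: A_def)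
    show "L \<subseteq> M" using NM subgroup.m_closed[OF sM] unfolding L_def set_mult_def A_def by blast
    show "L \<subseteq> Y i" unfolding L_def Y_def set_mult_def A_def by blast
    show "cnj g h \<in> L" if "g \<in> Y i" "h \<in> L" for g h
    proof (rule stable[OF Lm(1,2) _ i_le that])
      fix g h assume g: "g \<in> H i" and "h \<in> L"
      then obtain u v where uv: "u \<in> N" "v \<in> A" "h = u \<otimes> v" unfolding L_def set_mult_def by blast
      have gG: "g \<in> carrier G" using subgroup.mem_carrier[OF sHi g] .
      have "cnj g v \<in> A" using uv(2) nM[OF gG] g sHi unfolding A_def by (simp add: cnj_def subgroup.m_closed subgroup.m_inv_closed)
      moreover have "cnj g h = cnj g u \<otimes> cnj g v" using uv(3) cnj_hom[OF gG NG[OF uv(1)] AG[OF uv(2)]] by simp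
      ultimately show "cnj g h \<in> L" using nN[OF gG uv(1)] unfolding L_def set_mult_def by blast
    qed
    obtain k where k: "card L = card N * k" using card_subgroup_dvd[OF fin sN Lm(1,2)] by (auto simp: dvd_def)
    have "card L * card (N \<inter> A) = card N * card A" unfolding L_def by (rule card_set_mult[OF fin N sA])
    then have "card N * (k * card (N \<inter> A)) = card N * card A" unfolding k by (simp only: ac_simps)
    then have kA: "k * card (N \<inter> A) = card A" using cpos[OF sN] by simp
    have sAi: "subgroup A (G\<lparr>carrier := H i\<rparr>)" using subgroup_incl[OF sA sHi] by (simp add: A_def)
    have seq: "H j <#>\<^bsub>G\<lparr>carrier := H i\<rparr>\<^esub> A = H j <#> A" by (simp add: set_mult_def)
    note m = Hi.set_mult_mem[OF nHj sAi, unfolded seq]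
    have cm: "card (H j <#> A) * card (H j \<inter> A) = card (H j) * card A"
      using Hi.card_set_mult[OF _ nHj sAi] finS[OF sHi] seq by simp
    have sHA: "subgroup (H j <#> A) G" by (rule incl_subgroup[OF sHi m(1)])
    obtain e where e: "card (H j <#> A) = card (H j) * e" using card_subgroup_dvd[OF fin sHj sHA m(2)] by (auto simp: dvd_def)
    obtain e' where e': "card (H i) = card (H j <#> A) * e'"
      using card_subgroup_dvd[OF fin sHA sHi] subgroup.subset[OF m(1)] by (auto simp: dvd_def)
    have "card (H j) * q = card (H j) * (e * e')" using q e e' by (simp add: ac_simps)
    then have eq: "e dvd q" using cpos[OF sHj] by simp
    have "card (H j) * (e * card (H j \<inter> A)) = card (H j) * card A" using cm unfolding e by (simp only: ac_simps)
    then have eA: "e * card (H j \<inter> A) = card A" using cpos[OF sHj] by simp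
    have sHjA: "subgroup (H j \<inter> A) G" and sNA: "subgroup (N \<inter> A) G" by (rule subgroups_Inter_pair[OF sHj sA], rule subgroups_Inter_pair[OF sN sA])
    \<comment> \<open>By minimality of \<open>i\<close> the previous term meets \<open>M\<close>
      inside \<open>N\<close>. Hence the index of \<open>N\<close> in \<open>L\<close> divides that
      of \<open>H j\<close> in \<open>H j A\<close>, which divides the order of the factor.\<close>
    have "H j \<inter> A \<subseteq> N \<inter> A" using jN by (auto simp: A_def)
    then obtain f where f: "card (N \<inter> A) = card (H j \<inter> A) * f" using card_subgroup_dvd[OF fin sHjA sNA] by (auto simp: dvd_def)
    have "card (H j \<inter> A) * (k * f) = card (H j \<inter> A) * e" using kA eA unfolding f by (simp only: ac_simps)
    then have "k dvd e" using cpos[OF sHjA] by (metis dvd_triv_left mult_left_cancel)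
    then have "\<tau> k" using \<tau>_dvd[OF \<tau>q] eq dvd_trans by blast
    then show "\<exists>k. card L = card N * k \<and> \<tau> k" using k by blast
  qed
  have "\<exists>L. ext (Y l) L" if "i \<le> l" "l \<le> n" for l
    using that
  proof (induction l rule: dec_induct)
    case base then show ?case using \<open>ext (Y i) L\<close> by blast
  next
    case (step l)
    then obtain L' where L': "ext (Y l) L'" by auto
    have l: "l < n" "l \<le> n" "Suc l \<le> n" using step by auto
    have Hl: "H l \<subseteq> H (Suc l)" and nHl: "\<And>g h. g \<in> H (Suc l) \<Longrightarrow> h \<in> H l \<Longrightarrow> cnj g h \<in> H l"
    proof -
      interpret HS: Group.group "G\<lparr>carrier := H (Suc l)\<rparr>" by (rule subgroup_imp_group[OF sH[OF l(3)]])
      have *: "subgroup (H l) (G\<lparr>carrier := H (Suc l)\<rparr>)"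
        "\<forall>x \<in> H (Suc l). \<forall>h \<in> H l. x \<otimes> h \<otimes> inv\<^bsub>G\<lparr>carrier := H (Suc l)\<rparr>\<^esub> x \<in> H l"
        using nH[OF l(1)] unfolding HS.normal_inv_iff by auto
      show "H l \<subseteq> H (Suc l)" using subgroup.subset[OF *(1)] by simp
      show "cnj g h \<in> H l" if "g \<in> H (Suc l)" "h \<in> H l" for g h
        using *(2) that m_inv_consistent[OF sH[OF l(3)]] by (simp add: cnj_def)
    qed
    have "\<exists>L'. subgroup L' G \<and> N \<subset> L' \<and> L' \<subseteq> M \<and> L' \<subseteq> Y (Suc l) \<and> (\<forall>g \<in> Y (Suc l). \<forall>h \<in> L'. cnj g h \<in> L') \<and>
      (\<exists>k. card L' = card N * k \<and> \<tau> k)"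
    proof (rule subnormal_extension_step[OF fin _ _ N M Ym(1)[OF l(2)] Ym(1)[OF l(3)]])
      show "Y l \<subseteq> Y (Suc l)" using Hl unfolding Y_def set_mult_def by blast
      show "\<tau> (k * l)" if "\<tau> k" "\<tau> l" for k l by (rule \<tau>_mult[OF that])
      show "\<tau> l" if "\<tau> k" "l dvd k" for k l by (rule \<tau>_dvd[OF that])
      show "cnj g h \<in> Y l" if "g \<in> Y (Suc l)" "h \<in> Y l" for g h
      proof (rule stable[OF Ym(1,2)[OF l(2)] _ l(3) that])
        fix g h assume g: "g \<in> H (Suc l)" and "h \<in> Y l"
        then obtain u v where uv: "u \<in> N" "v \<in> H l" "h = u \<otimes> v" unfolding Y_def set_mult_def by blast
        have gG: "g \<in> carrier G" using subgroup.mem_carrier[OF sH[OF l(3)] g] .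
        have "cnj g h = cnj g u \<otimes> cnj g v"
          using uv(3) cnj_hom[OF gG NG[OF uv(1)] subgroup.mem_carrier[OF sH[OF l(2)] uv(2)]] by simp
        then show "cnj g h \<in> Y l" using nN[OF gG uv(1)] nHl[OF g uv(2)] unfolding Y_def set_mult_def by blast
      qed
    qed (use L' in \<open>simp add: ext_def\<close>)
    then show ?case by (simp add: ext_def)
  qed
  from this[OF i_le order_refl] obtain L' where L': "ext (Y n) L'" by blast
  have "Y n = carrier G" using Ym(3)[of n] subgroup.subset[OF Ym(1)[of n]] Hn by auto
  obtain k where k: "card L' = card N * k" "\<tau> k" using L' by (auto simp only: ext_def)
  have "L' \<lhd> G" "N \<subset> L'" "L' \<subseteq> M" using L' \<open>Y n = carrier G\<close> by (simp_all add: ext_def normal_cnj_iff)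
  moreover have "(\<exists>i. k = p ^ i) \<or> coprime k p" using k(2) by (simp add: \<tau>_def split: if_splits)
  ultimately show "\<exists>L k. L \<lhd> G \<and> N \<subset> L \<and> L \<subseteq> M \<and> card L = card N * k \<and> ((\<exists>i. k = p ^ i) \<or> coprime k p)"
    using k(1) by blast
qed

end

section \<open>Images under homomorphisms\<close>

context group_hom
begin

lemma hom_cnj: "g \<in> carrier G \<Longrightarrow> a \<in> carrier G \<Longrightarrow> h (G.cnj g a) = H.cnj (h g) (h a)"
  by (simp add: G.cnj_def H.cnj_def)

lemma hom_cmt: "g \<in> carrier G \<Longrightarrow> a \<in> carrier G \<Longrightarrow> h (G.cmt g a) = H.cmt (h g) (h a)"
  by (simp add: G.cmt_def H.cmt_def)

lemma card_vimage:
  assumes fin: "finite (carrier G)" and surj: "h ` carrier G = carrier H" and S: "S \<subseteq> carrier H"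
  shows "card {x \<in> carrier G. h x \<in> S} = card S * card (kernel G H h)"
proof -
  define F where "F y = {x \<in> carrier G. h x = y}" for y
  have finF: "finite (F y)" for y unfolding F_def using fin by simp
  have finS: "finite S" by (rule finite_subset[OF S]) (simp add: surj[symmetric] fin)
  have cF: "card (F y) = card (kernel G H h)" if y: "y \<in> S" for y
  proof -
    have "y \<in> h ` carrier G" unfolding surj using y S by blast
    then obtain x where x: "x \<in> carrier G" "h x = y" by blast
    have "bij_betw (\<lambda>k. k \<otimes> x) (kernel G H h) (F y)"
    proof (rule bij_betw_byWitness[where f' = "\<lambda>z. z \<otimes> inv x"])
      show "\<forall>k \<in> kernel G H h. k \<otimes> x \<otimes> inv x = k" using x by (auto simp: kernel_def G.m_assoc)
      show "\<forall>z \<in> F y. z \<otimes> inv x \<otimes> x = z" using x by (auto simp: F_def G.m_assoc)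
      show "(\<lambda>k. k \<otimes> x) ` kernel G H h \<subseteq> F y" using x by (auto simp: kernel_def F_def)
      show "(\<lambda>z. z \<otimes> inv x) ` F y \<subseteq> kernel G H h" using x by (auto simp: kernel_def F_def)
    qed
    then show ?thesis by (rule bij_betw_same_card[symmetric])
  qed
  have "{x \<in> carrier G. h x \<in> S} = (\<Union>y \<in> S. F y)" by (auto simp: F_def)
  also have "card \<dots> = (\<Sum>y \<in> S. card (F y))"
    by (rule card_UN_disjoint[OF finS]) (use finF in \<open>auto simp: F_def\<close>)
  also have "\<dots> = card S * card (kernel G H h)" using cF by simp
  finally show ?thesis .
qed

lemma order_surj:
  assumes "finite (carrier G)" "h ` carrier G = carrier H"
  shows "order G = order H * card (kernel G H h)"
proof -
  have "{x \<in> carrier G. h x \<in> carrier H} = carrier G" by auto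
  then show ?thesis using card_vimage[OF assms order_refl] by (simp add: order_def)
qed

lemma vimage_normal:
  assumes N: "N \<lhd> H"
  shows "{x \<in> carrier G. h x \<in> N} \<lhd> G"
proof -
  have sN: "subgroup N H" and nN: "\<And>g x. g \<in> carrier H \<Longrightarrow> x \<in> N \<Longrightarrow> H.cnj g x \<in> N"
    using N by (auto simp: H.normal_cnj_iff)
  have "subgroup {x \<in> carrier G. h x \<in> N} G"
  proof (rule G.subgroupI)
    have "\<one> \<in> {x \<in> carrier G. h x \<in> N}" using subgroup.one_closed[OF sN] by simp
    then show "{x \<in> carrier G. h x \<in> N} \<noteq> {}" by blast
  qed (simp_all add: subset_iff subgroup.m_closed[OF sN] subgroup.m_inv_closed[OF sN])
  then show ?thesis using nN by (simp add: G.normal_cnj_iff hom_cnj)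
qed

lemma image_normal:
  assumes surj: "h ` carrier G = carrier H" and N: "N \<lhd> G"
  shows "h ` N \<lhd> H"
proof -
  have sN: "subgroup N G" and nN: "\<And>g x. g \<in> carrier G \<Longrightarrow> x \<in> N \<Longrightarrow> G.cnj g x \<in> N"
    using N by (auto simp: G.normal_cnj_iff)
  have "H.cnj y (h x) \<in> h ` N" if "y \<in> carrier H" "x \<in> N" for y x
  proof -
    have "y \<in> h ` carrier G" unfolding surj using that by blast
    then obtain g where g: "g \<in> carrier G" "y = h g" by blast
    have "H.cnj y (h x) = h (G.cnj g x)" using g that subgroup.mem_carrier[OF sN] by (simp add: hom_cnj)
    then show ?thesis using nN[OF g(1) that(2)] by blast
  qed
  then show ?thesis using subgroup_img_is_subgroup[OF sN] by (auto simp: H.normal_cnj_iff)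
qed

lemma vimage_image:
  assumes L: "subgroup L G" "kernel G H h \<subseteq> L"
  shows "{x \<in> carrier G. h x \<in> h ` L} = L"
proof
  show "L \<subseteq> {x \<in> carrier G. h x \<in> h ` L}" using subgroup.subset[OF L(1)] by blast
  show "{x \<in> carrier G. h x \<in> h ` L} \<subseteq> L"
  proof
    fix x assume "x \<in> {x \<in> carrier G. h x \<in> h ` L}"
    then obtain l where l: "x \<in> carrier G" "l \<in> L" "h x = h l" by blast
    have lG: "l \<in> carrier G" using subgroup.mem_carrier[OF L(1) l(2)] .
    have "x \<otimes> inv l \<in> kernel G H h" using l lG by (simp add: kernel_def)
    then have "x \<otimes> inv l \<otimes> l \<in> L" by (intro subgroup.m_closed[OF L(1) _ l(2)] subsetD[OF L(2)])
    then show "x \<in> L" using l(1) lG by (simp add: G.m_assoc)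
  qed
qed

lemma image_vimage:
  assumes "h ` carrier G = carrier H" "S \<subseteq> carrier H"
  shows "h ` {x \<in> carrier G. h x \<in> S} = S"
proof
  show "S \<subseteq> h ` {x \<in> carrier G. h x \<in> S}"
  proof
    fix y assume y: "y \<in> S"
    then have "y \<in> h ` carrier G" unfolding assms(1) using assms(2) by blast
    then show "y \<in> h ` {x \<in> carrier G. h x \<in> S}" using y by blast
  qed
qed blast

lemma p_chief_factors_image:
  assumes fin: "finite (carrier G)" and surj: "h ` carrier G = carrier H" and cf: "p_chief_factors p G"
  shows "p_chief_factors p H"
  unfolding p_chief_factors_def
proof (intro allI impI)
  fix N M assume N: "N \<lhd> H" and M: "M \<lhd> H" and NM: "N \<subset> M"
  define V where "V S = {x \<in> carrier G. h x \<in> S}" for S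
  have NH: "N \<subseteq> carrier H" and MH: "M \<subseteq> carrier H" 
    by (rule subgroup.subset[OF normal_imp_subgroup[OF N]], rule subgroup.subset[OF normal_imp_subgroup[OF M]])
  have hV: "h ` V S = S" if "S \<subseteq> carrier H" for S unfolding V_def by (rule image_vimage[OF surj that])
  have "V N \<subseteq> V M" using NM by (auto simp: V_def)
  moreover have "V N \<noteq> V M" 
  proof
    assume "V N = V M"
    then have "h ` V N = h ` V M" by (rule arg_cong)
    then show False using NM unfolding hV[OF NH] hV[OF MH] by simp
  qed
  ultimately have NV: "V N \<subset> V M" by (rule psubsetI)
  obtain L k where L: "L \<lhd> G" "V N \<subset> L" "L \<subseteq> V M" and k: "card L = card (V N) * k" "(\<exists>i. k = p ^ i) \<or> coprime k p"
    using cf[unfolded p_chief_factors_def, rule_format, OF vimage_normal[OF N, folded V_def] vimage_normal[OF M, folded V_def] NV]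
    by (elim exE conjE)
  have sL: "subgroup L G" using L(1) by (rule normal_imp_subgroup)
  have "kernel G H h \<subseteq> V N" using subgroup.one_closed[OF normal_imp_subgroup[OF N]] by (simp add: V_def kernel_def subset_iff)
  then have "kernel G H h \<subseteq> L" using L(2) by (simp add: psubset_eq order_trans)
  from vimage_image[OF sL this] have VL: "V (h ` L) = L" by (simp only: V_def)
  have nL: "h ` L \<lhd> H" by (rule image_normal[OF surj L(1)])
  have LH: "h ` L \<subseteq> carrier H" by (rule subgroup.subset[OF normal_imp_subgroup[OF nL]])
  have "N \<subseteq> h ` L" using image_mono[of "V N" L h] L(2) unfolding hV[OF NH] by (simp add: psubset_eq)
  moreover have "N \<noteq> h ` L" using VL L(2) by auto
  moreover have "h ` L \<subseteq> M" using image_mono[OF L(3), of h] unfolding hV[OF MH] .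
  moreover have "card (h ` L) = card N * k"
  proof -
    have "card (h ` L) * card (kernel G H h) = card N * k * card (kernel G H h)"
      using card_vimage[OF fin surj LH, folded V_def] card_vimage[OF fin surj NH, folded V_def] k(1) unfolding VL
      by (simp only: ac_simps)
    moreover have "card (kernel G H h) \<noteq> 0"
    proof -
      have "finite (kernel G H h)" using fin by (simp add: kernel_def)
      moreover have "\<one> \<in> kernel G H h" by (simp add: kernel_def)
      ultimately show ?thesis by auto
    qed
    ultimately show ?thesis by simp
  qed
  ultimately show "\<exists>L k. L \<lhd> H \<and> N \<subset> L \<and> L \<subseteq> M \<and> card L = card N * k \<and> ((\<exists>i. k = p ^ i) \<or> coprime k p)"
    using nL k(2) by blast
qed

end

section \<open>Sylow subgroups and kernels of order prime to \<open>p\<close>\<close>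

context Group.group
begin

lemma sylow_index_coprime:
  assumes fin: "finite (carrier G)" and p: "Factorial_Ring.prime p" and P: "sylow_subgroup p P G"
  shows "coprime (card (rcosets P)) p"
proof -
  have sP: "subgroup P G" and cP: "card P = p ^ multiplicity p (order G)" using P by (auto simp: sylow_subgroup_def)
  have o0: "order G \<noteq> 0" using fin by (auto simp: order_def)
  obtain y where y: "order G = p ^ multiplicity p (order G) * y" "\<not> p dvd y"
    using multiplicity_decompose'[OF o0] p by (metis not_prime_unit)
  have "card (rcosets P) * p ^ multiplicity p (order G) = p ^ multiplicity p (order G) * y"
    using card_rcosets_mult[OF fin sP] cP y(1) by (simp add: order_def)
  then have "card (rcosets P) = y" using p by (simp add: mult.commute prime_gt_0_nat)
  then have "\<not> p dvd card (rcosets P)" using y by simp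
  then show ?thesis using p prime_imp_coprime coprime_commute by blast
qed

lemma coprime_subgroups_Int:
  assumes fin: "finite (carrier G)" and A: "subgroup A G" and B: "subgroup B G" and c: "coprime (card A) (card B)"
  shows "A \<inter> B = {\<one>}"
proof -
  have I: "subgroup (A \<inter> B) G" by (rule subgroups_Inter_pair[OF A B])
  have "card (A \<inter> B) dvd card A" "card (A \<inter> B) dvd card B"
    using card_subgroup_dvd[OF fin I A] card_subgroup_dvd[OF fin I B] by auto
  then have "card (A \<inter> B) = 1" using c by (metis coprime_common_divisor_nat)
  then obtain u where "A \<inter> B = {u}" by (rule card_1_singletonE)
  then show ?thesis using subgroup.one_closed[OF I] by auto
qed

lemma sylowI:
  assumes fin: "finite (carrier G)" and p: "Factorial_Ring.prime p" and P: "subgroup P G" "card P = p ^ a" "coprime (card (rcosets P)) p"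
  shows "sylow_subgroup p P G"
proof -
  have "\<not> p dvd card (rcosets P)" using P(3) p by (metis coprime_absorb_right not_prime_unit)
  moreover have "order G = p ^ a * card (rcosets P)" using card_rcosets_mult[OF fin P(1)] P(2) by (simp add: order_def mult.commute)
  moreover have "order G \<noteq> 0" using fin by (auto simp: order_def)
  ultimately have "multiplicity p (order G) = a" using p by (intro multiplicity_decomposeI) auto
  then show ?thesis using P by (simp add: sylow_subgroup_def)
qed

end

context group_hom
begin

lemma inj_on_coprime_kernel:
  assumes fin: "finite (carrier G)" and K: "coprime (card (kernel G H h)) p" and P: "subgroup P G" "card P = p ^ a"
  shows "P \<inter> kernel G H h = {\<one>}" "inj_on h P"
proof -
  have sK: "subgroup (kernel G H h) G" by (rule subgroup_kernel)
  have PG: "\<And>x. x \<in> P \<Longrightarrow> x \<in> carrier G" using subgroup.subset[OF P(1)] by blast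
  have "coprime (card P) (card (kernel G H h))" using K P(2) by (simp add: coprime_commute)
  then show *: "P \<inter> kernel G H h = {\<one>}" by (rule G.coprime_subgroups_Int[OF fin P(1) sK])
  show "inj_on h P"
  proof (rule inj_onI)
    fix x y assume xy: "x \<in> P" "y \<in> P" "h x = h y"
    have "x \<otimes> inv y \<in> P" using xy P(1) by (simp add: subgroup.m_closed subgroup.m_inv_closed)
    moreover have "x \<otimes> inv y \<in> kernel G H h" using xy PG by (simp add: kernel_def)
    ultimately have "x \<otimes> inv y \<in> {\<one>}" unfolding *[symmetric] by blast
    then have "x \<otimes> inv y \<otimes> y = y" using xy PG by simp
    then show "x = y" using xy PG by (simp add: G.m_assoc)
  qed
qed

lemma sylow_image:
  assumes fin: "finite (carrier G)" and surj: "h ` carrier G = carrier H" and p: "Factorial_Ring.prime p"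
    and K: "coprime (card (kernel G H h)) p" and P: "sylow_subgroup p P G"
  shows "sylow_subgroup p (h ` P) H"
proof -
  have sP: "subgroup P G" and cP: "card P = p ^ multiplicity p (order G)" using P by (auto simp: sylow_subgroup_def)
  have finH: "finite (carrier H)" unfolding surj[symmetric] using fin by simp
  have c: "card (h ` P) = card P" by (rule card_image[OF inj_on_coprime_kernel(2)[OF fin K sP cP]])
  have sI: "subgroup (h ` P) H" by (rule subgroup_img_is_subgroup[OF sP])
  have "card (rcosets P) * card P = order G" using G.card_rcosets_mult[OF fin sP] by (simp add: order_def)
  also have "\<dots> = order H * card (kernel G H h)" by (rule order_surj[OF fin surj])
  also have "order H = card (rcosets\<^bsub>H\<^esub> (h ` P)) * card P"
    using H.card_rcosets_mult[OF finH sI] c by (simp add: order_def)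
  finally have "card P * card (rcosets P) = card P * (card (rcosets\<^bsub>H\<^esub> (h ` P)) * card (kernel G H h))"
    by (simp only: ac_simps)
  moreover have "card P \<noteq> 0" using cP p by (simp add: prime_gt_0_nat)
  ultimately have "card (rcosets\<^bsub>H\<^esub> (h ` P)) dvd card (rcosets P)" by simp
  then have "coprime (card (rcosets\<^bsub>H\<^esub> (h ` P))) p"
    using G.sylow_index_coprime[OF fin p P] coprime_divisors dvd_refl by blast
  then show ?thesis using H.sylowI[OF finH p sI] c cP by simp
qed

text \<open>Transports the hypotheses to the quotient. A kernel of order prime to \<open>p\<close>
  meets \<open>P\<close> trivially, so \<open>P\<close> is mapped isomorphically; maximality of the
  kernel removes normal \<open>p'\<close>-subgroups from the image.\<close>

lemma sylow_image_normal:
  assumes fin: "finite (carrier G)" and surj: "h ` carrier G = carrier H" and p: "Factorial_Ring.prime (p::nat)" "odd p"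
    and cf: "p_chief_factors p G" and K: "coprime (card (kernel G H h)) p"
    and K_max: "\<And>N. N \<lhd> G \<Longrightarrow> coprime (card N) p \<Longrightarrow> N \<subseteq> kernel G H h"
    and P: "sylow_subgroup p P G" and cent: "p_central p (p - 2) (G\<lparr>carrier := P\<rparr>)"
  shows "h ` P \<lhd> H"
proof -
  have sP: "subgroup P G" and cP: "card P = p ^ multiplicity p (order G)" using P by (auto simp: sylow_subgroup_def)
  have PG: "\<And>x. x \<in> P \<Longrightarrow> x \<in> carrier G" using subgroup.subset[OF sP] by blast
  have finH: "finite (carrier H)" unfolding surj[symmetric] using fin by simp
  have sylH: "sylow_subgroup p (h ` P) H" by (rule sylow_image[OF fin surj p(1) K P])
  let ?P = "G\<lparr>carrier := P\<rparr>"
  interpret P: Group.group ?P by (rule G.subgroup_imp_group[OF sP])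
  \<comment> \<open>Images of the terms suffice: the commutator condition survives under any
    homomorphism, without identifying the upper central series of the image.\<close>
  define Z where "Z k = h ` upper_central ?P k" for k
  have sZ: "subgroup (upper_central ?P k) G" for k
    by (rule G.incl_subgroup[OF sP normal_imp_subgroup[OF P.upper_central_normal]])
  have ZP: "upper_central ?P k \<subseteq> P" for k
    using subgroup.subset[OF normal_imp_subgroup[OF P.upper_central_normal]] by simp
  have P_cmt: "P.cmt g b = G.cmt g b" if "g \<in> P" "b \<in> P" for g b
    using that G.m_inv_consistent[OF sP] by (simp add: P.cmt_def G.cmt_def)
  show ?thesis
  proof (rule H.sylow_normal[OF finH p p_chief_factors_image[OF fin surj cf]])
    show "N = {\<one>\<^bsub>H\<^esub>}" if N: "N \<lhd> H" "coprime (card N) p" for N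
    proof -
      have NH: "N \<subseteq> carrier H" by (rule subgroup.subset[OF normal_imp_subgroup[OF N(1)]])
      have "coprime (card {x \<in> carrier G. h x \<in> N}) p" using N(2) K by (simp add: card_vimage[OF fin surj NH])
      then have "{x \<in> carrier G. h x \<in> N} \<subseteq> kernel G H h" by (rule K_max[OF vimage_normal[OF N(1)]])
      then have "h ` {x \<in> carrier G. h x \<in> N} \<subseteq> {\<one>\<^bsub>H\<^esub>}" by (auto simp: kernel_def)
      then have "N \<subseteq> {\<one>\<^bsub>H\<^esub>}" by (simp only: image_vimage[OF surj NH])
      then show ?thesis using subgroup.one_closed[OF normal_imp_subgroup[OF N(1)]] by blast
    qed
    show "subgroup (h ` P) H" by (rule subgroup_img_is_subgroup[OF sP])
    show "card (h ` P) = p ^ multiplicity p (order H)" using sylH by (simp add: sylow_subgroup_def)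
    show "coprime (card (rcosets\<^bsub>H\<^esub> (h ` P))) p" by (rule H.sylow_index_coprime[OF finH p(1) sylH])
    show "Z 0 = {\<one>\<^bsub>H\<^esub>}" by (simp add: Z_def)
    show "H.cmt g b \<in> Z k" if b: "b \<in> Z (Suc k)" and g: "g \<in> h ` P" for k b g
    proof -
      obtain b' where b': "b' \<in> upper_central ?P (Suc k)" "b = h b'" using b unfolding Z_def by (rule imageE)
      obtain g' where g': "g' \<in> P" "g = h g'" using g by (rule imageE)
      have bP: "b' \<in> P" using b'(1) ZP by blast
      have "G.cmt g' b' \<in> upper_central ?P k"
        using P.cmt_upper_central[OF b'(1), of g'] g'(1) P_cmt[OF g'(1) bP] by simp
      then show ?thesis using b' g' bP PG by (simp add: Z_def hom_cmt[symmetric])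
    qed
    show "subgroup (Z (p - 2)) H" unfolding Z_def by (rule subgroup_img_is_subgroup[OF sZ])
    \<comment> \<open>A preimage in \<open>P\<close> has its \<open>p\<close>-th power in
      \<open>P\<close> and in the kernel, so it has order dividing \<open>p\<close> already
      upstairs, where the height condition applies.\<close>
    show "s \<in> Z (p - 2)" if s: "s \<in> h ` P" "s [^]\<^bsub>H\<^esub> p = \<one>\<^bsub>H\<^esub>" for s
    proof -
      obtain u where u: "u \<in> P" "s = h u" using s(1) by blast
      have "h (u [^] p) = \<one>\<^bsub>H\<^esub>" using s(2) u PG by (simp add: hom_nat_pow)
      then have "u [^] p \<in> P \<inter> kernel G H h" using u PG G.subgroup_pow_closed[OF sP] by (simp add: kernel_def)
      then have "u [^] p = \<one>" using inj_on_coprime_kernel(1)[OF fin K sP cP] by blast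
      then have "u \<in> Omega1 p ?P" using u(1) unfolding Omega1_def
        by (intro generate.incl) (simp add: G.nat_pow_consistent[symmetric])
      then show ?thesis using cent u(2) unfolding Z_def p_central_def by blast
    qed
  qed
qed

end

section \<open>Fusion\<close>

context Group.group
begin

lemma conjugate_coset: "g <# Q #> inv g = cnj g ` Q"
  by (auto simp: l_coset_def r_coset_def cnj_def)

lemma subgroup_cnj_image:
  assumes S: "subgroup S G" and g: "g \<in> carrier G"
  shows "subgroup (cnj g ` S) G" "card (cnj g ` S) = card S"
proof -
  have SG: "\<And>x. x \<in> S \<Longrightarrow> x \<in> carrier G" using subgroup.subset[OF S] by blast
  show "subgroup (cnj g ` S) G"
  proof (rule subgroupI)
    show "cnj g ` S \<noteq> {}" using subgroup.one_closed[OF S] by blast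
    show "cnj g ` S \<subseteq> carrier G" using SG g by auto
    show "inv y \<in> cnj g ` S" if "y \<in> cnj g ` S" for y
      using that SG g subgroup.m_inv_closed[OF S] by (auto simp: cnj_inv[symmetric])
    show "y \<otimes> z \<in> cnj g ` S" if "y \<in> cnj g ` S" "z \<in> cnj g ` S" for y z
      using that SG g subgroup.m_closed[OF S] by (auto simp: cnj_hom[symmetric])
  qed
  have "inj_on (cnj g) S" by (rule inj_on_inverseI[where g = "cnj (inv g)"]) (use SG g in simp)
  then show "card (cnj g ` S) = card S" by (rule card_image)
qed

lemma mem_normalizer_iff:
  assumes fin: "finite (carrier G)" and P: "subgroup P G"
  shows "g \<in> normalizer G P \<longleftrightarrow> g \<in> carrier G \<and> (\<forall>s \<in> P. cnj g s \<in> P)"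
proof -
  have PG: "P \<subseteq> carrier G" by (rule subgroup.subset[OF P])
  have finP: "finite P" by (rule finite_subset[OF PG fin])
  have "cnj g ` P = P \<longleftrightarrow> (\<forall>s \<in> P. cnj g s \<in> P)" if g: "g \<in> carrier G"
    using card_subset_eq[OF finP, of "cnj g ` P"] subgroup_cnj_image(2)[OF P g] by blast
  then show ?thesis using PG unfolding normalizer_def stabilizer_def by (auto simp: conjugate_coset)
qed

text \<open>Inside the normaliser \<open>P Q\<close> is a \<open>p\<close>-group containing
  \<open>P\<close>, and a Sylow subgroup is maximal among those.\<close>

lemma p_subgroup_normalizer:
  assumes fin: "finite (carrier G)" and p: "Factorial_Ring.prime p" and P: "sylow_subgroup p P G"
    and Q: "subgroup Q G" "card Q = p ^ j" "Q \<subseteq> normalizer G P"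
  shows "Q \<subseteq> P"
proof -
  have sP: "subgroup P G" and cP: "card P = p ^ multiplicity p (order G)" using P by (auto simp: sylow_subgroup_def)
  have sN: "subgroup (normalizer G P) G" by (rule normalizer_imp_subgroup[OF subgroup.subset[OF sP]])
  let ?N = "G\<lparr>carrier := normalizer G P\<rparr>"
  interpret N: Group.group ?N by (rule subgroup_imp_group[OF sN])
  have nP: "P \<lhd> ?N" by (rule subgroup_in_normalizer[OF sP])
  have sQ: "subgroup Q ?N" by (rule subgroup_incl[OF Q(1) sN Q(3)])
  have eq: "P <#>\<^bsub>?N\<^esub> Q = P <#> Q" by (simp add: set_mult_def)
  note m = N.set_mult_mem[OF nP sQ, unfolded eq]
  have finN: "finite (carrier ?N)" using finite_subset[OF subgroup.subset[OF sN] fin] by simp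
  have s: "subgroup (P <#> Q) G" by (rule incl_subgroup[OF sN m(1)])
  have "card (P <#> Q) * card (P \<inter> Q) = p ^ (multiplicity p (order G) + j)"
    using N.card_set_mult[OF finN nP sQ] unfolding eq cP Q(2) by (simp only: power_add)
  then have "card (P <#> Q) dvd p ^ (multiplicity p (order G) + j)" by (metis dvd_triv_left)
  then obtain i where "card (P <#> Q) = p ^ i" using p by (auto simp: divides_primepow_nat)
  then have "P <#> Q = P" by (rule sylow_maximal[OF fin p sP sylow_index_coprime[OF fin p P] s _ m(2)])
  then show ?thesis using m(3) by simp
qed

text \<open>Frattini argument in \<open>K P\<close>: the conjugate \<open>g^-1 P g\<close> lies in
  \<open>K P\<close> and is moved into \<open>P\<close> by some \<open>a\<close> there, so
  \<open>a g^-1\<close> normalises \<open>P\<close>. Writing \<open>a = k s\<close> with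
  \<open>s\<close> in \<open>P\<close>, the factor \<open>s\<close> is absorbed by the
  normaliser.\<close>

lemma normalizer_factorization:
  assumes fin: "finite (carrier G)" and p: "Factorial_Ring.prime p" and P: "sylow_subgroup p P G"
    and K: "K \<lhd> G" "coprime (card K) p" and W: "K <#> P \<lhd> G" and g: "g \<in> carrier G"
  obtains n k where "n \<in> normalizer G P" "k \<in> K" "g = n \<otimes> k"
proof -
  have sP: "subgroup P G" and cP: "card P = p ^ multiplicity p (order G)" using P by (auto simp: sylow_subgroup_def)
  have sK: "subgroup K G" and nK: "\<And>g h. g \<in> carrier G \<Longrightarrow> h \<in> K \<Longrightarrow> cnj g h \<in> K"
    using K(1) by (auto simp: normal_cnj_iff)
  have sW: "subgroup (K <#> P) G" and nW: "\<And>g h. g \<in> carrier G \<Longrightarrow> h \<in> K <#> P \<Longrightarrow> cnj g h \<in> K <#> P"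
    using W by (auto simp: normal_cnj_iff)
  have PG: "\<And>x. x \<in> P \<Longrightarrow> x \<in> carrier G" and KG: "\<And>x. x \<in> K \<Longrightarrow> x \<in> carrier G"
    using subgroup.subset[OF sP] subgroup.subset[OF sK] by auto
  have sN: "subgroup (normalizer G P) G" by (rule normalizer_imp_subgroup[OF subgroup.subset[OF sP]])
  note m = set_mult_mem[OF K(1) sP]
  let ?W = "G\<lparr>carrier := K <#> P\<rparr>"
  interpret W: Group.group ?W by (rule subgroup_imp_group[OF sW])
  have finW: "finite (carrier ?W)" using finite_subset[OF subgroup.subset[OF sW] fin] by simp
  have PW: "subgroup P ?W" by (rule subgroup_incl[OF sP sW m(3)])
  have "card (rcosets\<^bsub>?W\<^esub> P) * card P = card (K <#> P)" using W.card_rcosets_mult[OF finW PW] by simp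
  then have "card P * (card (rcosets\<^bsub>?W\<^esub> P) * card (K \<inter> P)) = card P * card K"
    using card_set_mult[OF fin K(1) sP] by (metis mult.assoc mult.commute)
  moreover have "card P \<noteq> 0" using cP p by (simp add: prime_gt_0_nat)
  ultimately have "card (rcosets\<^bsub>?W\<^esub> P) dvd card K" by (metis dvd_triv_left mult_left_cancel)
  then have "coprime (card (rcosets\<^bsub>?W\<^esub> P)) p" using K(2) coprime_divisors dvd_refl by blast
  then have ind: "\<not> p dvd card (rcosets\<^bsub>?W\<^esub> P)" using p by (metis coprime_absorb_right not_prime_unit)
  define S where "S = cnj (inv g) ` P"
  note S = subgroup_cnj_image[OF sP inv_closed[OF g], folded S_def]
  have "S \<subseteq> K <#> P" using nW[OF inv_closed[OF g]] m(3) unfolding S_def by blast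
  then have SW: "subgroup S ?W" by (rule subgroup_incl[OF S(1) sW])
  have "card S = p ^ multiplicity p (order G)" using S(2) cP by simp
  from W.sylow_conjugate[OF finW p PW ind SW this]
  obtain a where a': "a \<in> carrier ?W" "\<forall>s \<in> S. a \<otimes>\<^bsub>?W\<^esub> s \<otimes>\<^bsub>?W\<^esub> inv\<^bsub>?W\<^esub> a \<in> P" by metis
  then have a: "a \<in> K <#> P" "\<And>s. s \<in> S \<Longrightarrow> cnj a s \<in> P"
    using m_inv_consistent[OF sW] by (auto simp: cnj_def)
  have aG: "a \<in> carrier G" using subgroup.mem_carrier[OF sW a(1)] .
  obtain k s where ks: "k \<in> K" "s \<in> P" "a = k \<otimes> s" using a(1) unfolding set_mult_def by blast
  define b where "b = a \<otimes> inv g"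
  have bG: "b \<in> carrier G" using aG g by (simp add: b_def)
  have "cnj b x \<in> P" if x: "x \<in> P" for x
    using a(2)[of "cnj (inv g) x"] x aG g PG[OF x] by (simp add: b_def S_def cnj_mult)
  then have "b \<in> normalizer G P" using bG by (simp add: mem_normalizer_iff[OF fin sP])
  moreover have "s \<in> normalizer G P"
    using ks(2) PG sP by (simp add: mem_normalizer_iff[OF fin sP] cnj_def subgroup.m_closed subgroup.m_inv_closed)
  ultimately have "inv b \<otimes> s \<in> normalizer G P" by (intro subgroup.m_closed[OF sN] subgroup.m_inv_closed[OF sN])
  moreover have "cnj (inv s) k \<in> K" using nK ks PG by simp
  moreover have "g = inv b \<otimes> s \<otimes> cnj (inv s) k"
  proof -
    have sG: "s \<in> carrier G" and kG: "k \<in> carrier G" using ks PG KG by auto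
    have "inv b \<otimes> s \<otimes> cnj (inv s) k = inv b \<otimes> (k \<otimes> s)" using bG sG kG by (simp add: cnj_def m_assoc)
    also have "\<dots> = g" using ks(3)[symmetric] aG g by (simp add: b_def inv_mult_group m_assoc)
    finally show ?thesis by simp
  qed
  ultimately show thesis by (rule that)
qed

text \<open>With \<open>g = n k\<close> and \<open>x\<close> in \<open>Q\<close>, both
  \<open>x\<close> and \<open>k x k^-1\<close> lie in \<open>P\<close>, so \<open>[k, x]\<close>
  lies in \<open>P\<close>; it also lies in the normal subgroup \<open>K\<close>. The intersection
  is trivial, so \<open>k\<close> centralises \<open>x\<close>, and \<open>g\<close> acts on
  \<open>Q\<close> as \<open>n\<close>.\<close>

lemma normalizer_controls_fusion:
  assumes fin: "finite (carrier G)" and p: "Factorial_Ring.prime p" and P: "sylow_subgroup p P G"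
    and K: "K \<lhd> G" "coprime (card K) p" and W: "K <#> P \<lhd> G"
  shows "controls_p_fusion p (normalizer G P) G"
proof -
  have sP: "subgroup P G" and cP: "card P = p ^ multiplicity p (order G)" using P by (auto simp: sylow_subgroup_def)
  have sK: "subgroup K G" and nK: "\<And>g h. g \<in> carrier G \<Longrightarrow> h \<in> K \<Longrightarrow> cnj g h \<in> K"
    using K(1) by (auto simp: normal_cnj_iff)
  have PG: "\<And>x. x \<in> P \<Longrightarrow> x \<in> carrier G" and KG: "\<And>x. x \<in> K \<Longrightarrow> x \<in> carrier G"
    using subgroup.subset[OF sP] subgroup.subset[OF sK] by auto
  have sN: "subgroup (normalizer G P) G" by (rule normalizer_imp_subgroup[OF subgroup.subset[OF sP]])
  have "P \<subseteq> normalizer G P"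
    using subgroup.subset[OF normal_imp_subgroup[OF subgroup_in_normalizer[OF sP]]] by simp
  have PK: "P \<inter> K = {\<one>}"
    by (rule coprime_subgroups_Int[OF fin sP sK]) (use cP K(2) in \<open>simp add: coprime_commute\<close>)
  have "\<exists>n \<in> normalizer G P. \<forall>x \<in> Q. cnj g x = cnj n x"
    if Q: "subgroup Q G" "Q \<subseteq> normalizer G P" "p_group p (G\<lparr>carrier := Q\<rparr>)"
      and g: "g \<in> carrier G" "cnj g ` Q \<subseteq> normalizer G P" for Q g
  proof -
    obtain j where j: "card Q = p ^ j" using Q(3) by (auto simp: p_group_def order_def)
    have QP: "Q \<subseteq> P" by (rule p_subgroup_normalizer[OF fin p P Q(1) j Q(2)])
    have gQP: "cnj g ` Q \<subseteq> P"
      by (rule p_subgroup_normalizer[OF fin p P subgroup_cnj_image(1)[OF Q(1) g(1)] _ g(2)])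
        (simp add: subgroup_cnj_image(2)[OF Q(1) g(1)] j)
    obtain n k where nk: "n \<in> normalizer G P" "k \<in> K" "g = n \<otimes> k"
      by (rule normalizer_factorization[OF fin p P K W g(1)])
    have nG: "n \<in> carrier G" and kG: "k \<in> carrier G" using subgroup.mem_carrier[OF sN nk(1)] KG[OF nk(2)] .
    have "cnj g x = cnj n x" if x: "x \<in> Q" for x
    proof -
      have xP: "x \<in> P" and xG: "x \<in> carrier G" using x QP PG by auto
      have gx: "cnj g x = cnj n (cnj k x)" using nk(3) nG kG xG by (simp add: cnj_mult)
      have "cnj g x \<in> P" using gQP x by blast
      then have "cnj (inv n) (cnj g x) \<in> P"
        using subgroup.m_inv_closed[OF sN nk(1)] by (simp add: mem_normalizer_iff[OF fin sP])
      then have kx: "cnj k x \<in> P" using gx nG kG xG by simp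
      have "cmt k x \<in> P" using kx xP sP kG xG by (simp add: cmt_cnj subgroup.m_closed subgroup.m_inv_closed)
      moreover have "cmt k x = k \<otimes> cnj x (inv k)" using kG xG by (simp add: cmt_def cnj_def m_assoc)
      then have "cmt k x \<in> K" using nK[OF xG] nk(2) sK by (simp add: subgroup.m_closed subgroup.m_inv_closed)
      ultimately have "cmt k x = \<one>" using PK by blast
      then have "cnj k x \<otimes> inv x \<otimes> x = \<one> \<otimes> x" using kG xG by (simp add: cmt_cnj)
      then have "cnj k x = x" using kG xG by (simp add: m_assoc)
      then show ?thesis using gx by simp
    qed
    then show ?thesis using nk(1) by blast
  qed
  then show ?thesis
    unfolding controls_p_fusion_def conjugate_coset using sN P \<open>P \<subseteq> normalizer G P\<close> by (auto simp: cnj_def)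
qed

end

theorem theoremE:
  fixes G :: "('a, 'b) monoid_scheme" and p :: nat and P :: "'a set"
  assumes "Factorial_Ring.prime p" and "odd p"
    and "group G" and "finite (carrier G)" and "p_soluble p G"
    and "sylow_subgroup p P G" and "p_central p (p - 2) (G\<lparr>carrier := P\<rparr>)"
  shows "sandwich_group p G \<and> controls_p_fusion p (normalizer G P) G"
proof -
  interpret Group.group G by fact
  note fin = \<open>finite (carrier G)\<close> and p = \<open>Factorial_Ring.prime p\<close> and syl = \<open>sylow_subgroup p P G\<close>
  have sP: "subgroup P G" using syl by (simp add: sylow_subgroup_def)
  have PG: "\<And>x. x \<in> P \<Longrightarrow> x \<in> carrier G" using subgroup.subset[OF sP] by blast
  define K where "K = p'_core p G"
  have nK: "K \<lhd> G" unfolding K_def by (rule p'_core_greatest(1)[OF fin])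
  interpret K: normal K G by (rule nK)
  have cK: "coprime (card K) p"
    using p'_core_greatest(2)[OF fin, of p] by (simp add: K_def p'_group_def order_def)
  have K_max: "N \<subseteq> K" if "N \<lhd> G" "coprime (card N) p" for N
    unfolding K_def by (rule p'_core_greatest(3)[OF fin that(1)])
      (use normal_subgroup_carrier[OF fin that(1)] that(2) in \<open>simp add: p'_group_def order_def\<close>)
  interpret Q: Group.group "G Mod K" by (rule K.factorgroup_is_group)
  interpret \<pi>: group_hom G "G Mod K" "\<lambda>g. K #>\<^bsub>G\<^esub> g"
    by unfold_locales (rule K.r_coset_hom_Mod)
  have ker: "kernel G (G Mod K) (\<lambda>g. K #>\<^bsub>G\<^esub> g) = K"
  proof
    show "K \<subseteq> kernel G (G Mod K) (\<lambda>g. K #>\<^bsub>G\<^esub> g)"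
      using K.rcos_const K.subset by (auto simp: kernel_def FactGroup_def)
    show "kernel G (G Mod K) (\<lambda>g. K #>\<^bsub>G\<^esub> g) \<subseteq> K"
      using rcos_self[OF _ K.subgroup_axioms] by (auto simp: kernel_def FactGroup_def)
  qed
  have surj: "(\<lambda>g. K #>\<^bsub>G\<^esub> g) ` carrier G = carrier (G Mod K)" by (auto simp: FactGroup_def RCOSETS_def)
  have finQ: "finite (carrier (G Mod K))" unfolding surj[symmetric] using fin by simp
  have cf: "p_chief_factors p G" by (rule p_soluble_imp_p_chief_factors) (use p assms(5) in simp_all)
  define R where "R = (\<lambda>g. K #>\<^bsub>G\<^esub> g) ` P"
  have nR: "R \<lhd> G Mod K" unfolding R_def
    by (rule \<pi>.sylow_image_normal[OF fin surj p \<open>odd p\<close> cf _ _ syl assms(7)]) (use ker cK K_max in auto)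
  have sylR: "sylow_subgroup p R (G Mod K)" unfolding R_def
    by (rule \<pi>.sylow_image[OF fin surj p _ syl]) (use ker cK in simp)
  have "p_core p (G Mod K) = R"
  proof -
    have "p_group p ((G Mod K)\<lparr>carrier := R\<rparr>)"
      using Q.normal_subgroup_carrier[OF finQ nR] sylR by (auto simp: p_group_def order_def sylow_subgroup_def)
    then have le: "R \<subseteq> p_core p (G Mod K)" by (rule Q.p_core_greatest(3)[OF finQ p nR])
    obtain j where "card (p_core p (G Mod K)) = p ^ j"
      using Q.p_core_greatest(2)[OF finQ p] by (auto simp: p_group_def order_def)
    then show ?thesis
      using Q.sylow_maximal[OF finQ p normal_imp_subgroup[OF nR] Q.sylow_index_coprime[OF finQ p sylR]
          normal_imp_subgroup[OF Q.p_core_greatest(1)[OF finQ p]] _ le] by blast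
  qed
  then have "sandwich_group p G" using sylR assms(5) by (simp add: sandwich_group_def K_def)
  \<comment> \<open>As the preimage of the normal subgroup \<open>R\<close>, this product is normal
    in \<open>G\<close>, which is what the Frattini argument starts from.\<close>
  moreover have "K <#>\<^bsub>G\<^esub> P = {x \<in> carrier G. K #>\<^bsub>G\<^esub> x \<in> R}"
  proof
    show "K <#>\<^bsub>G\<^esub> P \<subseteq> {x \<in> carrier G. K #>\<^bsub>G\<^esub> x \<in> R}"
    proof
      fix x assume "x \<in> K <#>\<^bsub>G\<^esub> P"
      then obtain k s where ks: "k \<in> K" "s \<in> P" "x = k \<otimes>\<^bsub>G\<^esub> s" unfolding set_mult_def by blast
      have "K #>\<^bsub>G\<^esub> x = K #>\<^bsub>G\<^esub> s" using ks PG K.subset coset_mult_assoc[of K k s] K.rcos_const[OF is_group, of k] by auto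
      then show "x \<in> {x \<in> carrier G. K #>\<^bsub>G\<^esub> x \<in> R}" using ks PG K.subset by (auto simp: R_def)
    qed
    show "{x \<in> carrier G. K #>\<^bsub>G\<^esub> x \<in> R} \<subseteq> K <#>\<^bsub>G\<^esub> P"
    proof
      fix x assume "x \<in> {x \<in> carrier G. K #>\<^bsub>G\<^esub> x \<in> R}"
      then obtain s where s: "x \<in> carrier G" "s \<in> P" "K #>\<^bsub>G\<^esub> x = K #>\<^bsub>G\<^esub> s" unfolding R_def by blast
      then have "x \<in> K #>\<^bsub>G\<^esub> s" using rcos_self[OF s(1) K.subgroup_axioms] by simp
      then show "x \<in> K <#>\<^bsub>G\<^esub> P" using s(2) unfolding set_mult_def r_coset_def by blast
    qed
  qed
  then have "K <#>\<^bsub>G\<^esub> P \<lhd> G" using \<pi>.vimage_normal[OF nR] by simp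
  then have "controls_p_fusion p (normalizer G P) G" by (rule normalizer_controls_fusion[OF fin p syl nK cK])
  ultimately show ?thesis ..
qed

end
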